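(* Let $T$ be a locally finite, infinite tree with root $o$, and consider a transient nearest neighbour random walk on $T$. Then for all functions $\varphi,\psi \in \mathcal{D}(\partial T,P)$, $$\mathcal{E}_{HD}(\varphi,\psi) = \frac12\int_{\partial T}\int_{\partial T}\bigl(\varphi(\xi)-\varphi(\eta)\bigr)\bigl(\psi(\xi)-\psi(\eta)\bigr)\,\Theta_o(\xi,\eta)\,d\nu_o(\xi)\,d\nu_o(\eta).$$
   Context: $T$ is identified with its vertex set; $x\sim y$ means $x,y$ are neighbours; for $x\neq o$, $x^-$ is the neighbour of $x$ on the geodesic from $o$ to $x$, and the edge set is $E(T) = \{[x^-,x] : x \neq o\}$. $\partial T$ is the space of ends of $T$ (equivalence classes of geodesic rays under finite symmetric difference), with the topology in which the sets $\partial T_x$ (ends with a representative ray inside the branch $T_x=\{y: x \text{ on the geodesic from } o \text{ to } y\}$) are basic open sets; for distinct $\xi,\eta$, $\xi\wedge\eta$ is the last common vertex of the rays from $o$ to $\xi$ and $\eta$. A nearest neighbour random walk is given by a stochastic matrix $P = (p(x,y))_{x,y\in T}$ with $p(x,y)>0$ iff $x\sim y$; $(Z_n)$ is the resulting Markov chain, $\mathbb{P}_x$ its law started at $x$. Transience means that the Green kernel $G(x,y) = \sum_{n\ge0} p^{(n)}(x,y)$ is finite. $F(x,y) = \mathbb{P}_x[Z_n = y \text{ for some } n\ge 0]$. $Z_n$ converges almost surely to a random end $Z_\infty$; $\nu_x(B) = \mathbb{P}_x[Z_\infty \in B]$ is the limit distribution. For $\varphi\in L^1(\partial T,\nu_o)$,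 its Poisson transform is $h_\varphi(x) = \int\varphi\,d\nu_x$. The measure $\mathsf{m}$ on $T$ is given by $\mathsf{m}(o)=1$ and, for $\pi(o,x) = [o=x_0,x_1,\dots,x_k=x]$, $\mathsf{m}(x) = \prod_{i=1}^k p(x_{i-1},x_i)/p(x_i,x_{i-1})$; conductances are $a(x^-,x) = \mathsf{m}(x)p(x,x^-)$. For $f,g : T\to\mathbb{R}$, $\mathcal{E}_T(f,g) = \sum_{[x^-,x]\in E(T)}(f(x)-f(x^-))(g(x)-g(x^-))\,a(x^-,x)$. Set $\mathcal{D}(\partial T,P) = \{\varphi\in L^1(\partial T,\nu_o) : \mathcal{E}_T(h_\varphi,h_\varphi)<\infty\}$ and $\mathcal{E}_{HD}(\varphi,\psi) = \mathcal{E}_T(h_\varphi,h_\psi)$. The Naïm kernel is $\Theta_o(\xi,\eta) = \mathsf{m}(o)/\bigl(G(o,o)F(o,\xi\wedge\eta)F(\xi\wedge\eta,o)\bigr)$ for $\xi\neq\eta$ and $\Theta_o(\xi,\xi)=+\infty$. *)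

theory Defs
  imports "HOL-Probability.Probability"
begin

text \<open>The vertex set of the tree is the whole type 'a. The root is rt and
  par x is the predecessor x^- of x (for x different from rt; par rt is irrelevant).
  The tree axiom is that every vertex reaches the root by iterating par.\<close>

definition is_rooted_tree :: "'a \<Rightarrow> ('a \<Rightarrow> 'a) \<Rightarrow> bool" where
  "is_rooted_tree rt par \<longleftrightarrow> (\<forall>x. \<exists>n. (par ^^ n) x = rt)"

definition depth :: "'a \<Rightarrow> ('a \<Rightarrow> 'a) \<Rightarrow> 'a \<Rightarrow> nat" where
  "depth rt par x = (LEAST n. (par ^^ n) x = rt)"

definition tadj :: "'a \<Rightarrow> ('a \<Rightarrow> 'a) \<Rightarrow> 'a \<Rightarrow> 'a \<Rightarrow> bool" where
  "tadj rt par x y \<longleftrightarrow> (y \<noteq> rt \<and> par y = x) \<or> (x \<noteq> rt \<and> par x = y)"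

definition in_branch :: "'a \<Rightarrow> ('a \<Rightarrow> 'a) \<Rightarrow> 'a \<Rightarrow> 'a \<Rightarrow> bool" where
  "in_branch rt par y z \<longleftrightarrow> (\<exists>j\<le>depth rt par z. (par ^^ j) z = y)"

section \<open>Ends: each end is represented by its unique geodesic ray from the root\<close>

definition rays :: "'a \<Rightarrow> ('a \<Rightarrow> 'a) \<Rightarrow> (nat \<Rightarrow> 'a) set" where
  "rays rt par = {\<xi>. \<xi> 0 = rt \<and> (\<forall>n. \<xi> (Suc n) \<noteq> rt \<and> par (\<xi> (Suc n)) = \<xi> n)}"

definition bdry_branch :: "'a \<Rightarrow> ('a \<Rightarrow> 'a) \<Rightarrow> 'a \<Rightarrow> (nat \<Rightarrow> 'a) set" where
  "bdry_branch rt par y = {\<xi> \<in> rays rt par. \<xi> (depth rt par y) = y}"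

text \<open>Borel sigma-algebra of the end space: generated by the (countably many)
  basic open sets \<partial>T_y.\<close>
definition end_space :: "'a \<Rightarrow> ('a \<Rightarrow> 'a) \<Rightarrow> (nat \<Rightarrow> 'a) measure" where
  "end_space rt par = sigma (rays rt par) (range (bdry_branch rt par))"

definition confl :: "(nat \<Rightarrow> 'a) \<Rightarrow> (nat \<Rightarrow> 'a) \<Rightarrow> 'a" where
  "confl \<xi> \<eta> = \<xi> (LEAST k. \<xi> (Suc k) \<noteq> \<eta> (Suc k))"

definition nn_random_walk :: "'a \<Rightarrow> ('a \<Rightarrow> 'a) \<Rightarrow> ('a \<Rightarrow> 'a \<Rightarrow> real) \<Rightarrow> bool" where
  "nn_random_walk rt par p \<longleftrightarrow>
     (\<forall>x y. p x y \<ge> 0) \<and> (\<forall>x y. p x y > 0 \<longleftrightarrow> tadj rt par x y) \<and>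
     (\<forall>x. (\<Sum>y\<in>{y. tadj rt par x y}. p x y) = 1)"

fun nstep :: "('a \<Rightarrow> 'a \<Rightarrow> real) \<Rightarrow> nat \<Rightarrow> 'a \<Rightarrow> 'a \<Rightarrow> real" where
  "nstep p 0 x y = (if x = y then 1 else 0)"
| "nstep p (Suc n) x y = (\<Sum>z\<in>{z. p x z \<noteq> 0}. p x z * nstep p n z y)"

definition green :: "('a \<Rightarrow> 'a \<Rightarrow> real) \<Rightarrow> 'a \<Rightarrow> 'a \<Rightarrow> real" where
  "green p x y = (\<Sum>n. nstep p n x y)"

definition transient :: "('a \<Rightarrow> 'a \<Rightarrow> real) \<Rightarrow> bool" where
  "transient p \<longleftrightarrow> (\<forall>x y. summable (\<lambda>n. nstep p n x y))"

definition walk_measure :: "('a \<Rightarrow> 'a \<Rightarrow> real) \<Rightarrow> 'a \<Rightarrow> (nat \<Rightarrow> 'a) measure" where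
  "walk_measure p x = (THE M.
     sets M = sets (PiM UNIV (\<lambda>_. count_space UNIV)) \<and>
     (\<forall>n (xs :: nat \<Rightarrow> 'a). emeasure M {\<omega>. \<forall>i\<le>n. \<omega> i = xs i} =
        ennreal ((if xs 0 = x then 1 else 0) * (\<Prod>i<n. p (xs i) (xs (Suc i))))))"

definition hitprob :: "('a \<Rightarrow> 'a \<Rightarrow> real) \<Rightarrow> 'a \<Rightarrow> 'a \<Rightarrow> real" where
  "hitprob p x y = measure (walk_measure p x) {\<omega>. \<exists>n. \<omega> n = y}"

definition limit_end :: "'a \<Rightarrow> ('a \<Rightarrow> 'a) \<Rightarrow> (nat \<Rightarrow> 'a) \<Rightarrow> (nat \<Rightarrow> 'a)" where
  "limit_end rt par \<omega> = (THE \<xi>. \<xi> \<in> rays rt par \<and>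
     (\<forall>k. eventually (\<lambda>n. in_branch rt par (\<xi> k) (\<omega> n)) sequentially))"

definition limit_distr :: "'a \<Rightarrow> ('a \<Rightarrow> 'a) \<Rightarrow> ('a \<Rightarrow> 'a \<Rightarrow> real) \<Rightarrow> 'a \<Rightarrow> (nat \<Rightarrow> 'a) measure" where
  "limit_distr rt par p x = distr (walk_measure p x) (end_space rt par) (limit_end rt par)"

definition poisson :: "'a \<Rightarrow> ('a \<Rightarrow> 'a) \<Rightarrow> ('a \<Rightarrow> 'a \<Rightarrow> real) \<Rightarrow> ((nat \<Rightarrow> 'a) \<Rightarrow> real) \<Rightarrow> 'a \<Rightarrow> real" where
  "poisson rt par p \<phi> x = (\<integral>\<xi>. \<phi> \<xi> \<partial>limit_distr rt par p x)"

definition mweight :: "'a \<Rightarrow> ('a \<Rightarrow> 'a) \<Rightarrow> ('a \<Rightarrow> 'a \<Rightarrow> real) \<Rightarrow> 'a \<Rightarrow> real" where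
  "mweight rt par p x = (\<Prod>i<depth rt par x.
      p ((par ^^ Suc i) x) ((par ^^ i) x) / p ((par ^^ i) x) ((par ^^ Suc i) x))"

definition conductance :: "'a \<Rightarrow> ('a \<Rightarrow> 'a) \<Rightarrow> ('a \<Rightarrow> 'a \<Rightarrow> real) \<Rightarrow> 'a \<Rightarrow> real" where
  "conductance rt par p x = mweight rt par p x * p x (par x)"

definition energy :: "'a \<Rightarrow> ('a \<Rightarrow> 'a) \<Rightarrow> ('a \<Rightarrow> 'a \<Rightarrow> real) \<Rightarrow> ('a \<Rightarrow> real) \<Rightarrow> ('a \<Rightarrow> real) \<Rightarrow> real" where
  "energy rt par p f g = (\<Sum>\<^sub>\<infinity>x\<in>UNIV - {rt}.
      (f x - f (par x)) * (g x - g (par x)) * conductance rt par p x)"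

definition dirichlet_space :: "'a \<Rightarrow> ('a \<Rightarrow> 'a) \<Rightarrow> ('a \<Rightarrow> 'a \<Rightarrow> real) \<Rightarrow> ((nat \<Rightarrow> 'a) \<Rightarrow> real) set" where
  "dirichlet_space rt par p = {\<phi>. integrable (limit_distr rt par p rt) \<phi> \<and>
     (\<lambda>x. (poisson rt par p \<phi> x - poisson rt par p \<phi> (par x))\<^sup>2 * conductance rt par p x)
        summable_on (UNIV - {rt})}"

definition energy_HD :: "'a \<Rightarrow> ('a \<Rightarrow> 'a) \<Rightarrow> ('a \<Rightarrow> 'a \<Rightarrow> real) \<Rightarrow> ((nat \<Rightarrow> 'a) \<Rightarrow> real) \<Rightarrow> ((nat \<Rightarrow> 'a) \<Rightarrow> real) \<Rightarrow> real" where
  "energy_HD rt par p \<phi> \<psi> = energy rt par p (poisson rt par p \<phi>) (poisson rt par p \<psi>)"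

text \<open>Naim kernel \<Theta>_o. Its value +\<infinity> on the diagonal is not representable as a
  real; on the diagonal we set it to 0 (it only ever appears multiplied by
  (\<phi> \<xi> - \<phi> \<xi>)(\<psi> \<xi> - \<psi> \<xi>) = 0, so with the measure-theoretic convention
  0 * \<infinity> = 0 the integrand is unaffected).\<close>
definition naim_kernel :: "'a \<Rightarrow> ('a \<Rightarrow> 'a) \<Rightarrow> ('a \<Rightarrow> 'a \<Rightarrow> real) \<Rightarrow> (nat \<Rightarrow> 'a) \<Rightarrow> (nat \<Rightarrow> 'a) \<Rightarrow> real" where
  "naim_kernel rt par p \<xi> \<eta> = (if \<xi> = \<eta> then 0 else
     mweight rt par p rt / (green p rt rt * hitprob p rt (confl \<xi> \<eta>) * hitprob p (confl \<xi> \<eta>) rt))"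

end

(* Write N(x) for the mass that the limit distribution from the root gives to the boundary of the
   branch at x, A(x) for the average of phi there, h for the Poisson transform, y for the predecessor
   of x and c(v) = 1/(G(o,o) F(v,o)).  Splitting the Poisson integral at an edge expresses the flow
   a(x) (h(x) - h(y)) as c(x) N(x) (A(x) - h(x)), and also as c(y) N(x) (A(x) - h(y)).  Hence the
   energy of h on the first n levels plus D_n, the sum of c(x) N(x) (A(x) - h(x))^2 over level n, is
   the c-weighted sum of the variances of A at the first n levels.  Thomson's principle in each branch
   bounds D_n by the energy beyond level n, so the energy of h is the full sum of weighted variances.
   In particular the averages are bounded in L^2, so phi is square integrable.

   On the other side, the Naim kernel is a sum, over the common vertices of two rays, of nonnegative
   increments t(x) with N(x) t(x) = c(x) - c(y).  Integrating (phi(xi) - phi(eta))^2 against the kernel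
   truncated at level n and summing by parts gives twice the same weighted variances up to level n,
   plus a remainder that tends to 0 because c increases away from the root.  Monotone convergence
   gives the identity for phi = psi, and polarisation the general case. *)

theory Submission
  imports Defs
begin

section \<open>Rooted trees and their ends\<close>

text \<open>In electrical terms \<open>c x * N x\<close> is the effective conductance from x to the
  ends beyond x, and the flow is the current of h. This is where the weights \<open>c\<close> come
  from, and why Thomson's principle bounds \<open>Dn\<close> with exactly the right constant.

  The obstacle is that \<phi> is only assumed integrable. Expanding its squared differences against
  the product measure, or speaking of its variance in a branch, needs a second moment, so the energy
  side has to be completed before the kernel side can start. Passing from the averages to \<phi>
  itself takes L1 convergence of the level averages and Fatou's lemma.

  The path law is a definite description, so it has to be constructed. After that, hitting
  probabilities and harmonic measures are handled without stopping times: functions that are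
  harmonic on a set and dominated by Green potentials are determined by their values off the set,
  and the multiplicative rules across an edge follow from this. Branches of harmonic measure zero
  are allowed; their averages are 0 by the convention for division by zero.\<close>

locale locfin_tree =
  fixes rt :: 'a and par :: "'a \<Rightarrow> 'a"
  assumes tree: "is_rooted_tree rt par"
    and locfin: "finite {y. tadj rt par x y}"
begin

abbreviation dep :: "'a \<Rightarrow> nat" where "dep \<equiv> depth rt par"
abbreviation br :: "'a \<Rightarrow> 'a set" where "br y \<equiv> {z. in_branch rt par y z}"
abbreviation Bd :: "'a \<Rightarrow> (nat \<Rightarrow> 'a) set" where "Bd \<equiv> bdry_branch rt par"
abbreviation Rays :: "(nat \<Rightarrow> 'a) set" where "Rays \<equiv> rays rt par"
abbreviation adj :: "'a \<Rightarrow> 'a \<Rightarrow> bool" where "adj \<equiv> tadj rt par"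
definition ch :: "'a \<Rightarrow> 'a set" where "ch y = {x. x \<noteq> rt \<and> par x = y}"
definition Lv :: "nat \<Rightarrow> 'a set" where "Lv n = {x. dep x = n}"

lemma par_pow_dep: "(par ^^ dep x) x = rt"
  unfolding depth_def using tree LeastI_ex[of "\<lambda>n. (par ^^ n) x = rt"]
  by (auto simp: is_rooted_tree_def)

lemma dep_rt [simp]: "dep rt = 0"
  unfolding depth_def by (rule Least_eq_0) simp

lemma dep_0_iff [simp]: "dep x = 0 \<longleftrightarrow> x = rt"
  using par_pow_dep[of x] by auto

lemma dep_par: "x \<noteq> rt \<Longrightarrow> dep x = Suc (dep (par x))"
  unfolding depth_def
  using Least_Suc[of "\<lambda>n. (par ^^ n) x = rt" "dep x"] par_pow_dep[of x]
  by (simp add: funpow_swap1)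

lemma ch_iff: "x \<in> ch y \<longleftrightarrow> x \<noteq> rt \<and> par x = y"
  by (simp add: ch_def)

lemma dep_ch: "x \<in> ch y \<Longrightarrow> dep x = Suc (dep y)"
  by (auto simp: ch_iff dep_par)

lemma nbs: "{z. adj y z} = ch y \<union> (if y = rt then {} else {par y})"
  by (auto simp: tadj_def ch_def)

lemma finite_ch [simp]: "finite (ch y)"
  using locfin[of y] unfolding nbs by simp

lemma par_notin_ch: "y \<noteq> rt \<Longrightarrow> par y \<notin> ch y"
  using dep_par[of y] dep_ch[of "par y" y] by auto

lemma adj_sym: "adj x y \<Longrightarrow> adj y x"
  by (auto simp: tadj_def)

lemma Lv_0: "Lv 0 = {rt}" by (auto simp: Lv_def)

lemma Lv_Suc: "Lv (Suc n) = (\<Union>y\<in>Lv n. ch y)"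
proof (intro equalityI subsetI)
  fix x assume "x \<in> Lv (Suc n)"
  then have "x \<noteq> rt" "dep x = Suc n" by (auto simp: Lv_def)
  then have "par x \<in> Lv n" "x \<in> ch (par x)" using dep_par[of x] by (auto simp: Lv_def ch_def)
  then show "x \<in> (\<Union>y\<in>Lv n. ch y)" by blast
qed (use dep_ch in \<open>auto simp: Lv_def\<close>)

lemma finite_Lv [simp]: "finite (Lv n)"
proof (induction n)
  case (Suc n)
  then show ?case unfolding Lv_Suc by (rule finite_UN_I) (rule finite_ch)
qed (simp add: Lv_0)

lemma sum_Lv_Suc: "sum g (Lv (Suc n)) = (\<Sum>y\<in>Lv n. sum g (ch y))"
  unfolding Lv_Suc by (rule sum.UNION_disjoint) (auto simp: ch_iff)

lemma countable_vertices: "countable (UNIV :: 'a set)"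
proof -
  have "(UNIV :: 'a set) = (\<Union>n. Lv n)" by (auto simp: Lv_def)
  then show ?thesis by (metis countable_UN countableI_type countable_finite finite_Lv)
qed

lemma vertex_induct [case_names root step]:
  assumes "P rt" and "\<And>x. x \<noteq> rt \<Longrightarrow> P (par x) \<Longrightarrow> P x"
  shows "P x"
proof (induction "dep x" arbitrary: x)
  case 0 then show ?case using assms(1) by simp
next
  case (Suc n)
  then have "x \<noteq> rt" by auto
  with Suc dep_par assms(2) show ?case by simp
qed

subsection \<open>Branches\<close>

lemma dep_par_pow: "j \<le> dep z \<Longrightarrow> dep ((par ^^ j) z) = dep z - j"
proof (induction j)
  case (Suc j)
  then have d: "dep ((par ^^ j) z) = dep z - j" by simp
  then have "(par ^^ j) z \<noteq> rt" using Suc(2) unfolding dep_0_iff[symmetric] by linarith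
  from dep_par[OF this] d show ?case by simp
qed simp

lemma in_br_iff: "z \<in> br y \<longleftrightarrow> dep y \<le> dep z \<and> (par ^^ (dep z - dep y)) z = y"
  unfolding in_branch_def mem_Collect_eq
  by (metis dep_par_pow diff_diff_cancel diff_le_self)

lemma in_br_self [simp]: "in_branch rt par y y"
  using in_br_iff[of y y] by simp

lemma in_br_par_iff: "z \<noteq> rt \<Longrightarrow> z \<noteq> y \<Longrightarrow> in_branch rt par y (par z) \<longleftrightarrow> in_branch rt par y z"
proof -
  assume z: "z \<noteq> rt" "z \<noteq> y"
  have d: "dep z = Suc (dep (par z))" using dep_par z by simp
  show ?thesis
  proof (cases "dep y \<le> dep (par z)")
    case True
    then have "(par ^^ (dep z - dep y)) z = (par ^^ (dep (par z) - dep y)) (par z)"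
      using d by (simp add: Suc_diff_le funpow_swap1)
    with True d show ?thesis using in_br_iff[of z y] in_br_iff[of "par z" y] by simp
  next
    case False
    then show ?thesis using in_br_iff[of z y] in_br_iff[of "par z" y] d z
      by (cases "dep y = dep z") auto
  qed
qed

lemma in_br_par: "in_branch rt par y (par z) \<Longrightarrow> z \<noteq> rt \<Longrightarrow> in_branch rt par y z"
  using in_br_par_iff in_br_self by metis

lemma br_dep: "in_branch rt par y z \<Longrightarrow> dep y \<le> dep z"
  using in_br_iff[of z y] by simp

lemma par_notin_br: "x \<noteq> rt \<Longrightarrow> \<not> in_branch rt par x (par x)"
  using br_dep[of x "par x"] dep_par[of x] by auto

lemma rt_in_br: "in_branch rt par x rt \<longleftrightarrow> x = rt"
  using br_dep[of x rt] in_br_self by auto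

text \<open>Absence of cycles in the form in which it is used: a branch is joined to the rest of the
  tree by a single edge. Both the cut arguments and the convergence of paths rest on this.\<close>

lemma br_exit: "adj u v \<Longrightarrow> in_branch rt par x u \<Longrightarrow> \<not> in_branch rt par x v \<Longrightarrow> u = x \<and> v = par x"
  unfolding tadj_def by (metis in_br_par in_br_par_iff)

lemma br_same_level: "in_branch rt par x z \<Longrightarrow> in_branch rt par y z \<Longrightarrow> dep x = dep y \<Longrightarrow> x = y"
  using in_br_iff[of z x] in_br_iff[of z y] by auto

lemma br_trans: "in_branch rt par x y \<Longrightarrow> in_branch rt par y z \<Longrightarrow> in_branch rt par x z"
proof -
  assume a: "in_branch rt par x y" "in_branch rt par y z"
  then have 1: "dep x \<le> dep y" "(par ^^ (dep y - dep x)) y = x"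
     "dep y \<le> dep z" "(par ^^ (dep z - dep y)) z = y"
    using in_br_iff[of y x] in_br_iff[of z y] by auto
  then have "(par ^^ ((dep y - dep x) + (dep z - dep y))) z = x"
    by (simp only: funpow_add comp_apply)
  moreover have "(dep y - dep x) + (dep z - dep y) = dep z - dep x" using 1 by simp
  ultimately show ?thesis using 1 in_br_iff[of z x] by simp
qed

subsection \<open>Rays\<close>

lemma ray_props:
  assumes "\<xi> \<in> Rays"
  shows "\<xi> 0 = rt" "\<xi> (Suc n) \<noteq> rt" "par (\<xi> (Suc n)) = \<xi> n"
  using assms by (auto simp: rays_def)

lemma dep_ray: "\<xi> \<in> Rays \<Longrightarrow> dep (\<xi> n) = n"
  by (induction n) (auto simp: ray_props dep_par)

lemma ray_par_pow: "\<xi> \<in> Rays \<Longrightarrow> (par ^^ j) (\<xi> (n + j)) = \<xi> n"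
  by (induction j) (auto simp: ray_props funpow_swap1)

lemma Bd_iff: "\<xi> \<in> Bd x \<longleftrightarrow> \<xi> \<in> Rays \<and> \<xi> (dep x) = x"
  by (simp add: bdry_branch_def)

lemma Bd_rt [simp]: "Bd rt = Rays"
  by (auto simp: Bd_iff ray_props)

lemma Bd_ray: "\<xi> \<in> Rays \<Longrightarrow> \<xi> \<in> Bd (\<xi> n)"
  by (simp add: Bd_iff dep_ray)

lemma Bd_same_level: "\<xi> \<in> Bd x \<Longrightarrow> \<xi> \<in> Bd y \<Longrightarrow> dep x = dep y \<Longrightarrow> x = y"
  by (auto simp: Bd_iff)

lemma Bd_mono: "in_branch rt par x y \<Longrightarrow> Bd y \<subseteq> Bd x"
proof
  fix \<xi> assume a: "in_branch rt par x y" "\<xi> \<in> Bd y"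
  then have "\<xi> \<in> Rays" "\<xi> (dep y) = y" by (auto simp: Bd_iff)
  moreover have "dep x \<le> dep y" "(par ^^ (dep y - dep x)) y = x" using a(1) in_br_iff[of y x] by auto
  moreover have "(par ^^ (dep y - dep x)) (\<xi> (dep x + (dep y - dep x))) = \<xi> (dep x)"
    using ray_par_pow[OF \<open>\<xi> \<in> Rays\<close>] .
  ultimately show "\<xi> \<in> Bd x" by (auto simp: Bd_iff)
qed

lemma Bd_inter_br:
  assumes "\<xi> \<in> Bd x" "\<xi> \<in> Bd y" "dep x \<le> dep y" shows "in_branch rt par x y"
proof -
  have r: "\<xi> \<in> Rays" "\<xi> (dep x) = x" "\<xi> (dep y) = y" using assms by (auto simp: Bd_iff)
  have "(par ^^ (dep y - dep x)) (\<xi> (dep x + (dep y - dep x))) = \<xi> (dep x)"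
    using ray_par_pow[OF r(1)] .
  with r assms(3) show ?thesis using in_br_iff[of y x] by simp
qed

text \<open>Branches are nested or disjoint, so the basic sets together with the empty set form an
  intersection-stable generator, as \<open>approx_indicator\<close> requires.\<close>

lemma Bd_Int: "Bd x \<inter> Bd y = {} \<or> Bd x \<inter> Bd y = Bd x \<or> Bd x \<inter> Bd y = Bd y"
proof (cases "Bd x \<inter> Bd y = {}")
  case False
  then obtain \<xi> where "\<xi> \<in> Bd x" "\<xi> \<in> Bd y" by auto
  then have "in_branch rt par x y \<or> in_branch rt par y x" using Bd_inter_br by (meson linear)
  then show ?thesis using Bd_mono by blast
qed auto

lemma Bd_subset: "Bd x \<subseteq> Rays" by (auto simp: Bd_iff)

text \<open>A ray never stops, so it continues into a successor. At a leaf both sides are empty, and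
  such a vertex carries no harmonic measure.\<close>

lemma Bd_ch: "Bd y = (\<Union>x\<in>ch y. Bd x)"
proof (intro equalityI subsetI)
  fix \<xi> assume a: "\<xi> \<in> Bd y"
  then have r: "\<xi> \<in> Rays" "\<xi> (dep y) = y" by (auto simp: Bd_iff)
  then have "\<xi> (Suc (dep y)) \<in> ch y" by (auto simp: ch_def ray_props)
  then show "\<xi> \<in> (\<Union>x\<in>ch y. Bd x)" using Bd_ray[OF r(1)] by blast
next
  fix \<xi> assume "\<xi> \<in> (\<Union>x\<in>ch y. Bd x)"
  then obtain x where x: "x \<in> ch y" "\<xi> \<in> Bd x" by auto
  then have "in_branch rt par y x" by (metis ch_iff in_br_par in_br_self)
  then show "\<xi> \<in> Bd y" using x Bd_mono by blast
qed

end

section \<open>Potential theory of a transient nearest neighbour walk\<close>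

locale tree_walk = locfin_tree +
  fixes p :: "'a \<Rightarrow> 'a \<Rightarrow> real"
  assumes walk: "nn_random_walk rt par p"
    and trans: "transient p"
begin

abbreviation G :: "'a \<Rightarrow> 'a \<Rightarrow> real" where "G \<equiv> green p"
abbreviation ns :: "nat \<Rightarrow> 'a \<Rightarrow> 'a \<Rightarrow> real" where "ns \<equiv> nstep p"
abbreviation mw :: "'a \<Rightarrow> real" where "mw \<equiv> mweight rt par p"
text \<open>The hitting probability is first treated as a quotient of Green functions, which needs no
  probability space; \<open>hitprob_eq_F\<close> identifies the two.\<close>

definition F :: "'a \<Rightarrow> 'a \<Rightarrow> real" where "F x y = G x y / G y y"

definition nb :: "'a \<Rightarrow> 'a set" where "nb x = {z. adj x z}"
text \<open>The transition operator. Its sums are finite by local finiteness, so it commutes with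
  every pointwise convergent series (\<open>Pop_suminf\<close>).\<close>

definition Pop :: "('a \<Rightarrow> real) \<Rightarrow> 'a \<Rightarrow> real" where "Pop f x = (\<Sum>z\<in>nb x. p x z * f z)"

lemma p_nonneg [simp]: "p x y \<ge> 0"
  and p_pos_iff: "p x y > 0 \<longleftrightarrow> adj x y"
  using walk by (auto simp: nn_random_walk_def)

lemma p_nz_iff: "p x y \<noteq> 0 \<longleftrightarrow> adj x y"
  using p_nonneg[of x y] p_pos_iff[of x y] by linarith

lemma nb_eq: "{z. p x z \<noteq> 0} = nb x"
  by (auto simp: nb_def p_nz_iff)

lemma sum_p: "(\<Sum>z\<in>nb x. p x z) = 1"
  using walk by (auto simp: nn_random_walk_def nb_def)

lemma finite_nb [simp]: "finite (nb x)"
  using locfin by (simp add: nb_def)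

lemma nb_sym: "x \<in> nb y \<longleftrightarrow> y \<in> nb x"
  using adj_sym by (auto simp: nb_def)

lemma p_off_nb: "z \<notin> nb x \<Longrightarrow> p x z = 0"
  using p_nz_iff by (auto simp: nb_def)

lemma p_par_pos: "x \<noteq> rt \<Longrightarrow> p x (par x) > 0" "x \<noteq> rt \<Longrightarrow> p (par x) x > 0"
  by (auto simp: p_pos_iff tadj_def)

lemma sum_nb: "(\<Sum>z\<in>nb y. g z) = sum g (ch y) + (if y = rt then 0 else g (par y))"
  using par_notin_ch[of y] by (auto simp: nb_def nbs add.commute)

lemma ns_Suc: "ns (Suc n) x y = Pop (\<lambda>z. ns n z y) x"
  by (simp add: Pop_def nb_eq)

lemma Pop_mono: "(\<And>z. z \<in> nb x \<Longrightarrow> f z \<le> g z) \<Longrightarrow> Pop f x \<le> Pop g x"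
  unfolding Pop_def by (intro sum_mono mult_left_mono) auto

lemma Pop_cong: "(\<And>z. z \<in> nb x \<Longrightarrow> f z = g z) \<Longrightarrow> Pop f x = Pop g x"
  unfolding Pop_def by (intro sum.cong) auto

lemma Pop_add: "Pop (\<lambda>z. f z + g z) x = Pop f x + Pop g x"
  by (simp add: Pop_def algebra_simps sum.distrib)

lemma Pop_diff: "Pop (\<lambda>z. f z - g z) x = Pop f x - Pop g x"
  by (simp add: Pop_def algebra_simps sum_subtractf)

lemma Pop_cmult: "Pop (\<lambda>z. k * f z) x = k * Pop f x"
  by (simp add: Pop_def sum_distrib_left algebra_simps)

lemma Pop_divide: "Pop (\<lambda>z. f z / k) x = Pop f x / k"
  by (simp add: Pop_def sum_divide_distrib)

lemma Pop_const: "Pop (\<lambda>z. k) x = k"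
  by (simp add: Pop_def sum_distrib_right[symmetric] sum_p)

lemma Pop_sum: "Pop (\<lambda>z. \<Sum>i\<in>I. f i z) x = (\<Sum>i\<in>I. Pop (f i) x)"
  unfolding Pop_def sum_distrib_left by (rule sum.swap)

lemma abs_Pop: "\<bar>Pop f x\<bar> \<le> Pop (\<lambda>z. \<bar>f z\<bar>) x"
  unfolding Pop_def by (rule order_trans[OF sum_abs]) (simp add: abs_mult)

lemma ns_nonneg [simp]: "ns n x y \<ge> 0"
  by (induction n arbitrary: x) (auto intro!: sum_nonneg)

lemma ns_summable: "summable (\<lambda>n. ns n x y)"
  using trans by (auto simp: transient_def)

lemma G_nonneg [simp]: "G x y \<ge> 0"
  unfolding green_def by (rule suminf_nonneg[OF ns_summable]) simp

lemma Pop_suminf: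
  assumes "\<And>z. summable (\<lambda>n. f n z)"
  shows "Pop (\<lambda>z. \<Sum>n. f n z) x = (\<Sum>n. Pop (f n) x)"
proof -
  have "(\<Sum>n. Pop (f n) x) = (\<Sum>z\<in>nb x. \<Sum>n. p x z * f n z)"
    unfolding Pop_def by (rule suminf_sum) (intro summable_mult assms)
  then show ?thesis unfolding Pop_def by (simp add: suminf_mult[OF assms])
qed

lemma G_rec: "G x y = (if x = y then 1 else 0) + Pop (\<lambda>z. G z y) x"
proof -
  have "G x y = (\<Sum>n. ns (Suc n) x y) + ns 0 x y"
    unfolding green_def using suminf_split_head[OF ns_summable[of x y]] by simp
  also have "(\<Sum>n. ns (Suc n) x y) = Pop (\<lambda>z. G z y) x"
    unfolding green_def ns_Suc by (rule Pop_suminf[OF ns_summable, symmetric])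
  finally show ?thesis by simp
qed

lemma Pop_nonneg: "(\<And>z. f z \<ge> 0) \<Longrightarrow> Pop f x \<ge> 0"
  unfolding Pop_def by (intro sum_nonneg mult_nonneg_nonneg) auto

lemma G_diag_pos: "G y y > 0"
  using G_rec[of y y] Pop_nonneg[of "\<lambda>z. G z y" y] by simp

lemma F_diag [simp]: "F y y = 1"
  using G_diag_pos[of y] by (simp add: F_def)

lemma F_nonneg [simp]: "F x y \<ge> 0" by (simp add: F_def)

lemma F_harmonic: "x \<noteq> y \<Longrightarrow> F x y = Pop (\<lambda>z. F z y) x"
  unfolding F_def by (simp add: Pop_divide G_rec[of x y])

lemma G_F: "G x y = F x y * G y y"
  using G_diag_pos[of y] by (simp add: F_def)

section \<open>Uniqueness below Green potentials\<close>

lemma Pop_pow_G: "((Pop ^^ n) (\<lambda>z. G z y)) x = (\<Sum>k. ns (k + n) x y)"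
proof (induction n arbitrary: x)
  case 0 then show ?case by (simp add: green_def)
next
  case (Suc n)
  have "(Pop ^^ Suc n) (\<lambda>z. G z y) x = Pop (\<lambda>z. \<Sum>k. ns (k + n) z y) x"
    using Suc by (auto intro!: Pop_cong)
  also have "\<dots> = (\<Sum>k. Pop (\<lambda>z. ns (k + n) z y) x)"
    by (rule Pop_suminf) (rule summable_ignore_initial_segment[OF ns_summable])
  finally show ?case by (simp only: ns_Suc[symmetric] add_Suc_right)
qed

text \<open>The iterates are the tails of a convergent series; this is how transience enters the
  uniqueness arguments.\<close>

lemma Pop_pow_G_tendsto: "(\<lambda>n. ((Pop ^^ n) (\<lambda>z. G z y)) x) \<longlonglongrightarrow> 0"
proof -
  have "(\<lambda>n. G x y - (\<Sum>k<n. ns k x y)) \<longlonglongrightarrow> G x y - G x y"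
    unfolding green_def by (intro tendsto_intros summable_LIMSEQ[OF ns_summable])
  then show ?thesis
    unfolding Pop_pow_G using suminf_minus_initial_segment[OF ns_summable] by (simp add: green_def)
qed

text \<open>\<open>\<bar>e\<bar> \<le> P\<^sup>n \<bar>e\<bar>\<close>, and \<open>P\<^sup>n\<close> of a potential tends to 0.\<close>

lemma dirichlet_unique:
  assumes off: "\<And>x. x \<notin> C \<Longrightarrow> e x = 0"
    and harm: "\<And>x. x \<in> C \<Longrightarrow> e x = Pop e x"
    and bd: "\<And>x. \<bar>e x\<bar> \<le> K * G x y + K' * G x y'"
  shows "e x = 0"
proof -
  have sub: "\<bar>e x\<bar> \<le> Pop (\<lambda>z. \<bar>e z\<bar>) x" for x
    using abs_Pop[of e x] harm[of x] off[of x] Pop_nonneg[of "\<lambda>z. \<bar>e z\<bar>" x] by (cases "x \<in> C") auto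
  have *: "\<bar>e x\<bar> \<le> K * (Pop ^^ n) (\<lambda>z. G z y) x + K' * (Pop ^^ n) (\<lambda>z. G z y') x" for n x
  proof (induction n arbitrary: x)
    case 0 then show ?case using bd by simp
  next
    case (Suc n)
    have "\<bar>e x\<bar> \<le> Pop (\<lambda>z. K * (Pop ^^ n) (\<lambda>z. G z y) z + K' * (Pop ^^ n) (\<lambda>z. G z y') z) x"
      by (rule order_trans[OF sub Pop_mono[OF Suc]])
    then show ?case by (simp add: Pop_add Pop_cmult)
  qed
  have "(\<lambda>n. K * (Pop ^^ n) (\<lambda>z. G z y) x + K' * (Pop ^^ n) (\<lambda>z. G z y') x) \<longlonglongrightarrow> K * 0 + K' * 0"
    by (intro tendsto_intros Pop_pow_G_tendsto)
  then have "\<bar>e x\<bar> \<le> K * 0 + K' * 0"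
    using * by (intro LIMSEQ_le_const) auto
  then show ?thesis by simp
qed

text \<open>Meant for functions not given as quotients of Green functions, such as
  \<open>hitprob\<close>: there harmonicity comes from one step of the walk and the upper bound from
  a union bound.\<close>

lemma F_unique:
  assumes "f y = 1" and "\<And>x. x \<noteq> y \<Longrightarrow> f x = Pop f x" and "\<And>x. 0 \<le> f x" and "\<And>x. f x \<le> G x y"
  shows "f x = F x y"
proof -
  have "f x - F x y = 0"
  proof (rule dirichlet_unique[where e = "\<lambda>x. f x - F x y" and C = "- {y}" and K = "1 + 1 / G y y" and K' = 0 and y = y and y' = y])
    fix x
    have "\<bar>f x - F x y\<bar> \<le> f x + F x y" using assms(3)[of x] F_nonneg[of x y] by linarith
    also have "\<dots> \<le> G x y + F x y" using assms(4)[of x] by simp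
    finally show "\<bar>f x - F x y\<bar> \<le> (1 + 1 / G y y) * G x y + 0 * G x y"
      by (simp add: F_def field_simps)
  qed (use assms F_harmonic in \<open>auto simp: Pop_diff\<close>)
  then show ?thesis by simp
qed

section \<open>Factorization across a cut vertex\<close>

definition cut :: "'a \<Rightarrow> 'a set \<Rightarrow> bool" where
  "cut w C \<longleftrightarrow> w \<notin> C \<and> (\<forall>u\<in>C. \<forall>v. adj u v \<longrightarrow> v \<in> C \<or> v = w)"

text \<open>Extended by zero, \<open>e\<close> stays harmonic on \<open>C\<close>: a neighbour
  outside \<open>C\<close> can only be \<open>w\<close>, where \<open>e\<close> vanishes. Hence the
  domination is needed on \<open>C\<close> alone.\<close>

lemma cut_unique:
  assumes c: "cut w C" and x: "x \<in> C"
    and harm: "\<And>x. x \<in> C \<Longrightarrow> e x = Pop e x" and w: "e w = 0"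
    and bd: "\<And>x. x \<in> C \<Longrightarrow> \<bar>e x\<bar> \<le> K * G x y + K' * G x y'" and K: "K \<ge> 0" "K' \<ge> 0"
  shows "e x = 0"
proof -
  define e' where "e' z = (if z \<in> C then e z else 0)" for z
  have "e' x = 0"
  proof (rule dirichlet_unique[where C = C])
    fix z assume z: "z \<in> C"
    have "Pop e z = Pop e' z"
      by (rule Pop_cong) (use c w z in \<open>auto simp: e'_def cut_def nb_def\<close>)
    then show "e' z = Pop e' z" using harm[OF z] z by (simp add: e'_def)
  next
    fix z show "\<bar>e' z\<bar> \<le> K * G z y + K' * G z y'" using bd[of z] K by (auto simp: e'_def)
  qed (auto simp: e'_def)
  with x show ?thesis by (simp add: e'_def)
qed

text \<open>Analytic substitute for the strong Markov property at the first visit to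
  \<open>w\<close>: both sides are harmonic on \<open>C\<close>, agree at \<open>w\<close> and lie
  below Green potentials.\<close>

lemma F_cut:
  assumes c: "cut w C" and t: "t \<notin> C" and x: "x \<in> C \<or> x = w"
  shows "F x t = F x w * F w t"
proof (cases "x = w")
  case False
  then have x: "x \<in> C" using x by auto
  have "F x t - F x w * F w t = 0"
  proof (rule cut_unique[OF c x, where y = t and y' = w and K = "1 / G t t" and K' = "F w t / G w w"])
    fix z assume z: "z \<in> C"
    then have "z \<noteq> t" "z \<noteq> w" using c t by (auto simp: cut_def)
    then show "F z t - F z w * F w t = Pop (\<lambda>z. F z t - F z w * F w t) z"
      by (simp add: Pop_diff F_harmonic[symmetric] Pop_cmult[of "F w t", simplified mult.commute[of "F w t"]])
    have "\<bar>F z t - F z w * F w t\<bar> \<le> F z t + F z w * F w t"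
      using F_nonneg[of z t] mult_nonneg_nonneg[OF F_nonneg[of z w] F_nonneg[of w t]] by linarith
    then show "\<bar>F z t - F z w * F w t\<bar> \<le> 1 / G t t * G z t + F w t / G w w * G z w"
      by (simp add: F_def mult.commute)
  qed auto
  then show ?thesis by simp
qed simp

lemma cut_out: "x \<noteq> rt \<Longrightarrow> cut x (- br x)"
  unfolding cut_def using adj_sym br_exit by (metis ComplI Compl_iff in_br_self mem_Collect_eq)

lemma cut_in: "x \<noteq> rt \<Longrightarrow> cut (par x) (br x)"
  unfolding cut_def using br_exit par_notin_br by blast

lemma F_up: "x \<noteq> rt \<Longrightarrow> z \<in> br x \<Longrightarrow> t \<notin> br x \<Longrightarrow> F z t = F z (par x) * F (par x) t"
  by (rule F_cut[OF cut_in]) auto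

lemma F_rt_step: "x \<noteq> rt \<Longrightarrow> F x rt = F x (par x) * F (par x) rt"
  using F_up[of x x rt] rt_in_br by simp

lemma F_from_rt_step: 
  assumes "x \<noteq> rt" shows "F rt x = F rt (par x) * F (par x) x"
proof (cases "par x = rt")
  case False
  \<comment> \<open>The cut is taken at \<open>par x\<close>, not at \<open>x\<close>: the
    complement of its branch contains the root but not \<open>x\<close>.\<close>
  have "cut (par x) (- br (par x))" using cut_out[OF False] .
  moreover have "rt \<in> - br (par x)" using False rt_in_br by auto
  moreover have "x \<notin> - br (par x)" using assms in_br_par[of "par x" x] by auto
  ultimately show ?thesis using F_cut[of "par x" "- br (par x)" x rt] by simp
qed simp

lemma Pop_ge_term: "(\<And>z. f z \<ge> 0) \<Longrightarrow> z \<in> nb x \<Longrightarrow> p x z * f z \<le> Pop f x"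
  unfolding Pop_def by (rule member_le_sum) auto

lemma adj_G_pos: "adj x y \<Longrightarrow> G x y > 0"
proof -
  assume "adj x y"
  then have "p x y > 0" "y \<in> nb x" by (auto simp: p_pos_iff nb_def)
  then have "0 < p x y * G y y" using G_diag_pos by simp
  also have "\<dots> \<le> Pop (\<lambda>z. G z y) x" using Pop_ge_term[of "\<lambda>z. G z y"] \<open>y \<in> nb x\<close> by simp
  also have "\<dots> \<le> G x y" using G_rec[of x y] by simp
  finally show ?thesis .
qed

lemma F_adj_pos: "x \<noteq> rt \<Longrightarrow> F x (par x) > 0" "x \<noteq> rt \<Longrightarrow> F (par x) x > 0"
  using adj_G_pos G_diag_pos by (auto simp: F_def tadj_def)

lemma F_rt_pos: "F x rt > 0"
  by (induction x rule: vertex_induct) (use F_rt_step F_adj_pos in auto)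

lemma F_from_rt_pos: "F rt x > 0"
  by (induction x rule: vertex_induct) (use F_from_rt_step F_adj_pos in auto)

lemma F_le_1: "F x y \<le> 1"
proof -
  have "G x y \<le> G y y"
  proof (rule ccontr)
    \<comment> \<open>The maximum principle, via \<open>max (G(\<sqdot>,y) - G(y,y)) 0\<close>.\<close>
    define e where "e z = max (G z y - G y y) 0" for z
    have "e z \<le> Pop e z" for z
    proof (cases "z = y")
      case True then show ?thesis by (simp add: e_def Pop_nonneg)
    next
      case False
      have "G z y - G y y = Pop (\<lambda>z. G z y - G y y) z"
        using False G_rec[of z y] by (simp add: Pop_diff Pop_const)
      also have "\<dots> \<le> Pop e z" by (rule Pop_mono) (simp add: e_def)
      finally show ?thesis using Pop_nonneg[of e z] by (simp add: e_def)
    qed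
    note sub = this
    have "e z \<le> (Pop ^^ n) (\<lambda>z. G z y) z" for n z
    proof (induction n arbitrary: z)
      case 0 then show ?case using G_diag_pos[of y] by (simp add: e_def)
    next
      case (Suc n)
      have "Pop e z \<le> (Pop ^^ Suc n) (\<lambda>z. G z y) z" by (simp add: Pop_mono Suc)
      with sub[of z] show ?case by linarith
    qed
    then have "e x \<le> 0" using Pop_pow_G_tendsto[of y x] by (intro LIMSEQ_le_const) auto
    moreover assume "\<not> G x y \<le> G y y"
    ultimately show False by (simp add: e_def)
  qed
  then show ?thesis using G_diag_pos[of y] by (simp add: F_def)
qed

subsection \<open>Reversibility\<close>

lemma mw_rt [simp]: "mw rt = 1" by (simp add: mweight_def)

lemma mw_step: "x \<noteq> rt \<Longrightarrow> mw x * p x (par x) = mw (par x) * p (par x) x"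
proof -
  assume x: "x \<noteq> rt"
  then have "mw x = mw (par x) * (p (par x) x / p x (par x))"
    unfolding mweight_def dep_par[OF x] prod.lessThan_Suc_shift by (simp add: funpow_swap1)
  then show ?thesis using p_par_pos[OF x] by simp
qed

lemma mw_pos: "mw x > 0"
proof (induction x rule: vertex_induct)
  case (step x)
  have "0 < mw x * p x (par x)" using mw_step[OF step(1)] step(2) p_par_pos[OF step(1)] by simp
  then show ?case using p_par_pos[OF step(1)] zero_less_mult_pos2 by blast
qed simp

lemma reversible: "mw x * p x y = mw y * p y x"
proof (cases "adj x y")
  case True then show ?thesis using mw_step by (auto simp: tadj_def)
next
  case False
  then show ?thesis using p_nz_iff adj_sym by (metis mult_zero_right)
qed

text \<open>\<open>nstep\<close> recurses on the first step; reversing paths in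
  \<open>ns_reversible\<close> needs the last step split off instead.\<close>

lemma ns_Suc_right: "ns (Suc n) x y = (\<Sum>z\<in>nb y. ns n x z * p z y)"
proof (induction n arbitrary: x)
  case 0
  have "ns (Suc 0) x y = (\<Sum>z\<in>nb x. if z = y then p x z else 0)"
    unfolding nstep.simps nb_eq by (rule sum.cong) auto
  also have "\<dots> = p x y" using p_off_nb by (auto simp: sum.delta')
  also have "\<dots> = (\<Sum>z\<in>nb y. if z = x then p z y else 0)"
    using p_off_nb nb_sym by (auto simp: sum.delta')
  also have "\<dots> = (\<Sum>z\<in>nb y. ns 0 x z * p z y)"
    by (intro sum.cong) auto
  finally show ?case .
next
  case (Suc n)
  have "ns (Suc (Suc n)) x y = Pop (\<lambda>z. \<Sum>u\<in>nb y. ns n z u * p u y) x"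
    unfolding ns_Suc[of "Suc n"] Suc ..
  also have "\<dots> = (\<Sum>u\<in>nb y. p u y * Pop (\<lambda>z. ns n z u) x)"
    unfolding Pop_sum using Pop_cmult by (simp add: mult.commute)
  finally show ?case by (simp only: ns_Suc[symmetric] mult.commute)
qed

lemma ns_reversible: "mw x * ns n x y = mw y * ns n y x"
proof (induction n arbitrary: x)
  case (Suc n)
  have "mw x * ns (Suc n) x y = (\<Sum>z\<in>nb x. (mw x * p x z) * ns n z y)"
    unfolding ns_Suc Pop_def by (simp add: sum_distrib_left algebra_simps)
  also have "\<dots> = (\<Sum>z\<in>nb x. p z x * (mw z * ns n z y))"
    by (rule sum.cong[OF refl]) (simp add: reversible[of x] mult.assoc[symmetric] mult.commute[of "p _ _" "mw _"])
  also have "\<dots> = mw y * (\<Sum>z\<in>nb x. ns n y z * p z x)"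
    unfolding Suc sum_distrib_left by (simp add: algebra_simps)
  finally show ?case by (simp only: ns_Suc_right)
qed simp

lemma G_reversible: "mw x * G x y = mw y * G y x"
proof -
  have "mw x * G x y = (\<Sum>n. mw x * ns n x y)"
    unfolding green_def by (rule suminf_mult[OF ns_summable, symmetric])
  also have "\<dots> = mw y * G y x"
    unfolding ns_reversible[of x] green_def by (rule suminf_mult[OF ns_summable])
  finally show ?thesis .
qed

text \<open>\<open>G(x,x) (1 - F(x,x\<^sup>-) F(x\<^sup>-,x))\<close> is the Green function at \<open>x\<close> of the walk killed on
  leaving \<open>T\<^sub>x\<close>, and the walk leaves \<open>T\<^sub>x\<close> only through the edge from \<open>x\<close> to \<open>x\<^sup>-\<close>.\<close>

lemma exit_formula:
  assumes x: "x \<noteq> rt"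
  shows "G x x * p x (par x) * (1 - F x (par x) * F (par x) x) = F x (par x)"
proof -
  let ?y = "par x"
  \<comment> \<open>\<open>G z x - F z ?y * G ?y x\<close> counts the visits to \<open>x\<close>
    before \<open>?y\<close> is reached. Multiplied by \<open>p x ?y\<close> it is the probability
    of leaving the branch through its only exit, so \<open>e\<close> should vanish
    identically.\<close>
  define e where "e z = (if z \<in> br x then F z ?y - p x ?y * (G z x - F z ?y * G ?y x) else 0)" for z
  have y: "?y \<notin> br x" using par_notin_br[OF x] by simp
  have "e x = 0"
  proof (rule dirichlet_unique[where C = "br x" and y = ?y and y' = x and K = "(1 + p x ?y * G ?y x) / G ?y ?y" and K' = "p x ?y"])
    fix z assume z: "z \<in> br x"
    then have zy: "z \<noteq> ?y" using y by auto
    \<comment> \<open>The same expression without the cutoff. Harmonicity fails only at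
      \<open>x\<close>, by the amount \<open>p x ?y\<close> coming from the unit term of the Green
      function; the value 1 of \<open>e'\<close> at \<open>?y\<close>, which \<open>e\<close>
      replaces by 0, compensates for exactly this amount.\<close>
    define e' where "e' z = F z ?y - p x ?y * (G z x - F z ?y * G ?y x)" for z
    have "e' z = (1 + p x ?y * G ?y x) * F z ?y - p x ?y * G z x" for z
      by (simp add: e'_def algebra_simps)
    then have "e' = (\<lambda>z. (1 + p x ?y * G ?y x) * F z ?y - p x ?y * G z x)" by blast
    then have Pe': "Pop e' z = (1 + p x ?y * G ?y x) * Pop (\<lambda>z. F z ?y) z - p x ?y * Pop (\<lambda>z. G z x) z"
      by (simp only: Pop_diff Pop_cmult)
    have 1: "Pop e' z = e' z + (if z = x then p x ?y else 0)"
      unfolding Pe' F_harmonic[OF zy, symmetric] e'_def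
      using G_rec[of z x] by (simp add: algebra_simps split: if_splits)
    have e'y: "e' ?y = 1" by (simp add: e'_def)
    have ee: "e u = e' u - (if u = ?y then 1 else 0)" if "u \<in> nb z" for u
    proof (cases "u = ?y")
      case True then show ?thesis using y e'y by (simp add: e_def)
    next
      case False
      then have "u \<in> br x" using that z br_exit[of z u x] by (auto simp: nb_def)
      then show ?thesis using False by (simp add: e_def e'_def)
    qed
    have 2: "Pop (\<lambda>u. if u = ?y then 1 else 0) z = (if z = x then p x ?y else 0)"
    proof -
      have "Pop (\<lambda>u. if u = ?y then 1 else 0) z = (\<Sum>u\<in>nb z. if u = ?y then p z ?y else 0)"
        unfolding Pop_def by (intro sum.cong) auto
      also have "\<dots> = p z ?y" using p_off_nb by (auto simp: sum.delta')
      also have "\<dots> = (if z = x then p x ?y else 0)"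
        using z y br_exit[of z ?y x] p_nz_iff[of z ?y] by auto
      finally show ?thesis .
    qed
    have "Pop e z = Pop (\<lambda>u. e' u - (if u = ?y then 1 else 0)) z" by (rule Pop_cong[OF ee])
    also have "\<dots> = e' z" using 1 2 by (simp add: Pop_diff)
    finally show "e z = Pop e z" using z by (simp add: e_def e'_def)
  next
    fix z
    have "0 \<le> (1 + p x ?y * G ?y x) * F z ?y" "0 \<le> p x ?y * G z x" by auto
    then have "\<bar>(1 + p x ?y * G ?y x) * F z ?y - p x ?y * G z x\<bar> \<le> (1 + p x ?y * G ?y x) * F z ?y + p x ?y * G z x"
      by linarith
    moreover have "e z = (if z \<in> br x then (1 + p x ?y * G ?y x) * F z ?y - p x ?y * G z x else 0)"
      by (simp add: e_def algebra_simps)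
    ultimately have "\<bar>e z\<bar> \<le> (1 + p x ?y * G ?y x) * F z ?y + p x ?y * G z x"
      by auto
    then show "\<bar>e z\<bar> \<le> (1 + p x ?y * G ?y x) / G ?y ?y * G z ?y + p x ?y * G z x"
      by (simp add: F_def)
  qed (simp add: e_def)
  then have "F x ?y = p x ?y * (G x x - F x ?y * G ?y x)" by (simp add: e_def)
  also have "\<dots> = G x x * p x ?y * (1 - F x ?y * F ?y x)"
    using G_F[of ?y x] by (simp add: algebra_simps)
  finally show ?thesis by simp
qed

end

section \<open>The law of the walk\<close>

context tree_walk
begin

abbreviation S :: "(nat \<Rightarrow> 'a) measure" where "S \<equiv> PiM UNIV (\<lambda>_. count_space UNIV)"
abbreviation W :: "'a \<Rightarrow> (nat \<Rightarrow> 'a) measure" where "W \<equiv> walk_measure p"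
definition cyl :: "nat \<Rightarrow> (nat \<Rightarrow> 'a) \<Rightarrow> (nat \<Rightarrow> 'a) set" where
  "cyl n xs = {\<omega>. \<forall>i\<le>n. \<omega> i = xs i}"
definition cylp :: "'a \<Rightarrow> nat \<Rightarrow> (nat \<Rightarrow> 'a) \<Rightarrow> real" where
  "cylp x n xs = (if xs 0 = x then 1 else 0) * (\<Prod>i<n. p (xs i) (xs (Suc i)))"

lemma space_S: "space S = UNIV"
  by (simp add: space_PiM)

lemma S_component [measurable]: "(\<lambda>\<omega>. \<omega> n) \<in> measurable S (count_space UNIV)"
  by (rule measurable_component_singleton) simp

lemma S_pred: "{\<omega>. \<omega> n \<in> A} \<in> sets S"
proof -
  have "(\<lambda>\<omega>. \<omega> n) -` A \<inter> space S \<in> sets S" by (rule measurable_sets[OF S_component]) simp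
  then show ?thesis by (simp add: space_S vimage_def)
qed

lemma cyl_sets: "cyl n xs \<in> sets S"
proof -
  have "cyl n xs = (\<Inter>i\<in>{..n}. {\<omega>. \<omega> i \<in> {xs i}})" by (auto simp: cyl_def)
  also have "\<dots> \<in> sets S" by (rule sets.finite_INT) (simp_all only: S_pred finite_atMost, simp)
  finally show ?thesis .
qed

text \<open>Countability of the vertex set is essential here: an event about one coordinate is the
  union of the cylinders over all finite histories up to that time, coded as lists.\<close>

lemma sets_S_cyl: "sets S = sigma_sets UNIV (insert {} (range (\<lambda>(n, xs). cyl n xs)))" (is "_ = sigma_sets _ ?E")
proof
  have "sets S = sigma_sets UNIV {{f. f i \<in> A} |i A. True}"
    by (simp add: sets_PiM_single PiE_UNIV_domain)
  also have "\<dots> \<subseteq> sigma_sets UNIV ?E"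
  proof (rule sigma_sets_mono, clarify)
    fix i and A :: "'a set"
    define cl where "cl l = cyl i (\<lambda>j. l ! j)" for l :: "'a list"
    have "{f. f i \<in> A} = \<Union>(cl ` {l. length l = Suc i \<and> l ! i \<in> A})"
    proof (intro equalityI subsetI)
      fix f assume "f \<in> {f. f i \<in> A}"
      then have "f \<in> cl (map f [0..<Suc i])" "map f [0..<Suc i] \<in> {l. length l = Suc i \<and> l ! i \<in> A}"
        by (auto simp: cl_def cyl_def simp del: upt_Suc)
      then show "f \<in> \<Union>(cl ` {l. length l = Suc i \<and> l ! i \<in> A})" by blast
    qed (auto simp: cl_def cyl_def)
    moreover have "countable {l. length l = Suc i \<and> l ! i \<in> A}"
      using countable_subset[OF _ countable_lists[OF countable_vertices]] by fastforce
    moreover have "cl l \<in> sigma_sets UNIV ?E" for l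
      unfolding cl_def by (rule sigma_sets.Basic) force
    moreover have "sigma_algebra (UNIV :: (nat \<Rightarrow> 'a) set) (sigma_sets UNIV ?E)"
      by (rule sigma_algebra_sigma_sets) simp
    ultimately show "{f. f i \<in> A} \<in> sigma_sets UNIV ?E"
      by (simp only:) (rule sigma_algebra.countable_UN', auto)
  qed
  finally show "sets S \<subseteq> sigma_sets UNIV ?E" .
  show "sigma_sets UNIV ?E \<subseteq> sets S"
  proof -
    have "?E \<subseteq> sets S" using cyl_sets by auto
    from sets.sigma_sets_subset[OF this] show ?thesis by (simp only: space_S)
  qed
qed

lemma cyl_Int: "n \<le> m \<Longrightarrow> cyl n xs \<inter> cyl m ys = {} \<or> cyl n xs \<inter> cyl m ys = cyl m ys"
proof (cases "\<forall>i\<le>n. xs i = ys i")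
  case True
  assume "n \<le> m"
  with True show ?thesis by (auto simp: cyl_def)
next
  case False
  assume "n \<le> m"
  with False have "cyl n xs \<inter> cyl m ys = {}" by (fastforce simp: cyl_def)
  then show ?thesis ..
qed

text \<open>Two cylinders are nested or disjoint, so with the empty set they form an
  intersection-stable generator.\<close>

lemma walk_measure_unique:
  assumes M: "sets M = sets S" "\<And>n xs. emeasure M (cyl n xs) = ennreal (cylp x n xs)"
    and N: "sets N = sets S" "\<And>n xs. emeasure N (cyl n xs) = ennreal (cylp x n xs)"
  shows "M = N"
proof (rule measure_eqI_generator_eq)
  let ?E = "insert {} (range (\<lambda>(n, xs). cyl n xs))"
  show "Int_stable ?E"
  proof (rule Int_stableI)
    fix a b assume "a \<in> ?E" "b \<in> ?E"
    then consider "a = {} \<or> b = {}" | n xs m ys where "a = cyl n xs" "b = cyl m ys" by auto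
    then show "a \<inter> b \<in> ?E"
    proof cases
      case 2
      show ?thesis
      proof (cases "n \<le> m")
        case True
        then show ?thesis using 2 cyl_Int[OF True, of xs ys] by auto
      next
        case False
        then show ?thesis using 2 cyl_Int[of m n ys xs] by (auto simp: Int_commute)
      qed
    qed auto
  qed
  show "sets M = sigma_sets UNIV ?E" "sets N = sigma_sets UNIV ?E"
    using M N by (simp_all add: sets_S_cyl)
  show "emeasure M X = emeasure N X" if "X \<in> ?E" for X
    using that M N by auto
  \<comment> \<open>The countable cover by sets of finite mass: cylinders that prescribe only the
    starting point.\<close>
  define A where "A i = cyl 0 (\<lambda>_. from_nat_into UNIV i :: 'a)" for i :: nat
  show "range A \<subseteq> ?E" by (auto simp: A_def)
  show "(\<Union>i. A i) = UNIV"
  proof (intro equalityI subsetI UNIV_I)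
    fix \<omega> :: "nat \<Rightarrow> 'a"
    obtain i where "\<omega> 0 = from_nat_into UNIV i"
      using from_nat_into_surj[OF countable_vertices, of "\<omega> 0"] by (metis UNIV_I)
    then show "\<omega> \<in> (\<Union>i. A i)" by (auto simp: A_def cyl_def)
  qed
  show "emeasure M (A i) \<noteq> \<infinity>" for i by (simp add: A_def M)
qed auto

section \<open>Existence of the path measure\<close>

definition K :: "'a \<Rightarrow> 'a pmf" where "K x = embed_pmf (p x)"

lemma pmf_K: "pmf (K x) y = p x y"
  unfolding K_def
proof (rule pmf_embed_pmf)
  have "(\<integral>\<^sup>+ y. ennreal (p x y) \<partial>count_space UNIV) = (\<Sum>y\<in>nb x. ennreal (p x y))"
    by (rule nn_integral_count_space') (use p_off_nb in \<open>auto simp: ennreal_0\<close>)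
  also have "\<dots> = 1" by (simp add: sum_p)
  finally show "(\<integral>\<^sup>+ y. ennreal (p x y) \<partial>count_space UNIV) = 1" .
qed simp

lemma set_pmf_K: "set_pmf (K x) = nb x"
  by (auto simp: set_pmf_iff pmf_K p_nz_iff nb_def)

text \<open>Independent draws are attached to all pairs of a time and a vertex, and
  \<open>chain\<close> obeys the draw attached to its present time and place. Different times use
  different draws, so a product measure suffices and cylinder probabilities factor.\<close>

abbreviation Q :: "(nat \<times> 'a \<Rightarrow> 'a) measure" where
  "Q \<equiv> PiM UNIV (\<lambda>j. measure_pmf (K (snd j)))"

primrec chain :: "'a \<Rightarrow> (nat \<times> 'a \<Rightarrow> 'a) \<Rightarrow> nat \<Rightarrow> 'a" where
  "chain x \<omega> 0 = x"
| "chain x \<omega> (Suc n) = \<omega> (n, chain x \<omega> n)"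

lemma Q_component: "(\<lambda>\<omega>. \<omega> j) \<in> measurable Q (count_space UNIV)"
proof -
  have "(\<lambda>\<omega>. \<omega> j) \<in> measurable Q (measure_pmf (K (snd j)))"
    by (rule measurable_component_singleton) simp
  then show ?thesis by (simp cong: measurable_cong_sets)
qed

lemma chain_component: "(\<lambda>\<omega>. chain x \<omega> n) \<in> measurable Q (count_space UNIV)"
proof (induction n)
  case (Suc n)
  have "(\<lambda>\<omega>. (\<lambda>y \<omega>. \<omega> (n, y)) (chain x \<omega> n) \<omega>) \<in> measurable Q (count_space UNIV)"
    by (rule measurable_compose_countable'[OF Q_component Suc countable_vertices])
  then show ?case by simp
qed simp

lemma chain_measurable: "chain x \<in> measurable Q S"
  by (rule measurable_PiM_single') (auto simp: chain_component)

lemma chain_cyl: "xs 0 = x \<Longrightarrow> (\<forall>i\<le>n. chain x \<omega> i = xs i) \<longleftrightarrow> (\<forall>i<n. \<omega> (i, xs i) = xs (Suc i))"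
proof (induction n)
  case (Suc n)
  have "(\<forall>i\<le>Suc n. chain x \<omega> i = xs i) \<longleftrightarrow> (\<forall>i\<le>n. chain x \<omega> i = xs i) \<and> chain x \<omega> (Suc n) = xs (Suc n)"
    by (auto simp: le_Suc_eq)
  also have "\<dots> \<longleftrightarrow> (\<forall>i\<le>n. chain x \<omega> i = xs i) \<and> \<omega> (n, xs n) = xs (Suc n)"
    by auto
  also have "\<dots> \<longleftrightarrow> (\<forall>i<n. \<omega> (i, xs i) = xs (Suc i)) \<and> \<omega> (n, xs n) = xs (Suc n)"
    using Suc by simp
  finally show ?case by (auto simp: less_Suc_eq)
qed simp

lemma emeasure_chain_cyl: "emeasure (distr Q S (chain x)) (cyl n xs) = ennreal (cylp x n xs)"
proof -
  have sQ: "space Q = UNIV" by (simp add: space_PiM)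
  have 1: "emeasure (distr Q S (chain x)) (cyl n xs) = emeasure Q {\<omega>. \<forall>i\<le>n. chain x \<omega> i = xs i}"
    by (subst emeasure_distr[OF chain_measurable cyl_sets]) (simp add: cyl_def vimage_def sQ)
  show ?thesis
  proof (cases "xs 0 = x")
    case False
    then have e: "{\<omega>. \<forall>i\<le>n. chain x \<omega> i = xs i} = {}" by auto
    show ?thesis unfolding 1 e using False by (simp add: cylp_def)
  next
    case True
    interpret Q: product_prob_space "\<lambda>j. measure_pmf (K (snd j))" UNIV by unfold_locales
    let ?J = "(\<lambda>i. (i, xs i)) ` {..<n}"
    have "{\<omega>. \<forall>i\<le>n. chain x \<omega> i = xs i} = {\<omega>\<in>space Q. \<forall>j\<in>?J. \<omega> j \<in> {xs (Suc (fst j))}}"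
      using chain_cyl[of xs x n, OF True] unfolding sQ by auto
    also have "emeasure Q \<dots> = (\<Prod>j\<in>?J. emeasure (measure_pmf (K (snd j))) {xs (Suc (fst j))})"
      by (rule Q.emeasure_PiM_Collect) auto
    also have "\<dots> = (\<Prod>i<n. ennreal (p (xs i) (xs (Suc i))))"
      by (subst prod.reindex) (auto simp: inj_on_def emeasure_pmf_single pmf_K)
    also have "\<dots> = ennreal (cylp x n xs)"
      using True by (simp add: cylp_def prod_ennreal)
    finally show ?thesis using 1 by simp
  qed
qed

text \<open>The definite description is meaningful: the chain gives existence, and the cylinders
  give uniqueness.\<close>

lemma walk_measure_eq: "W x = distr Q S (chain x)"
proof -
  have "W x = (THE M. sets M = sets S \<and> (\<forall>n xs. emeasure M (cyl n xs) = ennreal (cylp x n xs)))"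
    by (simp add: walk_measure_def cyl_def cylp_def)
  also have "\<dots> = distr Q S (chain x)"
    by (rule the_equality) (use emeasure_chain_cyl walk_measure_unique in \<open>auto simp: sets_distr\<close>)
  finally show ?thesis .
qed

lemma sets_W [simp, measurable_cong]: "sets (W x) = sets S"
  by (simp add: walk_measure_eq)

lemma space_W [simp]: "space (W x) = UNIV"
  by (simp add: walk_measure_eq space_S)

lemma emeasure_W_cyl: "emeasure (W x) (cyl n xs) = ennreal (cylp x n xs)"
  unfolding walk_measure_eq by (rule emeasure_chain_cyl)

lemma prob_space_W: "prob_space (W x)"
proof -
  interpret Q: product_prob_space "\<lambda>j. measure_pmf (K (snd j))" UNIV by unfold_locales
  show ?thesis unfolding walk_measure_eq by (rule Q.prob_space_distr[OF chain_measurable])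
qed

section \<open>Markov property at time one\<close>

lemma shift_measurable: "case_nat x \<in> measurable S S"
proof (rule measurable_PiM_single')
  show "(\<lambda>\<omega>. case_nat x \<omega> i) \<in> measurable S (count_space UNIV)" for i
    by (cases i) auto
qed auto

lemma shift_kernel_measurable:
  "(\<lambda>y. distr (W y) S (case_nat x)) \<in> measurable (measure_pmf (K x)) (subprob_algebra S)"
proof -
  have "prob_space (distr (W y) S (case_nat x))" for y
    by (rule prob_space.prob_space_distr[OF prob_space_W]) (use shift_measurable in \<open>simp cong: measurable_cong_sets\<close>)
  then show ?thesis
    by (auto simp: space_subprob_algebra intro: prob_space_imp_subprob_space)
qed

text \<open>The measure on the right also has the prescribed cylinder probabilities. Prepending the
  starting point with \<open>case_nat\<close> expresses the time shift.\<close>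

lemma W_first_step: "W x = measure_pmf (K x) \<bind> (\<lambda>y. distr (W y) S (case_nat x))" (is "_ = ?N")
proof (rule walk_measure_unique)
  note m = shift_kernel_measurable
  show "sets ?N = sets S" by (subst sets_bind) auto
  fix n xs
  have d: "emeasure (distr (W y) S (case_nat x)) (cyl n xs) = emeasure (W y) {\<omega>. case_nat x \<omega> \<in> cyl n xs}" for y
    by (subst emeasure_distr) (use shift_measurable cyl_sets in \<open>auto simp: vimage_def cong: measurable_cong_sets\<close>)
  have "emeasure ?N (cyl n xs) = (\<integral>\<^sup>+ y. emeasure (W y) {\<omega>. case_nat x \<omega> \<in> cyl n xs} \<partial>measure_pmf (K x))"
    by (subst emeasure_bind[OF _ m]) (auto simp: cyl_sets d)
  also have "\<dots> = ennreal (cylp x n xs)"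
  proof (cases "xs 0 = x")
    case False
    then have "{\<omega>. case_nat x \<omega> \<in> cyl n xs} = {}" by (auto simp: cyl_def)
    then show ?thesis using False by (simp add: cylp_def)
  next
    case True
    show ?thesis
    proof (cases n)
      case 0
      have "{\<omega>. case_nat x \<omega> \<in> cyl n xs} = UNIV" using True 0 by (auto simp: cyl_def)
      then show ?thesis
        using True 0 prob_space.emeasure_space_1[OF prob_space_W] measure_pmf.emeasure_space_1[of "K x"]
        by (simp add: cylp_def)
    next
      case (Suc m)
      have "{\<omega>. case_nat x \<omega> \<in> cyl n xs} = cyl m (\<lambda>i. xs (Suc i))"
      proof -
        have "(\<forall>i\<le>Suc m. case_nat x \<omega> i = xs i) \<longleftrightarrow> (\<forall>i\<le>m. \<omega> i = xs (Suc i))" for \<omega>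
        proof
          assume a: "\<forall>i\<le>m. \<omega> i = xs (Suc i)"
          show "\<forall>i\<le>Suc m. case_nat x \<omega> i = xs i"
          proof (intro allI impI)
            fix i assume "i \<le> Suc m" then show "case_nat x \<omega> i = xs i" using a True by (cases i) auto
          qed
        qed fastforce
        then show ?thesis by (simp add: Suc cyl_def)
      qed
      then have "(\<integral>\<^sup>+ y. emeasure (W y) {\<omega>. case_nat x \<omega> \<in> cyl n xs} \<partial>measure_pmf (K x))
         = (\<Sum>y\<in>nb x. ennreal (cylp y m (\<lambda>i. xs (Suc i))) * ennreal (p x y))"
        by (subst nn_integral_measure_pmf_finite) (auto simp: set_pmf_K pmf_K emeasure_W_cyl)
      also have "\<dots> = ennreal (\<Sum>y\<in>nb x. cylp y m (\<lambda>i. xs (Suc i)) * p x y)"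
        by (subst sum_ennreal[symmetric]) (auto simp: ennreal_mult cylp_def prod_nonneg)
      also have "(\<Sum>y\<in>nb x. cylp y m (\<lambda>i. xs (Suc i)) * p x y) =
          (\<Sum>y\<in>nb x. if y = xs (Suc 0) then p x y * (\<Prod>i<m. p (xs (Suc i)) (xs (Suc (Suc i)))) else 0)"
        by (intro sum.cong) (auto simp: cylp_def)
      also have "\<dots> = p x (xs (Suc 0)) * (\<Prod>i<m. p (xs (Suc i)) (xs (Suc (Suc i))))"
        using p_off_nb by (auto simp: sum.delta')
      also have "\<dots> = cylp x n xs"
        using True unfolding cylp_def Suc prod.lessThan_Suc_shift by simp
      finally show ?thesis .
    qed
  qed
  finally show "emeasure ?N (cyl n xs) = ennreal (cylp x n xs)" .
qed (simp_all add: emeasure_W_cyl)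

lemma markov_emeasure:
  assumes A: "A \<in> sets S"
  shows "emeasure (W x) A = (\<Sum>y\<in>nb x. emeasure (W y) {\<omega>. case_nat x \<omega> \<in> A} * ennreal (p x y))"
proof -
  note m = shift_kernel_measurable
  have d: "emeasure (distr (W y) S (case_nat x)) A = emeasure (W y) {\<omega>. case_nat x \<omega> \<in> A}" for y
    by (subst emeasure_distr) (use shift_measurable A in \<open>auto simp: vimage_def cong: measurable_cong_sets\<close>)
  have "emeasure (W x) A = (\<integral>\<^sup>+ y. emeasure (W y) {\<omega>. case_nat x \<omega> \<in> A} \<partial>measure_pmf (K x))"
    by (subst W_first_step, subst emeasure_bind[OF _ m]) (auto simp: A d)
  then show ?thesis
    by (subst (asm) nn_integral_measure_pmf_finite) (auto simp: set_pmf_K pmf_K)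
qed

lemma markov:
  assumes A: "A \<in> sets S"
  shows "measure (W x) A = Pop (\<lambda>y. measure (W y) {\<omega>. case_nat x \<omega> \<in> A}) x"
proof -
  interpret prob_space "W y" for y by (rule prob_space_W)
  have "ennreal (measure (W x) A) = ennreal (\<Sum>y\<in>nb x. measure (W y) {\<omega>. case_nat x \<omega> \<in> A} * p x y)"
    using markov_emeasure[OF A, of x]
    by (subst sum_ennreal[symmetric]) (auto simp: emeasure_eq_measure ennreal_mult)
  then show ?thesis by (simp add: Pop_def sum_nonneg mult.commute)
qed

lemma AE_start: "AE \<omega> in W x. \<omega> 0 = x"
proof -
  interpret prob_space "W x" by (rule prob_space_W)
  have "emeasure (W x) (cyl 0 (\<lambda>_. x)) = 1" by (simp add: emeasure_W_cyl cylp_def)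
  then have "AE \<omega> in W x. \<omega> \<in> cyl 0 (\<lambda>_. x)"
    using AE_in_set_eq_1[of "cyl 0 (\<lambda>_. x)"] cyl_sets by (simp add: emeasure_eq_measure)
  then show ?thesis by (simp add: cyl_def)
qed

lemma measure_cong_AE:
  assumes "AE \<omega> in W x. P \<omega> \<longleftrightarrow> R \<omega>" "{\<omega>. P \<omega>} \<in> sets S" "{\<omega>. R \<omega>} \<in> sets S"
  shows "measure (W x) {\<omega>. P \<omega>} = measure (W x) {\<omega>. R \<omega>}"
  using assms by (intro measure_eq_AE) auto

lemma measure_W_start: "measure (W x) {\<omega>. \<omega> 0 = y} = (if x = y then 1 else 0)"
proof -
  have "{\<omega>. \<omega> 0 = y} = cyl 0 (\<lambda>_. y)" by (auto simp: cyl_def)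
  then show ?thesis by (simp add: measure_def emeasure_W_cyl cylp_def)
qed

lemma S_at: "{\<omega>. \<omega> n = y} \<in> sets S"
  using S_pred[of n "{y}"] by simp

lemma measure_at: "measure (W x) {\<omega>. \<omega> n = y} = ns n x y"
proof (induction n arbitrary: x)
  case (Suc n)
  have "{\<omega>. case_nat x \<omega> \<in> {\<omega>. \<omega> (Suc n) = y}} = {\<omega>. \<omega> n = y}" by simp
  then show ?case using markov[OF S_at, of x "Suc n" y] Suc by (simp only: ns_Suc)
qed (simp add: measure_W_start)

lemma S_hits: "{\<omega>. \<exists>n. \<omega> n = y} \<in> sets S"
proof -
  have "{\<omega>. \<exists>n. \<omega> n = y} = (\<Union>n. {\<omega>. \<omega> n = y})" by auto
  also have "\<dots> \<in> sets S" by (rule sets.countable_nat_UN) (use S_at in blast)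
  finally show ?thesis .
qed

lemma ex_case_nat: "(\<exists>n. case_nat z \<omega> n = y) \<longleftrightarrow> z = y \<or> (\<exists>n. \<omega> n = y)"
proof
  assume "\<exists>n. case_nat z \<omega> n = y"
  then obtain n where "case_nat z \<omega> n = y" ..
  then show "z = y \<or> (\<exists>n. \<omega> n = y)" by (cases n) auto
qed (metis nat.simps(4,5))

text \<open>The probability of a visit is at most the expected number of visits, which is the Green
  function; with harmonicity off \<open>y\<close> from the first step, \<open>F_unique\<close>
  applies.\<close>

lemma hitprob_eq_F: "hitprob p x y = F x y"
proof (rule F_unique)
  interpret prob_space "W z" for z by (rule prob_space_W)
  show "hitprob p y y = 1"
  proof -
    have "measure (W y) {\<omega>. \<omega> 0 = y} \<le> hitprob p y y"
      unfolding hitprob_def by (rule finite_measure_mono) (use S_hits in auto)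
    moreover have "hitprob p y y \<le> 1" by (simp add: hitprob_def)
    ultimately show ?thesis by (simp add: measure_W_start)
  qed
  fix z
  show "0 \<le> hitprob p z y" by (simp add: hitprob_def)
  have "hitprob p z y = measure (W z) (\<Union>n. {\<omega>. \<omega> n = y})"
    unfolding hitprob_def by (rule arg_cong[of _ _ "measure (W z)"]) auto
  also have "\<dots> \<le> (\<Sum>n. measure (W z) {\<omega>. \<omega> n = y})"
    by (rule finite_measure_subadditive_countably) (use S_at in \<open>auto simp: measure_at ns_summable\<close>)
  finally show "hitprob p z y \<le> G z y" by (simp add: measure_at green_def)
  assume "z \<noteq> y"
  then have "{\<omega>. case_nat z \<omega> \<in> {\<omega>. \<exists>n. \<omega> n = y}} = {\<omega>. \<exists>n. \<omega> n = y}"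
    by (auto simp: ex_case_nat)
  then show "hitprob p z y = Pop (\<lambda>z. hitprob p z y) z"
    unfolding hitprob_def using markov[OF S_hits, of z y] by (simp only:)
qed

end

section \<open>Convergence to the boundary and harmonic measures\<close>

text \<open>The two measures restricted to \<open>B\<close> agree up to the factor, hence so do
  their densities and integrals. If the factor is 0, integrability passes only from \<open>N\<close>
  to \<open>M\<close>, which is why it occurs twice.\<close>

lemma restricted_integral:
  fixes f :: "'b \<Rightarrow> real"
  assumes M: "finite_measure M" and N: "finite_measure N" and s: "sets M = sets N" and B: "B \<in> sets M"
    and c: "c \<ge> 0" and eq: "\<And>A. A \<in> sets M \<Longrightarrow> A \<subseteq> B \<Longrightarrow> measure M A = c * measure N A"
    and f: "f \<in> borel_measurable M"
  shows "(\<integral>x. indicator B x * f x \<partial>M) = c * (\<integral>x. indicator B x * f x \<partial>N)"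
    and "c > 0 \<Longrightarrow> integrable M (\<lambda>x. indicator B x * f x) \<longleftrightarrow> integrable N (\<lambda>x. indicator B x * f x)"
    and "integrable N (\<lambda>x. indicator B x * f x) \<Longrightarrow> integrable M (\<lambda>x. indicator B x * f x)"
proof -
  have f': "f \<in> borel_measurable N" using f s by (simp cong: measurable_cong_sets)
  have B': "B \<in> sets N" using B s by simp
  have d: "density M (\<lambda>x. ennreal (indicator B x)) = density N (\<lambda>x. ennreal (c * indicator B x))"
  proof (rule measure_eqI)
    fix A assume "A \<in> sets (density M (\<lambda>x. ennreal (indicator B x)))"
    then have A: "A \<in> sets M" "A \<in> sets N" by (auto simp: s)
    have "emeasure (density M (\<lambda>x. ennreal (indicator B x))) A = emeasure M (A \<inter> B)"
    proof -
      have "emeasure (density M (\<lambda>x. ennreal (indicator B x))) A = (\<integral>\<^sup>+ x. indicator (A \<inter> B) x \<partial>M)"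
        using A B by (subst emeasure_density) (auto intro!: nn_integral_cong simp del: nn_integral_indicator split: split_indicator)
      then show ?thesis using A B by simp
    qed
    also have "\<dots> = ennreal c * emeasure N (A \<inter> B)"
      using eq[of "A \<inter> B"] A B c
      by (simp add: finite_measure.emeasure_eq_measure[OF M] finite_measure.emeasure_eq_measure[OF N] ennreal_mult)
    also have "\<dots> = (\<integral>\<^sup>+ x. ennreal c * indicator (A \<inter> B) x \<partial>N)"
      using A B' by (subst nn_integral_cmult) auto
    also have "\<dots> = emeasure (density N (\<lambda>x. ennreal (c * indicator B x))) A"
      using A B' by (subst emeasure_density) (auto intro!: nn_integral_cong split: split_indicator)
    finally show "emeasure (density M (\<lambda>x. ennreal (indicator B x))) A = emeasure (density N (\<lambda>x. ennreal (c * indicator B x))) A" .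
  qed (simp add: s)
  have "(\<integral>x. indicator B x * f x \<partial>M) = integral\<^sup>L (density M (\<lambda>x. ennreal (indicator B x))) f"
    by (subst integral_density) (use B f in auto)
  also have "\<dots> = (\<integral>x. c * (indicator B x * f x) \<partial>N)"
    unfolding d by (subst integral_density) (use B' f' c in \<open>auto simp: mult.assoc\<close>)
  finally show "(\<integral>x. indicator B x * f x \<partial>M) = c * (\<integral>x. indicator B x * f x \<partial>N)" by simp
  have "integrable M (\<lambda>x. indicator B x * f x) \<longleftrightarrow> integrable (density M (\<lambda>x. ennreal (indicator B x))) f"
    by (subst integrable_density) (use B f in auto)
  also have "\<dots> \<longleftrightarrow> integrable N (\<lambda>x. c * (indicator B x * f x))"
    unfolding d by (subst integrable_density) (use B' f' c in \<open>auto simp: mult.assoc\<close>)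
  finally have i: "integrable M (\<lambda>x. indicator B x * f x) \<longleftrightarrow> integrable N (\<lambda>x. c * (indicator B x * f x))" .
  then show "c > 0 \<Longrightarrow> integrable M (\<lambda>x. indicator B x * f x) \<longleftrightarrow> integrable N (\<lambda>x. indicator B x * f x)"
    by (simp only: integrable_mult_left_iff) simp
  show "integrable N (\<lambda>x. indicator B x * f x) \<Longrightarrow> integrable M (\<lambda>x. indicator B x * f x)"
    unfolding i by simp
qed

context tree_walk
begin

abbreviation ES :: "(nat \<Rightarrow> 'a) measure" where "ES \<equiv> end_space rt par"
abbreviation nu :: "'a \<Rightarrow> (nat \<Rightarrow> 'a) measure" where "nu \<equiv> limit_distr rt par p"

section \<open>Almost sure convergence to an end\<close>

lemma S_rel: "{\<omega>. R (\<omega> i) (\<omega> j)} \<in> sets S"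
proof -
  have "{\<omega>. R (\<omega> i) (\<omega> j)} = (\<Union>y. {\<omega>. \<omega> i = y} \<inter> {\<omega>. \<omega> j \<in> {z. R y z}})" by auto
  also have "\<dots> \<in> sets S"
    by (rule sets.countable_UN'[OF countable_vertices]) (use S_at S_pred in blast)
  finally show ?thesis .
qed

text \<open>The path space contains arbitrary jumps, so the nearest neighbour property of
  trajectories holds only almost surely; later times reduce to the first step by shifting.\<close>

lemma measure_not_adj: "measure (W x) {\<omega>. \<not> adj (\<omega> i) (\<omega> (Suc i))} = 0"
proof (induction i arbitrary: x)
  case 0
  have "measure (W x) {\<omega>. \<not> adj (\<omega> 0) (\<omega> (Suc 0))} = Pop (\<lambda>y. measure (W y) {\<omega>. \<not> adj x (\<omega> 0)}) x"
    using markov[OF S_rel, of x "\<lambda>u v. \<not> adj u v" 0 "Suc 0"] by simp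
  also have "\<dots> = Pop (\<lambda>y. 0) x"
  proof (rule Pop_cong)
    fix y assume "y \<in> nb x"
    then have "measure (W y) {\<omega>. \<not> adj x (\<omega> 0)} = measure (W y) {\<omega>. False}"
      by (intro measure_cong_AE AE_mp[OF AE_start AE_I2]) (use S_pred[of 0 "{z. \<not> adj x z}"] in \<open>auto simp: nb_def\<close>)
    then show "measure (W y) {\<omega>. \<not> adj x (\<omega> 0)} = 0" by simp
  qed
  finally show ?case by (simp add: Pop_const)
next
  case (Suc i)
  have "measure (W x) {\<omega>. \<not> adj (\<omega> (Suc i)) (\<omega> (Suc (Suc i)))} = Pop (\<lambda>y. measure (W y) {\<omega>. \<not> adj (\<omega> i) (\<omega> (Suc i))}) x"
    using markov[OF S_rel, of x "\<lambda>u v. \<not> adj u v" "Suc i" "Suc (Suc i)"] by simp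
  then show ?case by (simp add: Suc Pop_const)
qed

lemma AE_adj: "AE \<omega> in W x. \<forall>i. adj (\<omega> i) (\<omega> (Suc i))"
proof -
  interpret prob_space "W x" by (rule prob_space_W)
  have "AE \<omega> in W x. adj (\<omega> i) (\<omega> (Suc i))" for i
    using prob_eq_0[of "{\<omega>. \<not> adj (\<omega> i) (\<omega> (Suc i))}"] S_rel[of "\<lambda>u v. \<not> adj u v"] measure_not_adj by simp
  then show ?thesis by (simp add: AE_all_countable)
qed

text \<open>Borel-Cantelli applied to the Green series at each of the countably many
  vertices.\<close>

lemma AE_leave: "AE \<omega> in W x. \<forall>y. \<forall>\<^sub>F n in sequentially. \<omega> n \<noteq> y"
proof -
  interpret prob_space "W x" by (rule prob_space_W)
  have "AE \<omega> in W x. \<forall>\<^sub>F n in sequentially. \<omega> n \<noteq> y" for y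
    using borel_cantelli_AE1[of "\<lambda>n. {\<omega>. \<omega> n = y}"] S_at ns_summable[of x y]
    by (simp add: measure_at emeasure_eq_measure)
  then have "AE \<omega> in W x. \<forall>y\<in>UNIV. \<forall>\<^sub>F n in sequentially. \<omega> n \<noteq> y"
    by (subst AE_ball_countable[OF countable_vertices]) blast
  then show ?thesis by simp
qed

definition ev :: "'a \<Rightarrow> (nat \<Rightarrow> 'a) set" where
  "ev y = {\<omega>. \<forall>\<^sub>F n in sequentially. \<omega> n \<in> br y}"
definition conv :: "(nat \<Rightarrow> 'a) \<Rightarrow> (nat \<Rightarrow> 'a) \<Rightarrow> bool" where
  "conv \<omega> \<xi> \<longleftrightarrow> \<xi> \<in> Rays \<and> (\<forall>k. \<omega> \<in> ev (\<xi> k))"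
text \<open>The trajectories that converge to an end (\<open>Gd_iff\<close>), written level by level
  with countable operations so that measurability is visible.\<close>

definition Gd :: "(nat \<Rightarrow> 'a) set" where "Gd = (\<Inter>k. \<Union>y\<in>Lv k. ev y)"

lemma limit_end_conv: "limit_end rt par \<omega> = (THE \<xi>. conv \<omega> \<xi>)"
  by (simp add: limit_end_def conv_def ev_def)

lemma ev_sets: "ev y \<in> sets S"
proof -
  have "ev y = (\<Union>N. \<Inter>n\<in>{N..}. {\<omega>. \<omega> n \<in> br y})"
    by (auto simp: ev_def eventually_sequentially)
  also have "\<dots> \<in> sets S"
  proof (rule sets.countable_nat_UN, rule image_subsetI)
    fix N :: nat show "(\<Inter>n\<in>{N..}. {\<omega>. \<omega> n \<in> br y}) \<in> sets S"
      by (rule sets.countable_INT') (use S_pred[of _ "br y"] in auto)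
  qed
  finally show ?thesis .
qed

lemma Gd_sets: "Gd \<in> sets S"
  unfolding Gd_def by (intro sets.countable_INT image_subsetI sets.finite_UN) (use ev_sets in auto)

lemma ev_same_level: "\<omega> \<in> ev x \<Longrightarrow> \<omega> \<in> ev y \<Longrightarrow> dep x = dep y \<Longrightarrow> x = y"
proof -
  assume a: "\<omega> \<in> ev x" "\<omega> \<in> ev y" "dep x = dep y"
  then have "\<forall>\<^sub>F n in sequentially. \<omega> n \<in> br x \<and> \<omega> n \<in> br y"
    unfolding ev_def mem_Collect_eq by (auto simp: eventually_conj_iff)
  then obtain n where "\<omega> n \<in> br x \<and> \<omega> n \<in> br y" by (auto simp: eventually_sequentially)
  then show "x = y" using a br_same_level by blast
qed

lemma conv_unique: "conv \<omega> \<xi> \<Longrightarrow> conv \<omega> \<eta> \<Longrightarrow> \<xi> = \<eta>"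
  unfolding conv_def by (metis dep_ray ev_same_level ext)

lemma ev_mono: "in_branch rt par x y \<Longrightarrow> \<omega> \<in> ev y \<Longrightarrow> \<omega> \<in> ev x"
  unfolding ev_def mem_Collect_eq using br_trans by (auto elim!: eventually_mono)

lemma conv_exists:
  assumes "\<omega> \<in> Gd" shows "\<exists>\<xi>. conv \<omega> \<xi>"
proof -
  have "\<forall>k. \<exists>y. dep y = k \<and> \<omega> \<in> ev y" using assms by (auto simp: Gd_def Lv_def)
  then obtain \<xi> where xi: "dep (\<xi> k) = k" "\<omega> \<in> ev (\<xi> k)" for k by metis
  have "\<xi> \<in> Rays" unfolding rays_def mem_Collect_eq
  proof (intro conjI allI)
    show "\<xi> 0 = rt" using xi(1)[of 0] by simp
    fix n
    show nr: "\<xi> (Suc n) \<noteq> rt" using xi(1)[of "Suc n"] dep_rt by (metis nat.distinct(1))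
    have "\<omega> \<in> ev (par (\<xi> (Suc n)))"
      using ev_mono[OF _ xi(2)[of "Suc n"]] in_br_par nr by simp
    then show "par (\<xi> (Suc n)) = \<xi> n"
      using ev_same_level xi(2)[of n] xi(1) dep_par[OF nr] by simp
  qed
  then show ?thesis using xi by (auto simp: conv_def)
qed

lemma Gd_iff: "\<omega> \<in> Gd \<longleftrightarrow> (\<exists>\<xi>. conv \<omega> \<xi>)"
proof
  assume "\<exists>\<xi>. conv \<omega> \<xi>"
  then obtain \<xi> where "\<xi> \<in> Rays" "\<And>k. \<omega> \<in> ev (\<xi> k)" by (auto simp: conv_def)
  then show "\<omega> \<in> Gd" using dep_ray by (force simp: Gd_def Lv_def)
qed (rule conv_exists)

text \<open>Once the path stays below level \<open>k\<close>, it can no longer change its branch of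
  level \<open>k\<close>, since it would have to pass through the top vertex of that branch.\<close>

lemma path_converges:
  assumes adj: "\<And>i. adj (\<omega> i) (\<omega> (Suc i))" and leave: "\<And>y. \<forall>\<^sub>F n in sequentially. \<omega> n \<noteq> y"
  shows "\<omega> \<in> Gd"
  unfolding Gd_def
proof
  fix k
  have "\<forall>\<^sub>F n in sequentially. \<forall>y\<in>(\<Union>j\<in>{..k}. Lv j). \<omega> n \<noteq> y"
    by (rule eventually_ball_finite) (use leave in auto)
  then obtain N where N: "\<And>n y. n \<ge> N \<Longrightarrow> y \<in> (\<Union>j\<in>{..k}. Lv j) \<Longrightarrow> \<omega> n \<noteq> y"
    unfolding eventually_sequentially by metis
  have dk: "dep (\<omega> n) > k" if "n \<ge> N" for n
  proof (rule ccontr)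
    assume "\<not> k < dep (\<omega> n)"
    then have "\<omega> n \<in> (\<Union>j\<in>{..k}. Lv j)" by (auto simp: Lv_def)
    then show False using N[OF that] by blast
  qed
  define y where "y = (par ^^ (dep (\<omega> N) - k)) (\<omega> N)"
  have dy: "dep y = k" using dk[of N] dep_par_pow[of "dep (\<omega> N) - k" "\<omega> N"] by (simp add: y_def)
  have "\<omega> n \<in> br y" if "n \<ge> N" for n using that
  proof (induction n rule: dec_induct)
    case base
    show ?case using in_br_iff[of "\<omega> N" y] dk[of N] dy by (simp add: y_def)
  next
    case (step n)
    then show ?case using br_exit[OF adj[of n], of y] dk[of n] dy by auto
  qed
  then show "\<omega> \<in> (\<Union>y\<in>Lv k. ev y)" using dy by (auto simp: Lv_def ev_def eventually_sequentially)
qed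

lemma AE_Gd: "AE \<omega> in W x. \<omega> \<in> Gd"
  using AE_adj[of x] AE_leave[of x] by eventually_elim (use path_converges in blast)

lemma conv_limit_end: "\<omega> \<in> Gd \<Longrightarrow> conv \<omega> (limit_end rt par \<omega>)"
proof -
  assume "\<omega> \<in> Gd"
  then have "\<exists>!\<xi>. conv \<omega> \<xi>" using conv_exists[of \<omega>] conv_unique[of \<omega>] by (intro ex_ex1I) auto
  then show ?thesis unfolding limit_end_conv by (rule theI')
qed

text \<open>The walk itself supplies an end. One is needed as the default value of
  \<open>lend\<close>.\<close>

lemma Rays_nonempty: "Rays \<noteq> {}"
proof -
  interpret prob_space "W rt" by (rule prob_space_W)
  have "\<exists>\<omega>. \<omega> \<in> Gd"
  proof (rule ccontr)
    assume "\<nexists>\<omega>. \<omega> \<in> Gd"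
    then have "AE \<omega> in W rt. False" using AE_Gd[of rt] by simp
    then show False by simp
  qed
  then show ?thesis using conv_exists by (auto simp: conv_def)
qed

text \<open>Off the null set of non-convergent trajectories \<open>limit_end\<close> may take a value that is not a ray;
  \<open>lend\<close> is a measurable modification.\<close>

definition lend :: "(nat \<Rightarrow> 'a) \<Rightarrow> (nat \<Rightarrow> 'a)" where
  "lend \<omega> = (if \<omega> \<in> Gd then limit_end rt par \<omega> else (SOME \<xi>. \<xi> \<in> Rays))"

lemma lend_Rays: "lend \<omega> \<in> Rays"
  using conv_limit_end Rays_nonempty by (auto simp: lend_def conv_def some_in_eq)

lemma lend_Bd: "\<omega> \<in> Gd \<Longrightarrow> lend \<omega> \<in> Bd y \<longleftrightarrow> \<omega> \<in> ev y"
proof -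
  assume g: "\<omega> \<in> Gd"
  then have c: "conv \<omega> (lend \<omega>)" using conv_limit_end by (simp add: lend_def)
  then have r: "\<omega> \<in> ev (lend \<omega> (dep y))" "dep (lend \<omega> (dep y)) = dep y"
    by (auto simp: conv_def dep_ray)
  show ?thesis
    using r ev_same_level lend_Rays by (metis Bd_iff)
qed

lemma space_ES: "space ES = Rays" and sets_ES: "sets ES = sigma_sets Rays (range Bd)"
  unfolding end_space_def by (rule space_measure_of, use Bd_subset in blast)
    (rule sets_measure_of, use Bd_subset in blast)

lemma Bd_sets [measurable, simp]: "Bd y \<in> sets ES"
  unfolding sets_ES by (rule sigma_sets.Basic) simp

lemma lend_measurable: "lend \<in> measurable S ES"
  unfolding end_space_def
proof (rule measurable_measure_of)
  show "range Bd \<subseteq> Pow Rays" using Bd_subset by auto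
  show "lend \<in> space S \<rightarrow> Rays" using lend_Rays by auto
  fix A assume "A \<in> range Bd"
  then obtain y where A: "A = Bd y" by auto
  have "lend -` A \<inter> space S = (Gd \<inter> ev y) \<union> (if (SOME \<xi>. \<xi> \<in> Rays) \<in> Bd y then space S - Gd else {})"
    using lend_Bd unfolding A space_S by (auto simp: lend_def split: if_splits)
  then show "lend -` A \<inter> space S \<in> sets S" using Gd_sets ev_sets[of y] by auto
qed

lemma lend_measurable_W [measurable]: "lend \<in> measurable (W x) ES"
  using lend_measurable by (simp cong: measurable_cong_sets)

text \<open>\<open>distr\<close> records only the masses of preimages of measurable sets, and for
  the two maps these differ by null sets.\<close>

lemma nu_eq: "nu x = distr (W x) ES lend"
  unfolding limit_distr_def distr_def
proof (rule measure_of_eq)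
  show "sets ES \<subseteq> Pow (space ES)" by (rule sets.space_closed)
  fix A assume "A \<in> sigma_sets (space ES) (sets ES)"
  then have A: "A \<in> sets ES" by (simp add: sets.sigma_sets_eq)
  \<comment> \<open>Off \<open>Gd\<close> no end is a limit, so \<open>limit_end\<close> takes there
    the single unspecified value of an empty description. Its preimages therefore remain measurable
    although this value need not be a ray.\<close>
  define z where "z = (THE \<xi> :: nat \<Rightarrow> 'a. False)"
  have z: "limit_end rt par \<omega> = z" if "\<omega> \<notin> Gd" for \<omega>
    using that by (simp add: limit_end_conv Gd_iff z_def)
  have lA: "lend -` A \<inter> space (W x) \<in> sets S" using measurable_sets[OF lend_measurable A] by (simp add: space_S)
  have eq: "limit_end rt par -` A \<inter> space (W x) = ((lend -` A \<inter> space (W x)) \<inter> Gd) \<union> (if z \<in> A then space S - Gd else {})"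
    using z by (auto simp: lend_def space_S)
  have "limit_end rt par -` A \<inter> space (W x) \<in> sets S" unfolding eq using lA Gd_sets by auto
  then show "emeasure (W x) (limit_end rt par -` A \<inter> space (W x)) = emeasure (W x) (lend -` A \<inter> space (W x))"
    using lA AE_Gd[of x] by (intro emeasure_eq_AE) (auto simp: lend_def)
qed

lemma sets_nu [simp, measurable_cong]: "sets (nu x) = sets ES"
  by (simp add: nu_eq)

lemma space_nu [simp]: "space (nu x) = Rays"
  by (simp add: nu_eq space_ES)

lemma prob_space_nu: "prob_space (nu x)"
  unfolding nu_eq by (rule prob_space.prob_space_distr[OF prob_space_W lend_measurable_W])

lemma finite_measure_nu: "finite_measure (nu x)"
  using prob_space_nu prob_space_def by blast

lemma lend_sets: "A \<in> sets ES \<Longrightarrow> {\<omega>. lend \<omega> \<in> A} \<in> sets S"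
  using measurable_sets[OF lend_measurable] by (simp add: space_S vimage_def)

lemma measure_nu: "A \<in> sets ES \<Longrightarrow> measure (nu x) A = measure (W x) {\<omega>. lend \<omega> \<in> A}"
  unfolding nu_eq by (subst measure_distr[OF lend_measurable_W]) (auto simp: vimage_def)

lemma lend_shift: "lend (case_nat x \<omega>) = lend \<omega>"
proof -
  have "case_nat x \<omega> \<in> ev y \<longleftrightarrow> \<omega> \<in> ev y" for y
    unfolding ev_def mem_Collect_eq
    using eventually_sequentially_Suc[of "\<lambda>n. in_branch rt par y (case_nat x \<omega> n)"] by simp
  then have "conv (case_nat x \<omega>) = conv \<omega>" by (simp add: conv_def fun_eq_iff)
  then show ?thesis by (simp only: lend_def limit_end_conv Gd_iff)
qed

lemma nu_harmonic: "A \<in> sets ES \<Longrightarrow> measure (nu x) A = Pop (\<lambda>y. measure (nu y) A) x"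
  using markov[OF lend_sets, of A x] by (simp add: measure_nu lend_shift)

section \<open>Harmonic measures across a cut\<close>

lemma path_hits_cut:
  assumes adj: "\<And>i. adj (\<omega> i) (\<omega> (Suc i))" and c: "cut w C" and C: "\<omega> 0 \<in> C" and n: "\<omega> n \<notin> C"
  shows "\<exists>n. \<omega> n = w"
proof -
  define k where "k = (LEAST n. \<omega> n \<notin> C)"
  have k: "\<omega> k \<notin> C" unfolding k_def by (rule LeastI[of "\<lambda>n. \<omega> n \<notin> C", OF n])
  with C obtain j where j: "k = Suc j" by (cases k) auto
  then have "\<omega> j \<in> C" using not_less_Least[of j "\<lambda>n. \<omega> n \<notin> C"] by (auto simp: k_def)
  then have "\<omega> k = w" using c adj[of j] k j by (auto simp: cut_def)
  then show ?thesis ..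
qed

text \<open>Counterpart of \<open>F_cut\<close> for sets of ends. Seen from \<open>C\<close> the
  ends in \<open>A\<close> lie behind \<open>w\<close>, so a trajectory converging into
  \<open>A\<close> visits \<open>w\<close>; this bounds the harmonic measure by
  \<open>F z w\<close>, a multiple of a Green potential.\<close>

lemma nu_cut:
  assumes c: "cut w C" and A: "A \<in> sets ES"
    and out: "\<And>\<xi>. \<xi> \<in> A \<Longrightarrow> \<exists>y. \<xi> \<in> Bd y \<and> br y \<inter> C = {}" and x: "x \<in> C \<or> x = w"
  shows "measure (nu x) A = F x w * measure (nu w) A"
proof (cases "x = w")
  case False
  then have x: "x \<in> C" using x by auto
  have bound: "measure (nu z) A \<le> F z w" if z: "z \<in> C" for z
  proof -
    interpret prob_space "W z" by (rule prob_space_W)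
    have "AE \<omega> in W z. lend \<omega> \<in> A \<longrightarrow> (\<exists>n. \<omega> n = w)"
      using AE_start[of z] AE_adj[of z] AE_Gd[of z]
    proof eventually_elim
      case (elim \<omega>)
      show ?case
      proof
        assume "lend \<omega> \<in> A"
        then obtain y where y: "lend \<omega> \<in> Bd y" "br y \<inter> C = {}" using out by blast
        then have "\<omega> \<in> ev y" using lend_Bd elim by blast
        then obtain n where "\<omega> n \<in> br y" by (auto simp: ev_def eventually_sequentially)
        then show "\<exists>n. \<omega> n = w" using path_hits_cut[OF _ c, of \<omega> n] elim y z by blast
      qed
    qed
    then have "measure (W z) {\<omega>. lend \<omega> \<in> A} \<le> measure (W z) {\<omega>. \<exists>n. \<omega> n = w}"
      by (intro finite_measure_mono_AE) (use S_hits in auto)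
    then show ?thesis using A by (simp add: measure_nu hitprob_eq_F[unfolded hitprob_def])
  qed
  have "measure (nu x) A - F x w * measure (nu w) A = 0"
  \<comment> \<open>The 2 arises because each of the two terms of the difference is at most
    \<open>F z w\<close>.\<close>
  proof (rule cut_unique[OF c x, where e = "\<lambda>z. measure (nu z) A - F z w * measure (nu w) A"
        and y = w and y' = w and K = "2 / G w w" and K' = 0])
    fix z assume z: "z \<in> C"
    then have zw: "z \<noteq> w" using c by (auto simp: cut_def)
    have "Pop (\<lambda>z. F z w * measure (nu w) A) z = F z w * measure (nu w) A"
      using Pop_cmult[of "measure (nu w) A" "\<lambda>z. F z w" z] F_harmonic[OF zw] by (simp add: mult.commute)
    then show "measure (nu z) A - F z w * measure (nu w) A = Pop (\<lambda>z. measure (nu z) A - F z w * measure (nu w) A) z"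
      using nu_harmonic[OF A, of z] by (simp add: Pop_diff)
    have "measure (nu w) A \<le> 1" by (rule prob_space.prob_le_1[OF prob_space_nu])
    then have "F z w * measure (nu w) A \<le> F z w" "0 \<le> F z w * measure (nu w) A"
      using mult_left_le[of "measure (nu w) A" "F z w"] by auto
    then have "\<bar>measure (nu z) A - F z w * measure (nu w) A\<bar> \<le> 2 * F z w"
      using bound[OF z] measure_nonneg[of "nu z" A] unfolding abs_le_iff by linarith
    then show "\<bar>measure (nu z) A - F z w * measure (nu w) A\<bar> \<le> 2 / G w w * G z w + 0 * G z w"
      by (simp add: F_def)
  qed (use G_diag_pos[of w] in auto)
  then show ?thesis by simp
qed simp

lemma nu_down:
  assumes "x \<noteq> rt" "z \<notin> br x" "A \<in> sets ES" "A \<subseteq> Bd x"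
  shows "measure (nu z) A = F z x * measure (nu x) A"
  by (rule nu_cut[OF cut_out]) (use assms in auto)

lemma nu_up:
  assumes "x \<noteq> rt" "z \<in> br x" "A \<in> sets ES" "A \<inter> Bd x = {}"
  shows "measure (nu z) A = F z (par x) * measure (nu (par x)) A"
proof (rule nu_cut[OF cut_in])
  fix \<xi> assume xi: "\<xi> \<in> A"
  then have r: "\<xi> \<in> Rays" using assms(3) sets.sets_into_space[of A ES] space_ES by auto
  then have "\<xi> (dep x) \<noteq> x" using xi assms(4) Bd_iff by blast
  \<comment> \<open>The end passes the level of \<open>x\<close> at a different vertex, whose branch
    is disjoint from that of \<open>x\<close>.\<close>
  then have "br (\<xi> (dep x)) \<inter> br x = {}" using br_same_level[of _ _ x] dep_ray[OF r] by auto
  then show "\<exists>y. \<xi> \<in> Bd y \<and> br y \<inter> br x = {}" using Bd_ray[OF r] by blast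
qed (use assms in auto)

end

section \<open>The Poisson transform along an edge\<close>

context tree_walk
begin

definition N :: "'a \<Rightarrow> real" where "N x = measure (nu rt) (Bd x)"
definition c :: "'a \<Rightarrow> real" where "c v = 1 / (G rt rt * F v rt)"
abbreviation a :: "'a \<Rightarrow> real" where "a \<equiv> conductance rt par p"

lemma c_pos: "c v > 0"
  using G_diag_pos F_rt_pos by (simp add: c_def)

lemma a_pos: "x \<noteq> rt \<Longrightarrow> a x > 0"
  using mw_pos p_par_pos by (simp add: conductance_def)

lemma N_nonneg [simp]: "N x \<ge> 0" by (simp add: N_def)

lemma N_rt: "N rt = 1"
  using prob_space.prob_space[OF prob_space_nu[of rt]] by (simp add: N_def)

lemma nu_from_rt: "A \<in> sets ES \<Longrightarrow> A \<subseteq> Bd x \<Longrightarrow> measure (nu rt) A = F rt x * measure (nu x) A"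
  using nu_down[of x rt A] rt_in_br[of x] by (cases "x = rt") auto

lemma nu_from_par: "x \<noteq> rt \<Longrightarrow> A \<in> sets ES \<Longrightarrow> A \<subseteq> Bd x \<Longrightarrow> measure (nu (par x)) A = F (par x) x * measure (nu x) A"
  using nu_down[of x "par x" A] par_notin_br[of x] by auto

lemma nu_to_par: "x \<noteq> rt \<Longrightarrow> A \<in> sets ES \<Longrightarrow> A \<subseteq> Rays - Bd x \<Longrightarrow> measure (nu x) A = F x (par x) * measure (nu (par x)) A"
  using nu_up[of x x A] by (auto simp: disjoint_iff subset_iff)

lemma Rays_sets [simp]: "Rays \<in> sets ES"
  using Bd_sets[of rt] by simp

lemma Rays_Diff_Bd_sets [simp]: "Rays - Bd x \<in> sets ES"
  by (rule sets.Diff) auto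

text \<open>With \<open>h\<close> the Poisson transform of \<open>f\<close> and \<open>S\<^sub>x = \<integral>\<^bsub>\<partial>T\<^sub>x\<^esub> f d\<nu>\<^sub>o\<close>, the values of \<open>h\<close> at the two ends
  of an edge are related by splitting the integral over \<open>\<partial>T\<close> into \<open>\<partial>T\<^sub>x\<close> and its complement.\<close>

lemma integrable_nu:
  fixes f :: "(nat \<Rightarrow> 'a) \<Rightarrow> real"
  assumes f: "integrable (nu rt) f"
  shows "integrable (nu x) f"
proof (induction x rule: vertex_induct)
  case (step x)
  have m: "f \<in> borel_measurable ES" using borel_measurable_integrable[OF f] by (simp cong: measurable_cong_sets)
  then have mm: "f \<in> borel_measurable (nu z)" for z by (simp cong: measurable_cong_sets)
  note fin = finite_measure_nu finite_measure_nu
  have 1: "integrable (nu x) (\<lambda>\<xi>. indicator (Bd x) \<xi> * f \<xi>)"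
  proof -
    have "integrable (nu rt) (\<lambda>\<xi>. indicator (Bd x) \<xi> * f \<xi>)"
      using integrable_mult_indicator[OF _ f, of "Bd x"] by simp
    then show ?thesis
      by (subst (asm) restricted_integral(2)[OF fin, where c = "F rt x"])
         (use mm nu_from_rt F_from_rt_pos in auto)
  qed
  have "integrable (nu (par x)) (\<lambda>\<xi>. indicator (Rays - Bd x) \<xi> * f \<xi>)"
    using integrable_mult_indicator[OF _ step(2), of "Rays - Bd x"] by simp
  then have 2: "integrable (nu x) (\<lambda>\<xi>. indicator (Rays - Bd x) \<xi> * f \<xi>)"
    by (rule restricted_integral(3)[OF fin, where c = "F x (par x)", rotated -1])
       (use mm nu_to_par[OF step(1)] in auto)
  have "integrable (nu x) (\<lambda>\<xi>. indicator (Bd x) \<xi> * f \<xi> + indicator (Rays - Bd x) \<xi> * f \<xi>)"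
    using 1 2 by (rule Bochner_Integration.integrable_add)
  then show ?case
    by (rule Bochner_Integration.integrable_cong[THEN iffD1, rotated -1])
       (auto split: split_indicator)
qed (rule f)

lemma poisson_step:
  fixes f :: "(nat \<Rightarrow> 'a) \<Rightarrow> real"
  assumes f: "integrable (nu rt) f" and x: "x \<noteq> rt"
  shows "poisson rt par p f x = F x (par x) * poisson rt par p f (par x)
    + (1 - F x (par x) * F (par x) x) * (\<integral>\<xi>. indicator (Bd x) \<xi> * f \<xi> \<partial>nu rt) / F rt x"
proof -
  have m: "f \<in> borel_measurable ES" using borel_measurable_integrable[OF f] by (simp cong: measurable_cong_sets)
  then have mm: "f \<in> borel_measurable (nu z)" for z by (simp cong: measurable_cong_sets)
  note fin = finite_measure_nu finite_measure_nu
  define J1 J2 where "J1 z = (\<integral>\<xi>. indicator (Bd x) \<xi> * f \<xi> \<partial>nu z)"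
    and "J2 z = (\<integral>\<xi>. indicator (Rays - Bd x) \<xi> * f \<xi> \<partial>nu z)" for z
  have split: "poisson rt par p f z = J1 z + J2 z" for z
  proof -
    have "integrable (nu z) (\<lambda>\<xi>. indicator (Bd x) \<xi> * f \<xi>)" "integrable (nu z) (\<lambda>\<xi>. indicator (Rays - Bd x) \<xi> * f \<xi>)"
      using integrable_mult_indicator[OF _ integrable_nu[OF f], of "Bd x" z]
         integrable_mult_indicator[OF _ integrable_nu[OF f], of "Rays - Bd x" z] by auto
    from Bochner_Integration.integral_add[OF this] show ?thesis
      unfolding J1_def J2_def poisson_def
      by (subst Bochner_Integration.integral_cong[OF refl, of _ f "\<lambda>\<xi>. indicator (Bd x) \<xi> * f \<xi> + indicator (Rays - Bd x) \<xi> * f \<xi>"])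
         (auto split: split_indicator)
  qed
  have "J1 rt = F rt x * J1 x" unfolding J1_def
    by (rule restricted_integral(1)[OF fin]) (use mm nu_from_rt in auto)
  then have 1: "J1 x = J1 rt / F rt x" using F_from_rt_pos[of x] by simp
  have 2: "J1 (par x) = F (par x) x * J1 x" unfolding J1_def
    by (rule restricted_integral(1)[OF fin]) (use mm nu_from_par[OF x] in auto)
  have 3: "J2 x = F x (par x) * J2 (par x)" unfolding J2_def
    by (rule restricted_integral(1)[OF fin]) (use mm nu_to_par[OF x] in auto)
  have "poisson rt par p f x = J1 x + F x (par x) * (poisson rt par p f (par x) - F (par x) x * J1 x)"
    unfolding split 2 3 by simp
  then show ?thesis unfolding 1 J1_def[symmetric] by (simp add: algebra_simps diff_divide_distrib)
qed

text \<open>\<open>poisson_step\<close> for the constant function 1.\<close>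

lemma edge_prob:
  assumes x: "x \<noteq> rt"
  shows "1 = F x (par x) + (1 - F x (par x) * F (par x) x) * N x / F rt x"
proof -
  have 1: "poisson rt par p (\<lambda>_. 1) z = 1" for z
    using prob_space.prob_space[OF prob_space_nu[of z]] by (simp add: poisson_def)
  have "integrable (nu rt) (\<lambda>_. 1 :: real)"
    using finite_measure.integrable_const[OF finite_measure_nu] .
  from poisson_step[OF this x] show ?thesis unfolding 1 N_def
    by (simp add: Int_absorb2[OF Bd_subset])
qed

text \<open>\<open>exit_formula\<close> contains the factor \<open>G x x\<close>; reversibility
  between \<open>x\<close> and the root trades it for \<open>G rt rt\<close>, which is the one
  occurring in \<open>c\<close>.\<close>

lemma edge_conductance:
  assumes x: "x \<noteq> rt"
  shows "a x * (1 - F x (par x) * F (par x) x) = c (par x) * F rt x"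
proof -
  let ?b = "F x (par x)"
  have b: "?b > 0" "F (par x) rt > 0" "G rt rt > 0" "G x x > 0" "F rt x > 0"
    using F_adj_pos[OF x] F_rt_pos G_diag_pos F_from_rt_pos by auto
  have rev: "mw x * (?b * F (par x) rt * G rt rt) = F rt x * G x x"
    using G_reversible[of x rt] G_F[of x rt] G_F[of rt x] F_rt_step[OF x] by simp
  have "a x * (1 - ?b * F (par x) x) * (G x x * ?b * (F (par x) rt * G rt rt))
     = (mw x * (?b * F (par x) rt * G rt rt)) * (G x x * p x (par x) * (1 - ?b * F (par x) x))"
    by (simp add: conductance_def)
  also have "\<dots> = F rt x * (G x x * ?b)"
    unfolding rev exit_formula[OF x] by simp
  finally have "a x * (1 - ?b * F (par x) x) * (F (par x) rt * G rt rt) = F rt x"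
    using b by simp
  then show ?thesis using b by (simp add: c_def field_simps)
qed

lemma c_step: "x \<noteq> rt \<Longrightarrow> c (par x) = F x (par x) * c x"
  using F_rt_step[of x] F_adj_pos(1)[of x] by (simp add: c_def)

lemma c_par_le: "x \<noteq> rt \<Longrightarrow> c (par x) \<le> c x"
  using c_step[of x] F_le_1[of x "par x"] c_pos[of x] mult_right_mono[of "F x (par x)" 1 "c x"] by simp

text \<open>The left side is the current through the edge when \<open>par x\<close> has potential 1
  and \<open>F\<close> with target \<open>par x\<close> is the potential in the branch of
  \<open>x\<close>. So the right side is the effective conductance from \<open>par x\<close> through
  this edge to the ends.\<close>

lemma edge_conductance_N:
  assumes x: "x \<noteq> rt"
  shows "a x * (1 - F x (par x)) = c (par x) * N x"
proof -
  have "1 - F x (par x) = (1 - F x (par x) * F (par x) x) * N x / F rt x"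
    using edge_prob[OF x] by simp
  then have "a x * (1 - F x (par x)) = a x * (1 - F x (par x) * F (par x) x) * N x / F rt x"
    by simp
  also have "\<dots> = c (par x) * N x"
    unfolding edge_conductance[OF x] using F_from_rt_pos[of x] by simp
  finally show ?thesis .
qed

lemma N_ch: "N y = (\<Sum>x\<in>ch y. N x)"
  unfolding N_def Bd_ch[of y]
  by (rule finite_measure.finite_measure_finite_Union[OF finite_measure_nu])
     (auto simp: disjoint_family_on_def dep_ch dest: Bd_same_level)

primrec desc :: "'a \<Rightarrow> nat \<Rightarrow> 'a set" where
  "desc y 0 = {y}"
| "desc y (Suc j) = (\<Union>x\<in>desc y j. ch x)"

lemma finite_desc [simp]: "finite (desc y j)"
  by (induction j) auto

lemma dep_desc: "v \<in> desc y j \<Longrightarrow> dep v = dep y + j"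
  by (induction j arbitrary: v) (auto simp: dep_ch)

lemma sum_desc_Suc: "sum g (desc y (Suc j)) = (\<Sum>v\<in>desc y j. sum g (ch v))"
  unfolding desc.simps by (rule sum.UNION_disjoint) (auto simp: ch_iff)

lemma desc_Suc_rt: "v \<in> desc y (Suc j) \<Longrightarrow> v \<noteq> rt \<and> par v \<in> desc y j"
  by (auto simp: ch_iff)

lemma sum_Lv_desc: "(\<Sum>y\<in>Lv n. sum g (desc y j)) = sum g (Lv (n + j))"
proof (induction j arbitrary: g)
  case (Suc j)
  then show ?case using sum_Lv_Suc[of g "n + j"] by (simp only: sum_desc_Suc add_Suc_right)
qed simp

end

section \<open>Energy of the Poisson transform\<close>

locale boundary_function = tree_walk +
  fixes \<phi> :: "(nat \<Rightarrow> 'a) \<Rightarrow> real"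
  assumes phi_int: "integrable (nu rt) \<phi>"
begin

abbreviation h :: "'a \<Rightarrow> real" where "h \<equiv> poisson rt par p \<phi>"
definition I :: "'a \<Rightarrow> real" where "I x = (\<integral>\<xi>. indicator (Bd x) \<xi> * \<phi> \<xi> \<partial>nu rt)"
text \<open>The current of \<open>h\<close> through the edge above \<open>x\<close>
  (\<open>flow_gradient\<close>). Unlike the gradient, this formula makes sense at the root, where
  it gives 0, so that \<open>flow_kirchhoff\<close> holds at every vertex.\<close>

definition flow :: "'a \<Rightarrow> real" where "flow x = c x * (I x - N x * h x)"

lemma int_Bd: "integrable (nu rt) (\<lambda>\<xi>. indicator (Bd x) \<xi> * \<phi> \<xi>)"
  using integrable_mult_indicator[OF _ phi_int, of "Bd x"] by simp

lemma h_rt: "h rt = I rt"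
  unfolding poisson_def I_def by (rule Bochner_Integration.integral_cong) auto

lemma I_ch: "I y = (\<Sum>x\<in>ch y. I x)"
proof -
  have "indicator (Bd y) \<xi> * \<phi> \<xi> = (\<Sum>x\<in>ch y. indicator (Bd x) \<xi> * \<phi> \<xi>)" for \<xi>
  proof -
    have "(indicator (Bd y) \<xi> :: real) = (\<Sum>x\<in>ch y. indicator (Bd x) \<xi>)"
      unfolding Bd_ch[of y] by (rule indicator_UN_disjoint) (auto simp: disjoint_family_on_def dep_ch dest: Bd_same_level)
    then show ?thesis by (simp add: sum_distrib_right)
  qed
  then show ?thesis unfolding I_def by (simp only: Bochner_Integration.integral_sum[OF int_Bd])
qed

text \<open>Makes averages over null branches harmless: numerator and denominator vanish
  together.\<close>

lemma I_zero: "N x = 0 \<Longrightarrow> I x = 0"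
proof -
  assume "N x = 0"
  then have "emeasure (nu rt) (Bd x) = 0"
    using finite_measure.emeasure_eq_measure[OF finite_measure_nu] by (simp add: N_def)
  then have "AE \<xi> in nu rt. \<xi> \<notin> Bd x" by (intro AE_not_in) (auto simp: null_sets_def)
  then have "I x = (\<integral>\<xi>. 0 \<partial>nu rt)" unfolding I_def
    by (intro integral_cong_AE) (use int_Bd[of x] borel_measurable_integrable in \<open>auto elim: AE_mp\<close>)
  then show ?thesis by simp
qed

text \<open>Here all successors of a vertex share the same weight and the same value of
  \<open>h\<close>, so Kirchhoff's law becomes additivity of \<open>I\<close> and
  \<open>N\<close>.\<close>

lemma flow_par:
  assumes x: "x \<noteq> rt" shows "flow x = c (par x) * (I x - N x * h (par x))"
proof -
  let ?b = "F x (par x)" and ?K = "(1 - F x (par x) * F (par x) x) / F rt x"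
  have h: "h x = ?b * h (par x) + ?K * I x"
    using poisson_step[OF phi_int x] by (simp add: I_def)
  have 1: "?K * N x = 1 - ?b" using edge_prob[OF x] by simp
  have "I x - N x * h x = I x - (?K * N x) * I x - N x * ?b * h (par x)"
    unfolding h by (simp add: algebra_simps)
  also have "\<dots> = ?b * (I x - N x * h (par x))" unfolding 1 by (simp add: algebra_simps)
  finally show ?thesis by (simp add: flow_def c_step[OF x])
qed

lemma flow_gradient:
  assumes x: "x \<noteq> rt" shows "flow x = a x * (h x - h (par x))"
proof -
  let ?b = "F x (par x)" and ?K = "(1 - F x (par x) * F (par x) x) / F rt x"
  have h: "h x = ?b * h (par x) + ?K * I x"
    using poisson_step[OF phi_int x] by (simp add: I_def)
  have K: "a x * ?K = c (par x)" using edge_conductance[OF x] F_from_rt_pos[of x] by simp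
  have "a x * (h x - h (par x)) = a x * ?K * I x - a x * (1 - ?b) * h (par x)"
    unfolding h by (simp add: algebra_simps)
  also have "\<dots> = c (par x) * (I x - N x * h (par x))"
    unfolding K edge_conductance_N[OF x] by (simp add: algebra_simps)
  finally show ?thesis using flow_par[OF x] by simp
qed

lemma flow_kirchhoff: "(\<Sum>x\<in>ch y. flow x) = flow y"
proof -
  have "(\<Sum>x\<in>ch y. flow x) = (\<Sum>x\<in>ch y. c y * (I x - N x * h y))"
    by (rule sum.cong) (auto simp: ch_iff flow_par)
  also have "\<dots> = c y * ((\<Sum>x\<in>ch y. I x) - (\<Sum>x\<in>ch y. N x) * h y)"
    by (simp add: sum_distrib_left[symmetric] sum_subtractf sum_distrib_right)
  finally show ?thesis by (simp add: flow_def I_ch[of y] N_ch[of y])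
qed

text \<open>If \<open>N x \<noteq> 0\<close>, then \<open>q x = \<integral>\<^bsub>\<partial>T\<^sub>x\<^esub> A\<^sub>x\<^sup>2 d\<nu>\<^sub>o\<close> and \<open>dev z x = N x (z - A\<^sub>x)\<^sup>2\<close>, where
  \<open>A\<^sub>x = I x / N x\<close> is the average of \<open>\<phi>\<close> over \<open>\<partial>T\<^sub>x\<close>; both vanish if \<open>N x = 0\<close>. So \<open>V y\<close> is the
  variance that the averages gain by passing from \<open>y\<close> to its successors.\<close>

definition q :: "'a \<Rightarrow> real" where "q x = (I x)\<^sup>2 / N x"
definition V :: "'a \<Rightarrow> real" where "V y = (\<Sum>x\<in>ch y. q x) - q y"
definition en :: "'a \<Rightarrow> real" where "en x = (h x - h (par x))\<^sup>2 * a x"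
definition dev :: "real \<Rightarrow> 'a \<Rightarrow> real" where "dev z x = N x * z\<^sup>2 - 2 * z * I x + q x"
definition En :: "nat \<Rightarrow> real" where "En n = (\<Sum>k<n. \<Sum>x\<in>Lv (Suc k). en x)"
definition Wn :: "nat \<Rightarrow> real" where "Wn n = (\<Sum>k<n. \<Sum>y\<in>Lv k. c y * V y)"
definition Dn :: "nat \<Rightarrow> real" where "Dn n = (\<Sum>x\<in>Lv n. c x * dev (h x) x)"

lemma dev_eq: "N x \<noteq> 0 \<Longrightarrow> dev z x = (I x - N x * z)\<^sup>2 / N x"
  by (simp add: dev_def q_def field_simps power2_eq_square)

lemma dev_zero: "N x = 0 \<Longrightarrow> dev z x = 0"
  using I_zero by (simp add: dev_def q_def)

lemma dev_nonneg: "dev z x \<ge> 0"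
  using dev_eq[of x z] dev_zero[of x z] by (cases "N x = 0") auto

lemma q_nonneg: "q x \<ge> 0" by (simp add: q_def)

text \<open>Parallel axis theorem: \<open>z\<close> drops out because \<open>I\<close> and
  \<open>N\<close> are additive over successors. Taking for \<open>z\<close> the average at
  \<open>y\<close> kills the second term and yields \<open>V_nonneg\<close>.\<close>

lemma dev_ch: "(\<Sum>x\<in>ch y. dev z x) - dev z y = V y"
  by (simp add: dev_def V_def sum.distrib sum_subtractf sum_distrib_left[symmetric] sum_distrib_right[symmetric]
      I_ch[of y] N_ch[of y])

lemma V_nonneg: "V y \<ge> 0"
proof -
  have "dev (I y / N y) y = 0"
    using dev_eq[of y] dev_zero[of y] by (cases "N y = 0") auto
  then have "V y = (\<Sum>x\<in>ch y. dev (I y / N y) x)" using dev_ch[of "I y / N y" y] by simp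
  then show ?thesis using dev_nonneg by (simp add: sum_nonneg)
qed

lemma en_nonneg: "x \<noteq> rt \<Longrightarrow> en x \<ge> 0"
  using a_pos[of x] by (simp add: en_def)

lemma en_flow: "x \<noteq> rt \<Longrightarrow> en x = flow x * (h x - h (par x))"
  by (simp add: en_def flow_gradient power2_eq_square)

text \<open>With A the average at \<open>x\<close>, each weighted deviation is the flow times A
  minus \<open>h\<close> at the respective end of the edge, by the two expressions for the flow.
  Their difference is the flow times the increment of \<open>h\<close>.\<close>

lemma en_dev:
  assumes x: "x \<noteq> rt" shows "en x + c x * dev (h x) x = c (par x) * dev (h (par x)) x"
proof (cases "N x = 0")
  case True
  then have "flow x = 0" using I_zero by (simp add: flow_def)
  then show ?thesis using dev_zero[OF True] en_flow[OF x] by simp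
next
  case False
  have 1: "c x * dev (h x) x = flow x * (I x - N x * h x) / N x"
    by (simp add: dev_eq[OF False] flow_def power2_eq_square)
  have 2: "c (par x) * dev (h (par x)) x = flow x * (I x - N x * h (par x)) / N x"
    by (simp add: dev_eq[OF False] flow_par[OF x] power2_eq_square)
  show ?thesis unfolding 1 2 en_flow[OF x] using False by (simp add: field_simps)
qed

lemma energy_identity: "En n + Dn n = Wn n"
proof (induction n)
  case 0
  have "dev (h rt) rt = 0" using dev_eq[of rt "h rt"] by (simp add: h_rt N_rt)
  then show ?case by (simp add: En_def Dn_def Wn_def Lv_0)
next
  case (Suc n)
  have "(\<Sum>x\<in>Lv (Suc n). en x) + Dn (Suc n) = (\<Sum>x\<in>Lv (Suc n). en x + c x * dev (h x) x)"
    by (simp add: Dn_def sum.distrib)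
  also have "\<dots> = (\<Sum>y\<in>Lv n. \<Sum>x\<in>ch y. c y * dev (h y) x)"
    unfolding sum_Lv_Suc by (intro sum.cong refl) (auto simp: ch_iff en_dev)
  also have "\<dots> = (\<Sum>y\<in>Lv n. c y * V y + c y * dev (h y) y)"
    using dev_ch by (intro sum.cong refl) (simp add: sum_distrib_left[symmetric] algebra_simps flip: dev_ch)
  also have "\<dots> = (\<Sum>y\<in>Lv n. c y * V y) + Dn n"
    by (simp add: Dn_def sum.distrib)
  finally show ?case using Suc by (simp add: En_def Wn_def)
qed

end

section \<open>Thomson's principle in a branch\<close>

locale dirichlet_function = tree_walk +
  fixes \<phi> :: "(nat \<Rightarrow> 'a) \<Rightarrow> real"
  assumes phi_dir: "\<phi> \<in> dirichlet_space rt par p"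

sublocale dirichlet_function \<subseteq> boundary_function
  using phi_dir by unfold_locales (simp add: dirichlet_space_def)

context tree_walk
begin

lemma a_mw: "x \<in> ch u \<Longrightarrow> a x = mw u * p u x"
  using mw_step[of x] by (auto simp: conductance_def ch_iff)

lemma gradient_divergence:
  assumes u: "u \<noteq> rt"
  shows "a u * (f u - f (par u)) - (\<Sum>x\<in>ch u. a x * (f x - f u)) = mw u * (f u - Pop f u)"
proof -
  have "(\<Sum>x\<in>ch u. a x * (f x - f u)) = (\<Sum>x\<in>ch u. mw u * (p u x * (f x - f u)))"
    by (rule sum.cong) (auto simp: a_mw)
  also have "\<dots> = mw u * (\<Sum>x\<in>ch u. p u x * (f x - f u))" by (simp add: sum_distrib_left)
  finally have 1: "(\<Sum>x\<in>ch u. a x * (f x - f u)) = mw u * (\<Sum>x\<in>ch u. p u x * (f x - f u))" .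
  have "Pop f u - f u = Pop (\<lambda>z. f z - f u) u" by (simp add: Pop_diff Pop_const)
  also have "\<dots> = (\<Sum>x\<in>ch u. p u x * (f x - f u)) + p u (par u) * (f (par u) - f u)"
    unfolding Pop_def sum_nb using u by simp
  finally have "(\<Sum>x\<in>ch u. p u x * (f x - f u)) = Pop f u - f u - p u (par u) * (f (par u) - f u)" by simp
  then have 2: "(\<Sum>x\<in>ch u. p u x * (f x - f u)) = Pop f u - f u - p u (par u) * (f (par u) - f u)" .
  show ?thesis unfolding 1 2 using mw_step[OF u] by (simp add: conductance_def algebra_simps)
qed

text \<open>Summation by parts over the finite subtree: the term at the lowest generation vanishes,
  the term at \<open>y\<close> is the bound, and the interior terms have a sign by
  subharmonicity.\<close>

lemma branch_energy_le:
  assumes f: "\<And>v. f v \<ge> 0" and sub: "\<And>u. u \<noteq> y \<Longrightarrow> f u \<le> Pop f u" and van: "\<And>v. v \<in> desc y m \<Longrightarrow> f v = 0"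
    and m: "m > 0"
  shows "(\<Sum>j<m. \<Sum>v\<in>desc y (Suc j). a v * (f v - f (par v))\<^sup>2) \<le> f y * (\<Sum>x\<in>ch y. a x * (f y - f x))"
proof -
  define J where "J v = a v * (f v - f (par v))" for v
  define A where "A j = (\<Sum>v\<in>desc y j. f v * J v)" for j
  define B where "B j = (\<Sum>u\<in>desc y j. f u * (\<Sum>v\<in>ch u. J v))" for j
  have s: "(\<Sum>v\<in>desc y (Suc j). a v * (f v - f (par v))\<^sup>2) = A (Suc j) - B j" for j
  proof -
    have "(\<Sum>v\<in>desc y (Suc j). a v * (f v - f (par v))\<^sup>2) = A (Suc j) - (\<Sum>v\<in>desc y (Suc j). f (par v) * J v)"
      unfolding A_def sum_subtractf[symmetric]
      by (intro sum.cong refl) (simp add: J_def power2_eq_square algebra_simps)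
    also have "(\<Sum>v\<in>desc y (Suc j). f (par v) * J v) = B j"
      unfolding sum_desc_Suc B_def sum_distrib_left
      by (intro sum.cong refl) (simp add: ch_iff)
    finally show ?thesis .
  qed
  \<comment> \<open>At an interior vertex the increment along the edge above, weighted by its
    conductance, is at most the sum of those below; this is subharmonicity read through
    \<open>gradient_divergence\<close>.\<close>
  have AB: "A j \<le> B j" if "j > 0" for j
    unfolding A_def B_def
  proof (intro sum_mono mult_left_mono f)
    fix u assume u: "u \<in> desc y j"
    then have ur: "u \<noteq> rt" using that desc_Suc_rt by (cases j) auto
    have uy: "u \<noteq> y" using dep_desc[OF u] that by auto
    have "(\<Sum>v\<in>ch u. J v) = (\<Sum>x\<in>ch u. a x * (f x - f u))"
      by (rule sum.cong) (auto simp: J_def ch_iff)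
    moreover have "mw u * (f u - Pop f u) \<le> 0"
      using sub[OF uy] mw_pos[of u] by (simp add: mult_le_0_iff)
    ultimately show "J u \<le> (\<Sum>v\<in>ch u. J v)"
      using gradient_divergence[OF ur, of f] by (simp add: J_def)
  qed
  have "(\<Sum>j<Suc k. A (Suc j) - B j) \<le> A (Suc k) - B 0" for k
  proof (induction k)
    case (Suc k)
    then show ?case using AB[of "Suc k"] by (simp only: sum.lessThan_Suc) simp
  qed simp
  from this[of "m - 1"] have "(\<Sum>j<m. A (Suc j) - B j) \<le> A m - B 0" using m by simp
  moreover have "A m = 0" using van by (simp add: A_def)
  moreover have "B 0 = - (f y * (\<Sum>x\<in>ch y. a x * (f y - f x)))"
    unfolding B_def J_def
    by (simp add: ch_iff flip: mult_minus_right sum_negf cong: sum.cong)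
       (intro disjI2 sum.cong; auto simp: ch_iff algebra_simps)
  ultimately show ?thesis unfolding s by simp
qed

lemma ns_zero: "dep x > dep y + k \<Longrightarrow> ns k x y = 0"
proof (induction k arbitrary: x)
  case (Suc k)
  have "Pop (\<lambda>z. ns k z y) x = Pop (\<lambda>_. 0) x"
  proof (rule Pop_cong)
    fix z assume "z \<in> nb x"
    then have "dep x \<le> Suc (dep z)" using dep_par by (auto simp: nb_def tadj_def)
    then show "ns k z y = 0" using Suc by simp
  qed
  then show ?case by (simp only: ns_Suc Pop_const)
qed auto

text \<open>The pole comes first, so that \<open>Gn n y\<close> is a function of the starting point,
  ready to serve as a test function.\<close>

definition Gn :: "nat \<Rightarrow> 'a \<Rightarrow> 'a \<Rightarrow> real" where "Gn n y x = (\<Sum>k<n. ns k x y)"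

lemma Gn_nonneg: "Gn n y x \<ge> 0" by (simp add: Gn_def sum_nonneg)

lemma Gn_tendsto: "(\<lambda>n. Gn n y x) \<longlonglongrightarrow> G x y"
  unfolding Gn_def green_def by (rule summable_LIMSEQ[OF ns_summable])

text \<open>The operator shifts the partial sum by one step. Off the pole the term of step 0
  vanishes, so nothing is lost and one nonnegative term is gained.\<close>

lemma Gn_sub: "u \<noteq> y \<Longrightarrow> Gn n y u \<le> Pop (Gn n y) u"
proof -
  assume u: "u \<noteq> y"
  have "Pop (Gn n y) u = (\<Sum>k<n. ns (Suc k) u y)"
    unfolding Gn_def Pop_sum ns_Suc ..
  also have "\<dots> = (\<Sum>k<Suc n. ns k u y)" using u by (simp only: sum.lessThan_Suc_shift) simp
  finally show ?thesis by (simp add: Gn_def)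
qed

lemma Gn_van: "v \<in> desc y n \<Longrightarrow> Gn n y v = 0"
  unfolding Gn_def by (rule sum.neutral) (simp add: dep_desc ns_zero)

end

context boundary_function
begin

definition Xn :: "'a \<Rightarrow> nat \<Rightarrow> real" where "Xn y m = (\<Sum>j<m. \<Sum>v\<in>desc y (Suc j). en v)"

lemma Xn_nonneg: "Xn y m \<ge> 0"
  unfolding Xn_def by (intro sum_nonneg en_nonneg) (use desc_Suc_rt in blast)

text \<open>By Kirchhoff's law the generations telescope, and \<open>f\<close> vanishes at the
  lowest one, so only the contribution of \<open>y\<close> survives.\<close>

lemma flow_test_function:
  assumes van: "\<And>v. v \<in> desc y m \<Longrightarrow> f v = 0"
  shows "(\<Sum>j<m. \<Sum>v\<in>desc y (Suc j). (f v - f (par v)) * flow v) = - (f y * flow y)"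
proof -
  define A where "A j = (\<Sum>v\<in>desc y j. f v * flow v)" for j
  have s: "(\<Sum>v\<in>desc y (Suc j). (f v - f (par v)) * flow v) = A (Suc j) - A j" for j
  proof -
    have "(\<Sum>v\<in>desc y (Suc j). f (par v) * flow v) = (\<Sum>u\<in>desc y j. f u * (\<Sum>v\<in>ch u. flow v))"
      unfolding sum_desc_Suc sum_distrib_left by (intro sum.cong refl) (simp add: ch_iff)
    also have "\<dots> = A j" unfolding flow_kirchhoff A_def ..
    finally show ?thesis unfolding A_def by (simp only: left_diff_distrib sum_subtractf)
  qed
  have "(\<Sum>j<m. A (Suc j) - A j) = A m - A 0" by (rule sum_lessThan_telescope)
  moreover have "A m = 0" unfolding A_def using van by simp
  ultimately show ?thesis unfolding s by (simp add: A_def)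
qed

lemma thomson_test:
  assumes van: "\<And>v. v \<in> desc y m \<Longrightarrow> f v = 0"
  shows "(f y * flow y)\<^sup>2 \<le> (\<Sum>j<m. \<Sum>v\<in>desc y (Suc j). a v * (f v - f (par v))\<^sup>2) * Xn y m"
proof -
  \<comment> \<open>The double sum is flattened so that the finite Cauchy-Schwarz inequality
    applies, with the square roots of the conductances split between the two gradients.\<close>
  let ?S = "SIGMA j:{..<m}. desc y (Suc j)"
  have sg: "(\<Sum>j<m. \<Sum>v\<in>desc y (Suc j). g v) = (\<Sum>t\<in>?S. g (snd t))" for g :: "'a \<Rightarrow> real"
    by (subst sum.Sigma) (auto simp del: desc.simps simp: split_beta)
  have nr: "snd t \<noteq> rt" if "t \<in> ?S" for t using that desc_Suc_rt[of "snd t"] by (auto simp del: desc.simps)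
  have "(f y * flow y)\<^sup>2 = (\<Sum>t\<in>?S. (f (snd t) - f (par (snd t))) * flow (snd t))\<^sup>2"
    using flow_test_function[of y m f, OF van] unfolding sg by (metis power2_minus)
  also have "\<dots> = (\<Sum>t\<in>?S. (sqrt (a (snd t)) * (f (snd t) - f (par (snd t)))) * (sqrt (a (snd t)) * (h (snd t) - h (par (snd t)))))\<^sup>2"
    by (rule arg_cong[of _ _ "\<lambda>x. x\<^sup>2"], rule sum.cong[OF refl])
       (use nr a_pos in \<open>auto simp: flow_gradient less_imp_le\<close>)
  also have "\<dots> \<le> (\<Sum>t\<in>?S. (sqrt (a (snd t)) * (f (snd t) - f (par (snd t))))\<^sup>2)
      * (\<Sum>t\<in>?S. (sqrt (a (snd t)) * (h (snd t) - h (par (snd t))))\<^sup>2)"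
    by (rule Cauchy_Schwarz_ineq_sum)
  also have "(\<Sum>t\<in>?S. (sqrt (a (snd t)) * (f (snd t) - f (par (snd t))))\<^sup>2) = (\<Sum>t\<in>?S. a (snd t) * (f (snd t) - f (par (snd t)))\<^sup>2)"
    by (rule sum.cong[OF refl]) (use nr a_pos in \<open>auto simp: power_mult_distrib less_imp_le\<close>)
  also have "(\<Sum>t\<in>?S. (sqrt (a (snd t)) * (h (snd t) - h (par (snd t))))\<^sup>2) = (\<Sum>t\<in>?S. en (snd t))"
    by (rule sum.cong[OF refl]) (use nr a_pos in \<open>auto simp: power_mult_distrib less_imp_le en_def\<close>)
  finally show ?thesis unfolding Xn_def sg .
qed

text \<open>The truncated Green functions are finitely supported and subharmonic off \<open>y\<close>; as test functions
  they bound the flow into \<open>T\<^sub>y\<close> by the energy there times the effective conductance from \<open>y\<close>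
  to \<open>\<partial>T\<^sub>y\<close>, which is \<open>c y * N y\<close>.\<close>

lemma thomson:
  assumes X: "\<And>m. Xn y m \<le> X"
  shows "(flow y)\<^sup>2 \<le> X * (c y * N y)"
proof -
  have "(Gn (Suc n) y y * flow y)\<^sup>2 \<le> X * (Gn (Suc n) y y * (\<Sum>x\<in>ch y. a x * (Gn (Suc n) y y - Gn (Suc n) y x)))" for n
  proof -
    let ?f = "Gn (Suc n) y" and ?e = "\<lambda>f. (\<Sum>j<Suc n. \<Sum>v\<in>desc y (Suc j). a v * (f v - f (par v))\<^sup>2)"
    have "?e ?f \<le> ?f y * (\<Sum>x\<in>ch y. a x * (?f y - ?f x))"
      by (rule branch_energy_le) (use Gn_nonneg Gn_sub Gn_van in auto)
    moreover have "(?f y * flow y)\<^sup>2 \<le> ?e ?f * Xn y (Suc n)"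
      by (rule thomson_test) (rule Gn_van)
    moreover have "0 \<le> ?e ?f"
    proof (intro sum_nonneg mult_nonneg_nonneg)
      fix j v assume "v \<in> desc y (Suc j)"
      then show "0 \<le> a v" using desc_Suc_rt a_pos[of v] by (simp add: less_imp_le del: desc.simps)
    qed simp
    ultimately show ?thesis
      using X[of "Suc n"] Xn_nonneg[of y "Suc n"] mult_mono[of "?e ?f" "?f y * (\<Sum>x\<in>ch y. a x * (?f y - ?f x))" "Xn y (Suc n)" X]
      by (simp add: mult.commute)
  qed
  moreover have "(\<lambda>n. (Gn (Suc n) y y * flow y)\<^sup>2) \<longlonglongrightarrow> (G y y * flow y)\<^sup>2"
    by (intro tendsto_intros LIMSEQ_Suc Gn_tendsto)
  moreover have "(\<lambda>n. X * (Gn (Suc n) y y * (\<Sum>x\<in>ch y. a x * (Gn (Suc n) y y - Gn (Suc n) y x))))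
      \<longlonglongrightarrow> X * (G y y * (\<Sum>x\<in>ch y. a x * (G y y - G x y)))"
    by (intro tendsto_intros LIMSEQ_Suc Gn_tendsto)
  ultimately have "(G y y * flow y)\<^sup>2 \<le> X * (G y y * (\<Sum>x\<in>ch y. a x * (G y y - G x y)))"
    by (intro LIMSEQ_le) auto
  \<comment> \<open>The limiting test function has the value \<open>G y y\<close> at
    \<open>y\<close>. By \<open>edge_conductance_N\<close> its current into each successor branch is
    this value times the effective conductance of that branch; the factor cancels at the
    end.\<close>
  also have "(\<Sum>x\<in>ch y. a x * (G y y - G x y)) = (\<Sum>x\<in>ch y. G y y * (c y * N x))"
  proof (rule sum.cong[OF refl])
    fix x assume "x \<in> ch y"
    then have x: "x \<noteq> rt" "par x = y" by (auto simp: ch_iff)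
    have "a x * (G y y - G x y) = G y y * (a x * (1 - F x y))" by (subst G_F[of x y]) (simp add: algebra_simps)
    also have "\<dots> = G y y * (c y * N x)" using edge_conductance_N[OF x(1)] x(2) by simp
    finally show "a x * (G y y - G x y) = G y y * (c y * N x)" .
  qed
  also have "\<dots> = G y y * (c y * N y)" by (simp add: N_ch[of y] sum_distrib_left)
  finally have "(G y y)\<^sup>2 * (flow y)\<^sup>2 \<le> (G y y)\<^sup>2 * (X * (c y * N y))"
    by (simp add: power2_eq_square algebra_simps)
  then show ?thesis using G_diag_pos[of y] by simp
qed

end

context dirichlet_function
begin

definition E :: real where "E = (\<Sum>\<^sub>\<infinity>x\<in>UNIV - {rt}. en x)"

lemma en_summable: "en summable_on (UNIV - {rt})"
  using phi_dir unfolding dirichlet_space_def en_def[abs_def] by simp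

lemma En_tendsto: "En \<longlonglongrightarrow> E"
proof -
  define A where "A n = (\<Union>k<n. Lv (Suc k))" for n
  have "En n = sum en (A n)" for n
    unfolding En_def A_def by (rule sum.UNION_disjoint[symmetric]) (simp_all, auto simp: Lv_def)
  then have "En = (\<lambda>n. sum en (A n))" by blast
  moreover have "(\<lambda>n. sum en (A n)) \<longlonglongrightarrow> E"
  proof -
    have "(sum en \<longlongrightarrow> E) (finite_subsets_at_top (UNIV - {rt}))"
      using en_summable infsum_tendsto unfolding E_def by blast
    moreover have "filterlim A (finite_subsets_at_top (UNIV - {rt})) sequentially"
      unfolding filterlim_finite_subsets_at_top
    proof (intro allI impI)
      fix X assume X: "finite X \<and> X \<subseteq> UNIV - {rt}"
      have "X \<subseteq> A n" if n: "n \<ge> Max (insert 0 (dep ` X))" for n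
      proof
        fix x assume x: "x \<in> X"
        then have "dep x \<le> n" using X n by (meson Max_ge finite_imageI finite_insert image_eqI insertI2 order_trans)
        moreover have "dep x = Suc (dep (par x))" using x X dep_par by blast
        ultimately show "x \<in> A n" by (auto simp: A_def Lv_def intro!: bexI[of _ "dep (par x)"])
      qed
      moreover have "finite (A n)" "A n \<subseteq> UNIV - {rt}" for n by (auto simp: A_def Lv_def[of "Suc _"] intro!: finite_UN_I) (auto simp: Lv_def[symmetric])
      ultimately show "\<forall>\<^sub>F n in sequentially. finite (A n) \<and> X \<subseteq> A n \<and> A n \<subseteq> UNIV - {rt}"
        by (auto simp: eventually_sequentially)
    qed
    ultimately show ?thesis by (rule filterlim_compose)
  qed
  ultimately show ?thesis by simp
qed

lemma Lv_Suc_rt: "x \<in> Lv (Suc n) \<Longrightarrow> x \<noteq> rt"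
  by (auto simp: Lv_def)

lemma En_le: "En n \<le> E"
proof (rule incseq_le[OF _ En_tendsto])
  show "incseq En"
    by (rule incseq_SucI) (simp add: En_def sum_nonneg en_nonneg Lv_Suc_rt)
qed

lemma Xn_sum: "(\<Sum>y\<in>Lv n. Xn y m) = En (n + m) - En n"
proof (induction m)
  case (Suc m)
  have "(\<Sum>y\<in>Lv n. Xn y (Suc m)) = (\<Sum>y\<in>Lv n. Xn y m) + (\<Sum>y\<in>Lv n. \<Sum>v\<in>desc y (Suc m). en v)"
    unfolding Xn_def by (simp only: sum.lessThan_Suc sum.distrib)
  then show ?case unfolding sum_Lv_desc Suc by (simp add: En_def)
qed (simp add: Xn_def)

lemma Dn_le: "Dn n \<le> E - En n"
proof -
  have inc: "incseq (Xn y)" for y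
    unfolding Xn_def by (rule incseq_SucI) (simp only: sum.lessThan_Suc, simp del: desc.simps, intro sum_nonneg en_nonneg, use desc_Suc_rt in blast)
  have le: "Xn y m \<le> E" if "y \<in> Lv n" for y m
  proof -
    have "Xn y m \<le> (\<Sum>y\<in>Lv n. Xn y m)" by (rule member_le_sum[OF that]) (auto simp: Xn_nonneg)
    also have "\<dots> \<le> E"
    proof -
      have "0 \<le> En n" by (simp add: En_def sum_nonneg en_nonneg Lv_Suc_rt)
      then show ?thesis unfolding Xn_sum using En_le[of "n + m"] by linarith
    qed
    finally show ?thesis .
  qed
  have "\<exists>X. Xn y \<longlonglongrightarrow> X" if "y \<in> Lv n" for y
    using incseq_convergent[OF inc, of y E] le[OF that] by metis
  \<comment> \<open>\<open>X y\<close> is the energy inside the branch of \<open>y\<close> alone.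
    Bounding every branch by the whole of \<open>E\<close> would not survive the summation over the
    level.\<close>
  then obtain X where X: "\<And>y. y \<in> Lv n \<Longrightarrow> Xn y \<longlonglongrightarrow> X y" by metis
  have bnd: "c y * dev (h y) y \<le> X y" if y: "y \<in> Lv n" for y
  proof (cases "N y = 0")
    case True
    have "0 \<le> X y" using X[OF y] by (rule LIMSEQ_le_const) (simp add: Xn_nonneg)
    then show ?thesis using dev_zero[OF True] by simp
  next
    case False
    then have pos: "c y * N y > 0" using c_pos[of y] N_nonneg[of y] by (simp del: N_nonneg add: less_le)
    have "(flow y)\<^sup>2 \<le> X y * (c y * N y)"
      by (rule thomson) (rule incseq_le[OF inc X[OF y]])
    \<comment> \<open>The weighted deviation is flow squared over effective conductance, exactly the
      quantity that \<open>thomson\<close> bounds by the energy in the branch.\<close>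
    moreover have "c y * dev (h y) y = (flow y)\<^sup>2 / (c y * N y)"
      using False c_pos[of y] by (simp add: dev_eq flow_def power2_eq_square field_simps)
    ultimately show ?thesis using pos by (simp add: divide_le_eq)
  qed
  have "Dn n \<le> (\<Sum>y\<in>Lv n. X y)" unfolding Dn_def by (intro sum_mono bnd)
  also have "\<dots> \<le> E - En n"
  proof (rule LIMSEQ_le)
    show "(\<lambda>m. \<Sum>y\<in>Lv n. Xn y m) \<longlonglongrightarrow> (\<Sum>y\<in>Lv n. X y)" by (rule tendsto_sum) (rule X)
    show "(\<lambda>m. E - En n) \<longlonglongrightarrow> E - En n" by simp
    show "\<exists>N. \<forall>m\<ge>N. (\<Sum>y\<in>Lv n. Xn y m) \<le> E - En n" unfolding Xn_sum using En_le by simp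
  qed
  finally show ?thesis .
qed

lemma Wn_tendsto: "Wn \<longlonglongrightarrow> E"
proof -
  have "Dn \<longlonglongrightarrow> 0"
  proof (rule tendsto_sandwich)
    show "\<forall>\<^sub>F n in sequentially. 0 \<le> Dn n"
      unfolding Dn_def using c_pos dev_nonneg by (simp add: sum_nonneg less_imp_le)
    show "\<forall>\<^sub>F n in sequentially. Dn n \<le> E - En n" using Dn_le by simp
    have "(\<lambda>n. E - En n) \<longlonglongrightarrow> E - E" by (intro tendsto_intros En_tendsto)
    then show "(\<lambda>n. E - En n) \<longlonglongrightarrow> 0" by simp
  qed simp
  then have "(\<lambda>n. En n + Dn n) \<longlonglongrightarrow> E + 0" by (intro tendsto_intros En_tendsto)
  then show ?thesis unfolding energy_identity by simp
qed

lemma Wn_le: "Wn n \<le> E"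
proof (rule incseq_le[OF _ Wn_tendsto])
  show "incseq Wn"
    by (rule incseq_SucI) (simp add: Wn_def sum_nonneg V_nonneg c_pos less_imp_le)
qed

end

section \<open>Approximation by level averages\<close>

context tree_walk
begin

abbreviation Z :: "(nat \<Rightarrow> 'a) measure" where "Z \<equiv> nu rt"
definition Ib :: "((nat \<Rightarrow> 'a) \<Rightarrow> real) \<Rightarrow> 'a \<Rightarrow> real" where
  "Ib f x = (\<integral>\<xi>. indicator (Bd x) \<xi> * f \<xi> \<partial>Z)"
text \<open>Conditional expectation given the first \<open>n\<close> levels; null branches get the
  value 0.\<close>

definition Ex :: "nat \<Rightarrow> ((nat \<Rightarrow> 'a) \<Rightarrow> real) \<Rightarrow> (nat \<Rightarrow> 'a) \<Rightarrow> real" where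
  "Ex n f \<xi> = (\<Sum>x\<in>Lv n. Ib f x / N x * indicator (Bd x) \<xi>)"

lemma prob_space_Z: "prob_space Z" by (rule prob_space_nu)

lemma int_ind: "integrable Z f \<Longrightarrow> integrable Z (\<lambda>\<xi>. indicator (Bd x) \<xi> * f \<xi>)" for f :: "(nat \<Rightarrow> 'a) \<Rightarrow> real"
  using integrable_mult_indicator[of "Bd x" Z f] by simp

lemma integrable_Bd: "integrable Z (indicator (Bd x) :: _ \<Rightarrow> real)"
  using int_ind[OF finite_measure.integrable_const[OF finite_measure_nu], of x 1] by simp

lemma measure_Bd [simp]: "measure Z (Bd x \<inter> Rays) = N x"
  by (simp add: N_def Int_absorb2[OF Bd_subset])

lemma integral_Bd: "(\<integral>\<xi>. indicator (Bd x) \<xi> \<partial>Z) = N x"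
  by simp

lemma Ib_add: "integrable Z f \<Longrightarrow> integrable Z g \<Longrightarrow> Ib (\<lambda>\<xi>. f \<xi> + g \<xi>) x = Ib f x + Ib g x"
  unfolding Ib_def by (simp add: distrib_left Bochner_Integration.integral_add[OF int_ind int_ind])

lemma Ib_diff: "integrable Z f \<Longrightarrow> integrable Z g \<Longrightarrow> Ib (\<lambda>\<xi>. f \<xi> - g \<xi>) x = Ib f x - Ib g x"
  unfolding Ib_def by (simp add: right_diff_distrib Bochner_Integration.integral_diff[OF int_ind int_ind])

lemma Ib_cmult: "Ib (\<lambda>\<xi>. k * f \<xi>) x = k * Ib f x"
  unfolding Ib_def by (simp add: mult.left_commute)

lemma Ib_Lv:
  assumes "integrable Z f" shows "(\<Sum>x\<in>Lv n. Ib f x) = (\<integral>\<xi>. f \<xi> \<partial>Z)"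
proof -
  interpret f: boundary_function rt par p f using assms by unfold_locales
  have "Ib f = f.I" by (simp add: fun_eq_iff Ib_def f.I_def)
  then have "(\<Sum>x\<in>Lv n. Ib f x) = Ib f rt"
    by (induction n) (simp_all add: Lv_0 sum_Lv_Suc f.I_ch[symmetric])
  also have "\<dots> = (\<integral>\<xi>. f \<xi> \<partial>Z)"
    unfolding Ib_def by (rule Bochner_Integration.integral_cong) auto
  finally show ?thesis .
qed

lemma abs_Ib_le: "integrable Z f \<Longrightarrow> \<bar>Ib f x\<bar> \<le> Ib (\<lambda>\<xi>. \<bar>f \<xi>\<bar>) x"
  unfolding Ib_def
  by (rule order_trans[OF integral_abs_bound]) (simp add: abs_mult)

lemma integrable_Ex: "integrable Z (Ex n f)"
  unfolding Ex_def[abs_def] by (intro Bochner_Integration.integrable_sum integrable_mult_right integrable_Bd)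

lemma Ex_add: "integrable Z f \<Longrightarrow> integrable Z g \<Longrightarrow> Ex n (\<lambda>\<xi>. f \<xi> + g \<xi>) \<xi> = Ex n f \<xi> + Ex n g \<xi>"
  by (simp add: Ex_def Ib_add add_divide_distrib distrib_right sum.distrib)

lemma Ex_diff: "integrable Z f \<Longrightarrow> integrable Z g \<Longrightarrow> Ex n (\<lambda>\<xi>. f \<xi> - g \<xi>) \<xi> = Ex n f \<xi> - Ex n g \<xi>"
  by (simp add: Ex_def Ib_diff diff_divide_distrib left_diff_distrib sum_subtractf)

lemma Ex_cmult: "Ex n (\<lambda>\<xi>. k * f \<xi>) \<xi> = k * Ex n f \<xi>"
  by (simp add: Ex_def Ib_cmult sum_distrib_left mult.assoc)

lemma Ex_contraction:
  assumes f: "integrable Z f" shows "(\<integral>\<xi>. \<bar>Ex n f \<xi>\<bar> \<partial>Z) \<le> (\<integral>\<xi>. \<bar>f \<xi>\<bar> \<partial>Z)"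
proof -
  have int: "integrable Z (\<lambda>\<xi>. \<Sum>x\<in>Lv n. \<bar>Ib f x\<bar> / N x * indicator (Bd x) \<xi>)"
    by (intro Bochner_Integration.integrable_sum integrable_mult_right integrable_Bd)
  have "(\<integral>\<xi>. \<bar>Ex n f \<xi>\<bar> \<partial>Z) \<le> (\<integral>\<xi>. (\<Sum>x\<in>Lv n. \<bar>Ib f x\<bar> / N x * indicator (Bd x) \<xi>) \<partial>Z)"
  proof (rule integral_mono)
    show "integrable Z (\<lambda>\<xi>. \<bar>Ex n f \<xi>\<bar>)" using integrable_Ex by (rule integrable_abs)
    show "\<bar>Ex n f \<xi>\<bar> \<le> (\<Sum>x\<in>Lv n. \<bar>Ib f x\<bar> / N x * indicator (Bd x) \<xi>)" for \<xi>
      unfolding Ex_def by (rule order_trans[OF sum_abs]) (simp add: abs_mult)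
  qed (rule int)
  also have "\<dots> = (\<Sum>x\<in>Lv n. \<bar>Ib f x\<bar> / N x * N x)"
    by (subst Bochner_Integration.integral_sum) (auto simp: integrable_Bd integral_Bd)
  also have "\<dots> \<le> (\<Sum>x\<in>Lv n. Ib (\<lambda>\<xi>. \<bar>f \<xi>\<bar>) x)"
  proof (rule sum_mono)
    fix x
    have "\<bar>Ib f x\<bar> / N x * N x \<le> \<bar>Ib f x\<bar>" by (cases "N x = 0") auto
    then show "\<bar>Ib f x\<bar> / N x * N x \<le> Ib (\<lambda>\<xi>. \<bar>f \<xi>\<bar>) x" using abs_Ib_le[OF f] order_trans by blast
  qed
  also have "\<dots> = (\<integral>\<xi>. \<bar>f \<xi>\<bar> \<partial>Z)" by (rule Ib_Lv) (use f in auto)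
  finally show ?thesis .
qed

text \<open>L1 convergence of the martingale of level averages. The class is shown to contain the
  basic sets and to be closed under the operations that generate all integrable functions.\<close>

definition approx :: "((nat \<Rightarrow> 'a) \<Rightarrow> real) \<Rightarrow> bool" where
  "approx f \<longleftrightarrow> integrable Z f \<and> (\<lambda>n. \<integral>\<xi>. \<bar>f \<xi> - Ex n f \<xi>\<bar> \<partial>Z) \<longlonglongrightarrow> 0"

lemma int_abs_diff_Ex: "integrable Z f \<Longrightarrow> integrable Z (\<lambda>\<xi>. \<bar>f \<xi> - Ex n f \<xi>\<bar>)"
  by (intro integrable_abs Bochner_Integration.integrable_diff integrable_Ex)

lemma approx_add: assumes "approx f" "approx g" shows "approx (\<lambda>\<xi>. f \<xi> + g \<xi>)"
proof -
  have i: "integrable Z f" "integrable Z g" using assms by (auto simp: approx_def)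
  have "(\<lambda>n. \<integral>\<xi>. \<bar>(f \<xi> + g \<xi>) - Ex n (\<lambda>\<xi>. f \<xi> + g \<xi>) \<xi>\<bar> \<partial>Z) \<longlonglongrightarrow> 0"
  proof (rule tendsto_sandwich[where f = "\<lambda>_. 0"])
    show "\<forall>\<^sub>F n in sequentially. (\<integral>\<xi>. \<bar>(f \<xi> + g \<xi>) - Ex n (\<lambda>\<xi>. f \<xi> + g \<xi>) \<xi>\<bar> \<partial>Z) \<le>
      (\<integral>\<xi>. \<bar>f \<xi> - Ex n f \<xi>\<bar> \<partial>Z) + (\<integral>\<xi>. \<bar>g \<xi> - Ex n g \<xi>\<bar> \<partial>Z)"
    proof (intro always_eventually allI)
      fix n
      have "(\<integral>\<xi>. \<bar>(f \<xi> + g \<xi>) - Ex n (\<lambda>\<xi>. f \<xi> + g \<xi>) \<xi>\<bar> \<partial>Z) \<le> (\<integral>\<xi>. \<bar>f \<xi> - Ex n f \<xi>\<bar> + \<bar>g \<xi> - Ex n g \<xi>\<bar> \<partial>Z)"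
      proof (rule integral_mono)
        show "integrable Z (\<lambda>\<xi>. \<bar>(f \<xi> + g \<xi>) - Ex n (\<lambda>\<xi>. f \<xi> + g \<xi>) \<xi>\<bar>)"
          by (intro int_abs_diff_Ex Bochner_Integration.integrable_add i)
        show "integrable Z (\<lambda>\<xi>. \<bar>f \<xi> - Ex n f \<xi>\<bar> + \<bar>g \<xi> - Ex n g \<xi>\<bar>)"
          by (intro int_abs_diff_Ex Bochner_Integration.integrable_add i)
      qed (simp add: Ex_add[OF i])
      also have "\<dots> = (\<integral>\<xi>. \<bar>f \<xi> - Ex n f \<xi>\<bar> \<partial>Z) + (\<integral>\<xi>. \<bar>g \<xi> - Ex n g \<xi>\<bar> \<partial>Z)"
        by (rule Bochner_Integration.integral_add) (use i int_abs_diff_Ex in auto)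
      finally show "(\<integral>\<xi>. \<bar>(f \<xi> + g \<xi>) - Ex n (\<lambda>\<xi>. f \<xi> + g \<xi>) \<xi>\<bar> \<partial>Z) \<le> (\<integral>\<xi>. \<bar>f \<xi> - Ex n f \<xi>\<bar> \<partial>Z) + (\<integral>\<xi>. \<bar>g \<xi> - Ex n g \<xi>\<bar> \<partial>Z)" .
    qed
    have "(\<lambda>n. (\<integral>\<xi>. \<bar>f \<xi> - Ex n f \<xi>\<bar> \<partial>Z) + (\<integral>\<xi>. \<bar>g \<xi> - Ex n g \<xi>\<bar> \<partial>Z)) \<longlonglongrightarrow> 0 + 0"
      by (rule tendsto_add) (use assms in \<open>auto simp: approx_def\<close>)
    then show "(\<lambda>n. (\<integral>\<xi>. \<bar>f \<xi> - Ex n f \<xi>\<bar> \<partial>Z) + (\<integral>\<xi>. \<bar>g \<xi> - Ex n g \<xi>\<bar> \<partial>Z)) \<longlonglongrightarrow> 0" by simp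
  qed auto
  then show ?thesis using i by (simp add: approx_def)
qed

lemma approx_cmult: assumes "approx f" shows "approx (\<lambda>\<xi>. k * f \<xi>)"
proof -
  have "(\<integral>\<xi>. \<bar>k * f \<xi> - Ex n (\<lambda>\<xi>. k * f \<xi>) \<xi>\<bar> \<partial>Z) = \<bar>k\<bar> * (\<integral>\<xi>. \<bar>f \<xi> - Ex n f \<xi>\<bar> \<partial>Z)" for n
    by (simp add: Ex_cmult right_diff_distrib[symmetric] abs_mult)
  moreover have "(\<lambda>n. \<bar>k\<bar> * (\<integral>\<xi>. \<bar>f \<xi> - Ex n f \<xi>\<bar> \<partial>Z)) \<longlonglongrightarrow> \<bar>k\<bar> * 0"
    by (rule tendsto_mult_left) (use assms in \<open>simp add: approx_def\<close>)
  ultimately show ?thesis using assms by (simp add: approx_def)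
qed

lemma approx_limit:
  assumes f: "integrable Z f" and s: "\<And>i. approx (s i)" and lim: "(\<lambda>i. \<integral>\<xi>. \<bar>f \<xi> - s i \<xi>\<bar> \<partial>Z) \<longlonglongrightarrow> 0"
  shows "approx f"
proof -
  have si: "integrable Z (s i)" for i using s by (simp add: approx_def)
  have "(\<lambda>n. \<integral>\<xi>. \<bar>f \<xi> - Ex n f \<xi>\<bar> \<partial>Z) \<longlonglongrightarrow> 0"
  proof (rule LIMSEQ_I)
    fix e :: real assume e: "e > 0"
    obtain i where i: "(\<integral>\<xi>. \<bar>f \<xi> - s i \<xi>\<bar> \<partial>Z) < e / 3"
      using LIMSEQ_D[OF lim, of "e / 3"] e by auto
    have "(\<lambda>n. \<integral>\<xi>. \<bar>s i \<xi> - Ex n (s i) \<xi>\<bar> \<partial>Z) \<longlonglongrightarrow> 0" using s by (simp add: approx_def)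
    then obtain n0 where n0: "\<And>n. n \<ge> n0 \<Longrightarrow> (\<integral>\<xi>. \<bar>s i \<xi> - Ex n (s i) \<xi>\<bar> \<partial>Z) < e / 3"
      using LIMSEQ_D[of _ 0 "e / 3"] e by fastforce
    have "norm ((\<integral>\<xi>. \<bar>f \<xi> - Ex n f \<xi>\<bar> \<partial>Z) - 0) < e" if n: "n \<ge> n0" for n
    proof -
      let ?d = "\<lambda>\<xi>. f \<xi> - s i \<xi>"
      have d: "integrable Z ?d" using f si by auto
      have i1: "integrable Z (\<lambda>\<xi>. \<bar>?d \<xi>\<bar>)" "integrable Z (\<lambda>\<xi>. \<bar>Ex n ?d \<xi>\<bar>)"
        using d integrable_Ex by auto
      note i2 = int_abs_diff_Ex[OF si]
      \<comment> \<open>Splits the error into f minus \<open>s i\<close>, the error for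
        \<open>s i\<close>, and the average of f minus \<open>s i\<close>; the last is controlled by
        \<open>Ex_contraction\<close> uniformly in \<open>n\<close>.\<close>
      have "(\<integral>\<xi>. \<bar>f \<xi> - Ex n f \<xi>\<bar> \<partial>Z) \<le> (\<integral>\<xi>. (\<bar>?d \<xi>\<bar> + \<bar>s i \<xi> - Ex n (s i) \<xi>\<bar>) + \<bar>Ex n ?d \<xi>\<bar> \<partial>Z)"
        by (rule integral_mono)
           (use i1 i2 int_abs_diff_Ex[OF f] in \<open>auto simp: Ex_diff[OF f si] intro!: Bochner_Integration.integrable_add\<close>)
      also have "\<dots> = (\<integral>\<xi>. \<bar>?d \<xi>\<bar> \<partial>Z) + (\<integral>\<xi>. \<bar>s i \<xi> - Ex n (s i) \<xi>\<bar> \<partial>Z) + (\<integral>\<xi>. \<bar>Ex n ?d \<xi>\<bar> \<partial>Z)"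
        using i1 i2 by (subst Bochner_Integration.integral_add; (subst Bochner_Integration.integral_add)?; auto)
      also have "\<dots> < e" using i n0[OF n] Ex_contraction[OF d, of n] by simp
      finally show ?thesis by simp
    qed
    then show "\<exists>n0. \<forall>n\<ge>n0. norm ((\<integral>\<xi>. \<bar>f \<xi> - Ex n f \<xi>\<bar> \<partial>Z) - 0) < e" by blast
  qed
  then show ?thesis using f by (simp add: approx_def)
qed

lemma AE_positive: "AE \<xi> in Z. N (\<xi> n) > 0"
proof -
  interpret prob_space Z by (rule prob_space_Z)
  have "AE \<xi> in Z. \<xi> \<notin> Bd x" if "N x = 0" for x
    using that prob_eq_0[of "Bd x"] by (simp add: N_def)
  then have "AE \<xi> in Z. \<forall>x\<in>{x\<in>Lv n. N x = 0}. \<xi> \<notin> Bd x"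
    by (subst AE_ball_countable) (auto intro: countable_finite)
  moreover have "AE \<xi> in Z. \<xi> \<in> Rays" using AE_space[of Z] by simp
  ultimately show ?thesis
  proof eventually_elim
    case (elim \<xi>)
    then have "N (\<xi> n) \<noteq> 0" using Bd_ray[of \<xi> n] dep_ray[of \<xi> n] by (auto simp: Lv_def)
    then show ?case using N_nonneg[of "\<xi> n"] by linarith
  qed
qed

lemma Ex_ray: assumes "\<xi> \<in> Rays" shows "Ex n f \<xi> = Ib f (\<xi> n) / N (\<xi> n)"
proof -
  have "Ex n f \<xi> = (\<Sum>x\<in>Lv n. if x = \<xi> n then Ib f x / N x else 0)"
    unfolding Ex_def by (rule sum.cong) (use assms in \<open>auto simp: Lv_def Bd_iff indicator_def\<close>)
  also have "\<dots> = Ib f (\<xi> n) / N (\<xi> n)"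
    using dep_ray[OF assms, of n] by (subst sum.delta[OF finite_Lv]) (simp add: Lv_def)
  finally show ?thesis .
qed

text \<open>From level \<open>dep y\<close> on, the indicator is constant on every branch of the
  level, so averaging reproduces it wherever the branch has positive mass.\<close>

lemma approx_Bd: "approx (indicator (Bd y))"
proof -
  have "(\<integral>\<xi>. \<bar>indicator (Bd y) \<xi> - Ex n (indicator (Bd y)) \<xi>\<bar> \<partial>Z) = 0" if n: "n \<ge> dep y" for n
  proof -
    have "(\<integral>\<xi>. \<bar>indicator (Bd y) \<xi> - Ex n (indicator (Bd y)) \<xi>\<bar> \<partial>Z) = (\<integral>\<xi>. 0 \<partial>Z)"
    proof (rule integral_cong_AE)
      have "AE \<xi> in Z. \<xi> \<in> Rays" using AE_space[of Z] by simp
      then show "AE \<xi> in Z. \<bar>indicator (Bd y) \<xi> - Ex n (indicator (Bd y)) \<xi>\<bar> = 0"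
        using AE_positive[of n]
      proof eventually_elim
        case (elim \<xi>)
        let ?x = "\<xi> n"
        have "Ib (indicator (Bd y)) ?x = indicator (Bd y) \<xi> * N ?x"
        proof (cases "\<xi> \<in> Bd y")
          case True
          then have "Bd ?x \<subseteq> Bd y"
            using Bd_mono[OF Bd_inter_br[OF True Bd_ray[OF elim(1)]]] n dep_ray[OF elim(1)] by simp
          then have "(\<lambda>\<eta>. indicator (Bd ?x) \<eta> * indicator (Bd y) \<eta>) = (indicator (Bd ?x) :: _ \<Rightarrow> real)"
            by (intro ext) (auto split: split_indicator)
          then show ?thesis using True by (simp add: Ib_def)
        next
          case False
          have "\<not> in_branch rt par y ?x" using False Bd_mono Bd_ray[OF elim(1)] by blast
          then have "Bd ?x \<inter> Bd y = {}"
            using Bd_inter_br n dep_ray[OF elim(1)] by fastforce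
          then have "(\<lambda>\<eta>. indicator (Bd ?x) \<eta> * indicator (Bd y) \<eta>) = (\<lambda>\<eta>. 0 :: real)"
            by (intro ext) (auto split: split_indicator)
          then show ?thesis using False by (simp add: Ib_def)
        qed
        then show ?case using elim by (simp add: Ex_ray)
      qed
    qed (use integrable_Ex[THEN borel_measurable_integrable] in auto)
    then show ?thesis by simp
  qed
  then have "\<forall>\<^sub>F n in sequentially. (\<integral>\<xi>. \<bar>indicator (Bd y) \<xi> - Ex n (indicator (Bd y)) \<xi>\<bar> \<partial>Z) = 0"
    by (auto simp: eventually_sequentially)
  then show ?thesis using integrable_Bd by (simp add: approx_def tendsto_eventually)
qed

lemma approx_cong: "approx f \<Longrightarrow> (\<And>\<xi>. \<xi> \<in> Rays \<Longrightarrow> f \<xi> = g \<xi>) \<Longrightarrow> approx g"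
proof -
  assume a: "approx f" "\<And>\<xi>. \<xi> \<in> Rays \<Longrightarrow> f \<xi> = g \<xi>"
  have i: "integrable Z g" using a Bochner_Integration.integrable_cong[of Z Z f g] by (simp add: approx_def)
  have "Ib f x = Ib g x" for x unfolding Ib_def by (rule Bochner_Integration.integral_cong) (use a in auto)
  then have "Ex n f = Ex n g" for n by (simp add: Ex_def[abs_def])
  then have "(\<integral>\<xi>. \<bar>f \<xi> - Ex n f \<xi>\<bar> \<partial>Z) = (\<integral>\<xi>. \<bar>g \<xi> - Ex n g \<xi>\<bar> \<partial>Z)" for n
    by (intro Bochner_Integration.integral_cong) (use a in auto)
  then show ?thesis using a i by (simp add: approx_def)
qed

text \<open>Dynkin's argument: closure under complements and disjoint unions follows from linearity
  and \<open>approx_limit\<close>.\<close>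

lemma approx_indicator: "A \<in> sets ES \<Longrightarrow> approx (indicator A)"
proof -
  assume "A \<in> sets ES"
  interpret prob_space Z by (rule prob_space_Z)
  have zero: "approx (\<lambda>_. 0)" using approx_cmult[OF approx_Bd, of 0] by simp
  have A: "A \<in> sigma_sets Rays (insert {} (range Bd))"
    using \<open>A \<in> sets ES\<close> sigma_sets_mono'[of "range Bd" "insert {} (range Bd)" Rays] unfolding sets_ES by blast
  have S: "sigma_sets Rays (insert {} (range Bd)) = sets ES"
  proof
    show "sigma_sets Rays (insert {} (range Bd)) \<subseteq> sets ES"
    proof -
      have "insert {} (range Bd) \<subseteq> sets ES" by auto
      from sets.sigma_sets_subset[OF this] show ?thesis unfolding space_ES .
    qed
    show "sets ES \<subseteq> sigma_sets Rays (insert {} (range Bd))"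
      unfolding sets_ES by (rule sigma_sets_mono') auto
  qed
  have st: "Int_stable (insert {} (range Bd))"
  proof (rule Int_stableI)
    fix a b assume "a \<in> insert {} (range Bd)" "b \<in> insert {} (range Bd)"
    then consider "a = {} \<or> b = {}" | x y where "a = Bd x" "b = Bd y" by auto
    then show "a \<inter> b \<in> insert {} (range Bd)"
    proof cases
      case 2 then show ?thesis using Bd_Int[of x y] by (metis insertCI rangeI)
    qed auto
  qed
  have "insert {} (range Bd) \<subseteq> Pow Rays" using Bd_subset by auto
  from st this A show ?thesis
  proof (induct rule: sigma_sets_induct_disjoint)
    case (basic A) then show ?case using approx_Bd zero by (auto simp: indicator_def[abs_def])
  next
    case empty show ?case using zero by (simp add: indicator_def[abs_def])
  next
    case (compl A)
    have "approx (\<lambda>\<xi>. indicator Rays \<xi> + (-1) * indicator A \<xi>)"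
      by (rule approx_add[OF _ approx_cmult[OF compl(2)]]) (use approx_Bd[of rt] in simp)
    then show ?case by (rule approx_cong) (auto split: split_indicator)
  next
    case (union A)
    have As: "A i \<in> sets ES" for i using union(2) S by auto
    have fin: "approx (indicator (\<Union>i<n. A i))" for n
    proof (induction n)
      case (Suc n)
      have "approx (\<lambda>\<xi>. indicator (\<Union>i<n. A i) \<xi> + indicator (A n) \<xi>)"
        by (rule approx_add[OF Suc union(3)])
      moreover have "(\<Union>i<n. A i) \<inter> A n = {}"
        using union(1) unfolding disjoint_family_on_def by (auto simp: less_le disjoint_iff)
      ultimately show ?case
        by (elim approx_cong) (auto simp: lessThan_Suc split: split_indicator)
    qed (simp add: zero indicator_def[abs_def])
    show ?case
    proof (rule approx_limit[OF _ fin])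
      show "integrable Z (indicator (\<Union>i. A i) :: _ \<Rightarrow> real)"
        using As by (intro integrable_real_indicator) (auto simp: emeasure_eq_measure)
      have "(\<lambda>n. \<integral>\<xi>. \<bar>indicator (\<Union>i. A i) \<xi> - indicator (\<Union>i<n. A i) \<xi> :: real\<bar> \<partial>Z) \<longlonglongrightarrow> (\<integral>\<xi>. (0 :: real) \<partial>Z)"
      proof (rule integral_dominated_convergence[where w = "\<lambda>_. 1"])
        show "AE \<xi> in Z. (\<lambda>n. \<bar>indicator (\<Union>i. A i) \<xi> - indicator (\<Union>i<n. A i) \<xi>\<bar>) \<longlonglongrightarrow> (0 :: real)"
        proof (rule AE_I2)
          fix \<xi>
          have "(\<lambda>n. \<bar>indicator (\<Union>i. A i) \<xi> - indicator (\<Union>i<n. A i) \<xi>\<bar>) \<longlonglongrightarrow> \<bar>indicator (\<Union>i. A i) \<xi> - indicator (\<Union>i. A i) \<xi> :: real\<bar>"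
            by (intro tendsto_intros LIMSEQ_indicator_UN)
          then show "(\<lambda>n. \<bar>indicator (\<Union>i. A i) \<xi> - indicator (\<Union>i<n. A i) \<xi>\<bar>) \<longlonglongrightarrow> (0 :: real)" by simp
        qed
      qed (use As in \<open>auto split: split_indicator\<close>)
      then show "(\<lambda>n. \<integral>\<xi>. \<bar>indicator (\<Union>i. A i) \<xi> - indicator (\<Union>i<n. A i) \<xi> :: real\<bar> \<partial>Z) \<longlonglongrightarrow> 0" by simp
    qed
  qed
qed

lemma approx_integrable:
  fixes f :: "(nat \<Rightarrow> 'a) \<Rightarrow> real"
  shows "integrable Z f \<Longrightarrow> approx f"
proof (induct rule: integrable_induct)
  case (base A k)
  then have "approx (indicator A)" by (intro approx_indicator) simp
  from approx_cmult[OF this, of k] show ?case by (simp add: mult.commute)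
next
  case (add f g)
  then show ?case by (intro approx_add)
next
  case (lim f s)
  have fm: "f \<in> borel_measurable Z" "\<And>i. s i \<in> borel_measurable Z"
    by (rule borel_measurable_integrable[OF lim(5)], rule borel_measurable_integrable[OF lim(1)])
  have "(\<lambda>i. \<integral>\<xi>. \<bar>f \<xi> - s i \<xi>\<bar> \<partial>Z) \<longlonglongrightarrow> (\<integral>\<xi>. 0 \<partial>Z)"
  proof (rule integral_dominated_convergence[where w = "\<lambda>\<xi>. 3 * \<bar>f \<xi>\<bar>"])
    show "integrable Z (\<lambda>\<xi>. 3 * \<bar>f \<xi>\<bar>)" using lim(5) by auto
    show "AE \<xi> in Z. (\<lambda>i. \<bar>f \<xi> - s i \<xi>\<bar>) \<longlonglongrightarrow> 0"
    proof (rule AE_I2)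
      fix \<xi> assume "\<xi> \<in> space Z"
      then have "(\<lambda>i. \<bar>f \<xi> - s i \<xi>\<bar>) \<longlonglongrightarrow> \<bar>f \<xi> - f \<xi>\<bar>" by (intro tendsto_intros lim(3))
      then show "(\<lambda>i. \<bar>f \<xi> - s i \<xi>\<bar>) \<longlonglongrightarrow> 0" by simp
    qed
    show "AE \<xi> in Z. norm \<bar>f \<xi> - s i \<xi>\<bar> \<le> 3 * \<bar>f \<xi>\<bar>" for i
    proof (rule AE_I2)
      fix \<xi> assume "\<xi> \<in> space Z"
      from lim(4)[OF this, of i] show "norm \<bar>f \<xi> - s i \<xi>\<bar> \<le> 3 * \<bar>f \<xi>\<bar>" by simp
    qed
  qed (use fm in auto)
  then show ?case by (intro approx_limit[OF lim(5) lim(2)]) simp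
qed

end

section \<open>Square integrability\<close>

context boundary_function
begin

definition Qn :: "nat \<Rightarrow> real" where "Qn n = (\<Sum>x\<in>Lv n. q x)"

lemma I_Ib: "I = Ib \<phi>" by (simp add: fun_eq_iff I_def Ib_def)

lemma Qn_integral:
  "has_bochner_integral Z (\<lambda>\<xi>. (Ex n \<phi> \<xi>)\<^sup>2) (Qn n)"
proof -
  have sq: "(Ex n \<phi> \<xi>)\<^sup>2 = (\<Sum>x\<in>Lv n. (I x / N x)\<^sup>2 * indicator (Bd x) \<xi>)" if "\<xi> \<in> Rays" for \<xi>
  proof -
    have "(\<Sum>x\<in>Lv n. (I x / N x)\<^sup>2 * indicator (Bd x) \<xi>) = (\<Sum>x\<in>Lv n. if x = \<xi> n then (I x / N x)\<^sup>2 else 0)"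
      by (rule sum.cong) (use that in \<open>auto simp: Lv_def Bd_iff indicator_def\<close>)
    also have "\<dots> = (I (\<xi> n) / N (\<xi> n))\<^sup>2"
      using dep_ray[OF that, of n] by (subst sum.delta[OF finite_Lv]) (simp add: Lv_def)
    finally show ?thesis by (simp add: Ex_ray[OF that] I_Ib)
  qed
  have hb: "has_bochner_integral Z (indicator (Bd x) :: _ \<Rightarrow> real) (N x)" for x
    using has_bochner_integral_integrable[OF integrable_Bd[of x]] by (simp only: integral_Bd)
  have "has_bochner_integral Z (\<lambda>\<xi>. \<Sum>x\<in>Lv n. (I x / N x)\<^sup>2 * indicator (Bd x) \<xi>) (\<Sum>x\<in>Lv n. (I x / N x)\<^sup>2 * N x)"
    by (intro has_bochner_integral_sum has_bochner_integral_mult_right hb)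
  also have "(\<Sum>x\<in>Lv n. (I x / N x)\<^sup>2 * N x) = Qn n"
    unfolding Qn_def by (intro sum.cong refl) (auto simp: q_def power2_eq_square)
  finally show ?thesis
    by (rule has_bochner_integral_cong[THEN iffD1, rotated -1]) (auto simp: sq)
qed

lemma Qn_Suc: "Qn (Suc n) = Qn n + (\<Sum>y\<in>Lv n. V y)"
  unfolding Qn_def sum_Lv_Suc sum.distrib[symmetric] by (simp add: V_def)

lemma Qn_mono: "incseq Qn"
  by (rule incseq_SucI) (simp add: Qn_Suc sum_nonneg V_nonneg)

end

context tree_walk
begin

lemma c_rt_le: "c rt \<le> c x"
  by (induction x rule: vertex_induct) (use c_par_le order_trans in blast)+

lemma c_desc: "v \<in> desc x j \<Longrightarrow> c x \<le> c v"
proof (induction j arbitrary: v)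
  case (Suc j)
  then show ?case using desc_Suc_rt[OF Suc(2)] c_par_le[of v] by (meson order_trans)
qed simp

end

context dirichlet_function
begin

text \<open>The weights are at least \<open>c rt\<close>, so the bound on \<open>Wn\<close> bounds
  the unweighted variances.\<close>

lemma Qn_le: "Qn n \<le> Qn 0 + E / c rt"
proof -
  have "c rt * (Qn n - Qn 0) \<le> Wn n"
  proof (induction n)
    case (Suc n)
    have "c rt * (\<Sum>y\<in>Lv n. V y) \<le> (\<Sum>y\<in>Lv n. c y * V y)"
      unfolding sum_distrib_left by (intro sum_mono mult_right_mono c_rt_le V_nonneg)
    then show ?case using Suc by (simp add: Qn_Suc Wn_def algebra_simps)
  qed (simp add: Wn_def)
  also have "\<dots> \<le> E" by (rule Wn_le)
  finally show ?thesis using c_pos[of rt] by (simp add: field_simps)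
qed

text \<open>L1 convergence gives an almost everywhere convergent subsequence of averages, and
  Fatou's lemma along it bounds the second moment of \<phi>. Comparing with the limit of
  \<open>Qn\<close>, and not with some upper bound, is what makes the total variance vanish in
  \<open>R_tendsto\<close>.\<close>

lemma Qn_limit: "\<exists>L. Qn \<longlonglongrightarrow> L \<and> integrable Z (\<lambda>\<xi>. (\<phi> \<xi>)\<^sup>2) \<and> (\<integral>\<xi>. (\<phi> \<xi>)\<^sup>2 \<partial>Z) \<le> L"
proof -
  obtain L where L: "Qn \<longlonglongrightarrow> L" using incseq_convergent[OF Qn_mono] Qn_le by metis
  have "approx \<phi>" by (rule approx_integrable[OF phi_int])
  then have "(\<lambda>n. \<integral>\<xi>. norm (\<phi> \<xi> - Ex n \<phi> \<xi>) \<partial>Z) \<longlonglongrightarrow> 0" by (simp add: approx_def)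
  from tendsto_L1_AE_subseq[OF _ this] phi_int integrable_Ex
  obtain r where r: "strict_mono r" "AE \<xi> in Z. (\<lambda>n. \<phi> \<xi> - Ex (r n) \<phi> \<xi>) \<longlonglongrightarrow> 0"
    by auto
  have mE: "Ex n \<phi> \<in> borel_measurable Z" for n by (rule borel_measurable_integrable[OF integrable_Ex])
  have mphi: "\<phi> \<in> borel_measurable Z" by (rule borel_measurable_integrable[OF phi_int])
  have L0: "L \<ge> 0" using L by (rule LIMSEQ_le_const) (auto simp: Qn_def sum_nonneg q_nonneg)
  have "(\<integral>\<^sup>+ \<xi>. ennreal ((\<phi> \<xi>)\<^sup>2) \<partial>Z) = (\<integral>\<^sup>+ \<xi>. liminf (\<lambda>n. ennreal ((Ex (r n) \<phi> \<xi>)\<^sup>2)) \<partial>Z)"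
  proof (rule nn_integral_cong_AE, use r(2) in eventually_elim)
    fix \<xi> assume "(\<lambda>n. \<phi> \<xi> - Ex (r n) \<phi> \<xi>) \<longlonglongrightarrow> 0"
    then have "(\<lambda>n. \<phi> \<xi> - (\<phi> \<xi> - Ex (r n) \<phi> \<xi>)) \<longlonglongrightarrow> \<phi> \<xi> - 0" by (intro tendsto_intros)
    then have "(\<lambda>n. (Ex (r n) \<phi> \<xi>)\<^sup>2) \<longlonglongrightarrow> (\<phi> \<xi>)\<^sup>2" by (intro tendsto_intros) simp
    then have "(\<lambda>n. ennreal ((Ex (r n) \<phi> \<xi>)\<^sup>2)) \<longlonglongrightarrow> ennreal ((\<phi> \<xi>)\<^sup>2)" by (rule tendsto_ennrealI)
    then show "ennreal ((\<phi> \<xi>)\<^sup>2) = liminf (\<lambda>n. ennreal ((Ex (r n) \<phi> \<xi>)\<^sup>2))"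
      by (rule lim_imp_Liminf[OF sequentially_bot, symmetric])
  qed
  also have "\<dots> \<le> liminf (\<lambda>n. \<integral>\<^sup>+ \<xi>. ennreal ((Ex (r n) \<phi> \<xi>)\<^sup>2) \<partial>Z)"
    by (rule nn_integral_liminf) (use mE in measurable)
  also have "\<dots> = liminf (\<lambda>n. ennreal (Qn (r n)))"
  proof -
    have "(\<integral>\<^sup>+ \<xi>. ennreal ((Ex n \<phi> \<xi>)\<^sup>2) \<partial>Z) = ennreal (Qn n)" for n
      using nn_integral_eq_integral[of Z "\<lambda>\<xi>. (Ex n \<phi> \<xi>)\<^sup>2"] Qn_integral[of n]
      by (auto simp: has_bochner_integral_iff)
    then show ?thesis by simp
  qed
  also have "\<dots> = ennreal L"
  proof (rule lim_imp_Liminf[OF sequentially_bot])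
    show "(\<lambda>n. ennreal (Qn (r n))) \<longlonglongrightarrow> ennreal L"
      using LIMSEQ_subseq_LIMSEQ[OF L r(1)] by (intro tendsto_ennrealI) (simp add: o_def)
  qed
  finally have le: "(\<integral>\<^sup>+ \<xi>. ennreal ((\<phi> \<xi>)\<^sup>2) \<partial>Z) \<le> ennreal L" .
  have int: "integrable Z (\<lambda>\<xi>. (\<phi> \<xi>)\<^sup>2)"
    by (rule integrableI_nonneg) (use mphi le in \<open>auto intro: le_less_trans\<close>)
  have "ennreal (\<integral>\<xi>. (\<phi> \<xi>)\<^sup>2 \<partial>Z) \<le> ennreal L"
    using le nn_integral_eq_integral[OF int] by simp
  then have "(\<integral>\<xi>. (\<phi> \<xi>)\<^sup>2 \<partial>Z) \<le> L" using L0 by simp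
  then show ?thesis using L int by blast
qed

lemma sq_int: "integrable Z (\<lambda>\<xi>. (\<phi> \<xi>)\<^sup>2)" using Qn_limit by blast

definition M :: "'a \<Rightarrow> real" where "M x = Ib (\<lambda>\<xi>. (\<phi> \<xi>)\<^sup>2) x"
text \<open>The integral over the branch of the squared deviation of \<phi> from its average there,
  and 0 on null branches.\<close>

definition R :: "'a \<Rightarrow> real" where "R x = M x - q x"

lemma M_ch: "(\<Sum>x\<in>ch y. M x) = M y"
proof -
  interpret f: boundary_function rt par p "\<lambda>\<xi>. (\<phi> \<xi>)\<^sup>2" using sq_int by unfold_locales
  show ?thesis using f.I_ch[of y] by (simp add: M_def f.I_Ib)
qed

lemma M_zero: "N x = 0 \<Longrightarrow> M x = 0"
proof -
  interpret f: boundary_function rt par p "\<lambda>\<xi>. (\<phi> \<xi>)\<^sup>2" using sq_int by unfold_locales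
  show "N x = 0 \<Longrightarrow> M x = 0" using f.I_zero[of x] by (simp add: M_def f.I_Ib)
qed

lemma R_ch: "(\<Sum>x\<in>ch y. R x) = R y - V y"
  by (simp add: R_def V_def sum_subtractf M_ch)

lemma R_nonneg: "R x \<ge> 0"
proof (cases "N x = 0")
  case True then show ?thesis using M_zero[OF True] by (simp add: R_def q_def)
next
  case False
  define z where "z = I x / N x"
  have i: "integrable Z (\<lambda>\<xi>. indicator (Bd x) \<xi> * (\<phi> \<xi>)\<^sup>2)" "integrable Z (\<lambda>\<xi>. 2 * z * (indicator (Bd x) \<xi> * \<phi> \<xi>))"
     "integrable Z (\<lambda>\<xi>. z\<^sup>2 * indicator (Bd x) \<xi>)"
    using int_ind[OF sq_int] int_ind[OF phi_int] integrable_Bd by auto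
  have "0 \<le> (\<integral>\<xi>. indicator (Bd x) \<xi> * (\<phi> \<xi> - z)\<^sup>2 \<partial>Z)" by (rule integral_nonneg_AE) simp
  also have "\<dots> = (\<integral>\<xi>. indicator (Bd x) \<xi> * (\<phi> \<xi>)\<^sup>2 - 2 * z * (indicator (Bd x) \<xi> * \<phi> \<xi>) + z\<^sup>2 * indicator (Bd x) \<xi> \<partial>Z)"
    by (rule Bochner_Integration.integral_cong) (auto simp: power2_eq_square algebra_simps)
  also have "\<dots> = M x - 2 * z * I x + z\<^sup>2 * N x"
    using i by (simp add: M_def I_Ib Ib_def integral_Bd Bochner_Integration.integral_add Bochner_Integration.integral_diff)
  also have "\<dots> = R x" using False by (simp add: R_def q_def z_def power2_eq_square)
  finally show ?thesis .
qed

lemma sum_R: "(\<Sum>x\<in>Lv n. R x) = (\<integral>\<xi>. (\<phi> \<xi>)\<^sup>2 \<partial>Z) - Qn n"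
  unfolding R_def sum_subtractf Qn_def M_def Ib_Lv[OF sq_int] ..

lemma R_tendsto: "(\<lambda>n. \<Sum>x\<in>Lv n. R x) \<longlonglongrightarrow> 0"
proof -
  obtain L where L: "Qn \<longlonglongrightarrow> L" "(\<integral>\<xi>. (\<phi> \<xi>)\<^sup>2 \<partial>Z) \<le> L" using Qn_limit by blast
  have lim: "(\<lambda>n. \<Sum>x\<in>Lv n. R x) \<longlonglongrightarrow> (\<integral>\<xi>. (\<phi> \<xi>)\<^sup>2 \<partial>Z) - L"
    unfolding sum_R by (intro tendsto_intros L(1))
  then have "0 \<le> (\<integral>\<xi>. (\<phi> \<xi>)\<^sup>2 \<partial>Z) - L"
    by (rule LIMSEQ_le_const) (auto simp: sum_nonneg R_nonneg)
  then show ?thesis using lim L(2) by simp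
qed

text \<open>Since \<open>c\<close> may be unbounded, \<open>R_tendsto\<close> alone does not
  suffice. The remainder is compared with the tail of the weighted variances instead.\<close>

lemma weighted_R_tendsto: "(\<lambda>n. \<Sum>x\<in>Lv n. c x * R x) \<longlonglongrightarrow> 0"
proof -
  have bound: "(\<Sum>x\<in>Lv n. c x * R x) \<le> E - Wn n" for n
  proof -
    \<comment> \<open>The variance is resolved into finer generations while each descendant keeps
      the weight of its ancestor at level \<open>n\<close>. As \<open>c\<close> grows downwards, the
      variance released at each step is dominated by the corresponding term of
      \<open>Wn\<close>.\<close>
    define B where "B m = (\<Sum>x\<in>Lv n. \<Sum>v\<in>desc x m. c x * R v)" for m
    have step: "B m \<le> (\<Sum>v\<in>Lv (n + m). c v * V v) + B (Suc m)" for m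
    proof -
      have "B m = (\<Sum>x\<in>Lv n. \<Sum>v\<in>desc x m. c x * V v) + B (Suc m)"
        unfolding B_def sum_desc_Suc sum.distrib[symmetric]
        by (intro sum.cong refl) (simp add: sum_distrib_left[symmetric] R_ch algebra_simps)
      moreover have "(\<Sum>x\<in>Lv n. \<Sum>v\<in>desc x m. c x * V v) \<le> (\<Sum>x\<in>Lv n. \<Sum>v\<in>desc x m. c v * V v)"
        by (intro sum_mono mult_right_mono c_desc V_nonneg)
      ultimately show ?thesis unfolding sum_Lv_desc by linarith
    qed
    have iter: "B 0 \<le> Wn (n + m) - Wn n + B m" for m
    proof (induction m)
      case (Suc m)
      then show ?case using step[of m] by (simp add: Wn_def)
    qed simp
    define C where "C = (\<Sum>x\<in>Lv n. c x)"
    have B_le: "B m \<le> C * (\<Sum>v\<in>Lv (n + m). R v)" for m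
    proof -
      have "B m \<le> (\<Sum>x\<in>Lv n. \<Sum>v\<in>desc x m. C * R v)"
        unfolding B_def C_def
        by (intro sum_mono mult_right_mono R_nonneg member_le_sum) (auto simp: less_imp_le c_pos)
      then show ?thesis unfolding sum_Lv_desc by (simp add: sum_distrib_left)
    qed
    have "(\<lambda>m. Wn (n + m) - Wn n + C * (\<Sum>v\<in>Lv (n + m). R v)) \<longlonglongrightarrow> E - Wn n + C * 0"
      using LIMSEQ_ignore_initial_segment[OF Wn_tendsto, of n] LIMSEQ_ignore_initial_segment[OF R_tendsto, of n]
      by (intro tendsto_intros) (simp_all add: add.commute)
    moreover have "B 0 \<le> Wn (n + m) - Wn n + C * (\<Sum>v\<in>Lv (n + m). R v)" for m
      using iter[of m] B_le[of m] by simp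
    ultimately have "B 0 \<le> E - Wn n + C * 0" by (intro LIMSEQ_le_const) auto
    then show ?thesis by (simp add: B_def)
  qed
  have "(\<lambda>n. E - Wn n) \<longlonglongrightarrow> E - E" by (intro tendsto_intros Wn_tendsto)
  then have "(\<lambda>n. E - Wn n) \<longlonglongrightarrow> 0" by simp
  from tendsto_sandwich[OF _ _ tendsto_const this] bound
  show ?thesis by (simp add: sum_nonneg R_nonneg c_pos less_imp_le)
qed

end

section \<open>The Naim kernel as a sum over vertices\<close>

lemma integral_prod:
  fixes f :: "'b \<Rightarrow> real" and g :: "'c \<Rightarrow> real"
  assumes "sigma_finite_measure A" "sigma_finite_measure B" and f: "integrable A f" and g: "integrable B g"
  shows "has_bochner_integral (A \<Otimes>\<^sub>M B) (\<lambda>(x, y). f x * g y) ((\<integral>x. f x \<partial>A) * (\<integral>y. g y \<partial>B))"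
proof -
  interpret pair_sigma_finite A B using assms(1,2) by (simp add: pair_sigma_finite_def)
  have [measurable]: "f \<in> borel_measurable A" "g \<in> borel_measurable B" using f g by auto
  have i: "integrable (A \<Otimes>\<^sub>M B) (\<lambda>(x, y). f x * g y)"
  proof (rule Fubini_integrable)
    show "integrable A (\<lambda>x. \<integral>y. norm (case (x, y) of (x, y) \<Rightarrow> f x * g y) \<partial>B)"
      using f by (simp add: abs_mult)
    show "AE x in A. integrable B (\<lambda>y. case (x, y) of (x, y) \<Rightarrow> f x * g y)"
      using g by simp
  qed measurable
  have "(\<integral>x. f x \<partial>A) * (\<integral>y. g y \<partial>B) = integral\<^sup>L (A \<Otimes>\<^sub>M B) (\<lambda>(x, y). f x * g y)"
    using integral_fst[OF i] by simp
  with i show ?thesis by (simp add: has_bochner_integral_iff)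
qed

context tree_walk
begin

text \<open>\<open>Th v\<close> is the common value of the Naim kernel at all pairs of ends with confluent \<open>v\<close>, and \<open>t\<close> its
  increment along an edge, so that the kernel at \<open>(\<xi>, \<eta>)\<close> is the sum of \<open>t\<close> over the common vertices
  of the two rays; \<open>ThK\<close> truncates this sum.\<close>

definition Th :: "'a \<Rightarrow> real" where "Th v = c v / F rt v"
definition t :: "'a \<Rightarrow> real" where "t x = (if x = rt then Th rt else Th x - Th (par x))"
definition c' :: "'a \<Rightarrow> real" where "c' x = (if x = rt then c rt else c x - c (par x))"
definition ThK :: "nat \<Rightarrow> (nat \<Rightarrow> 'a) \<Rightarrow> (nat \<Rightarrow> 'a) \<Rightarrow> real" where
  "ThK J \<xi> \<eta> = (\<Sum>k\<le>J. \<Sum>x\<in>Lv k. t x * (indicator (Bd x) \<xi> * indicator (Bd x) \<eta>))"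
abbreviation naim :: "(nat \<Rightarrow> 'a) \<Rightarrow> (nat \<Rightarrow> 'a) \<Rightarrow> real" where "naim \<equiv> naim_kernel rt par p"

lemma t_step: "x \<noteq> rt \<Longrightarrow> t x = c x * ((1 - F x (par x) * F (par x) x) / F rt x)"
  using F_from_rt_step[of x] F_from_rt_pos[of "par x"] F_adj_pos(2)[of x]
  by (simp add: t_def Th_def c_step field_simps)

lemma t_nonneg: "t x \<ge> 0"
proof (cases "x = rt")
  case True then show ?thesis using c_pos[of rt] by (simp add: t_def Th_def)
next
  case False
  have "F x (par x) * F (par x) x \<le> 1" using F_le_1 by (intro mult_le_one) auto
  then show ?thesis using t_step[OF False] c_pos[of x] F_from_rt_pos[of x] by simp
qed

lemma N_t: "N x * t x = c' x"
proof (cases "x = rt")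
  case True then show ?thesis by (simp add: t_def Th_def c'_def N_rt)
next
  case False
  have "N x * t x = c x * ((1 - F x (par x) * F (par x) x) * N x / F rt x)"
    unfolding t_step[OF False] by simp
  also have "(1 - F x (par x) * F (par x) x) * N x / F rt x = 1 - F x (par x)" using edge_prob[OF False] by simp
  finally show ?thesis using False by (simp add: c'_def c_step algebra_simps)
qed

lemma naim_Th: "\<xi> \<noteq> \<eta> \<Longrightarrow> naim \<xi> \<eta> = Th (confl \<xi> \<eta>)"
  by (simp add: naim_kernel_def Th_def c_def hitprob_eq_F)

lemma ThK_rays:
  assumes "\<xi> \<in> Rays" "\<eta> \<in> Rays"
  shows "ThK J \<xi> \<eta> = (\<Sum>k\<le>J. if \<xi> k = \<eta> k then t (\<xi> k) else 0)"
  unfolding ThK_def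
proof (rule sum.cong[OF refl])
  fix k
  have "(\<Sum>x\<in>Lv k. t x * (indicator (Bd x) \<xi> * indicator (Bd x) \<eta>)) = (\<Sum>x\<in>Lv k. if x = \<xi> k then (if \<xi> k = \<eta> k then t (\<xi> k) else 0) else 0)"
    by (rule sum.cong) (use assms in \<open>auto simp: Lv_def Bd_iff indicator_def\<close>)
  then show "(\<Sum>x\<in>Lv k. t x * (indicator (Bd x) \<xi> * indicator (Bd x) \<eta>)) = (if \<xi> k = \<eta> k then t (\<xi> k) else 0)"
    using dep_ray[OF assms(1), of k] by (subst (asm) sum.delta[OF finite_Lv]) (simp add: Lv_def)
qed

text \<open>Predecessors are unique, so two rays that have separated never meet again.\<close>

lemma rays_agree_iff:
  assumes r: "\<xi> \<in> Rays" "\<eta> \<in> Rays" and ne: "\<xi> \<noteq> \<eta>"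
  shows "\<xi> k = \<eta> k \<longleftrightarrow> k \<le> (LEAST k. \<xi> (Suc k) \<noteq> \<eta> (Suc k))"
proof -
  define l where "l = (LEAST k. \<xi> (Suc k) \<noteq> \<eta> (Suc k))"
  obtain j where j: "\<xi> j \<noteq> \<eta> j" using ne by auto
  then obtain i where "\<xi> (Suc i) \<noteq> \<eta> (Suc i)" using r ray_props(1) by (cases j) auto
  then have l: "\<xi> (Suc l) \<noteq> \<eta> (Suc l)" unfolding l_def by (rule LeastI)
  have down: "\<xi> (m + i) = \<eta> (m + i) \<Longrightarrow> \<xi> m = \<eta> m" for m i
    using ray_par_pow[OF r(1), of i m] ray_par_pow[OF r(2), of i m] by simp
  show ?thesis
  proof
    assume e: "\<xi> k = \<eta> k"
    show "k \<le> (LEAST k. \<xi> (Suc k) \<noteq> \<eta> (Suc k))"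
    proof (rule ccontr)
      assume "\<not> ?thesis"
      then have "\<exists>i. k = Suc l + i" unfolding l_def[symmetric] by presburger
      then show False using e down[of "Suc l"] l by metis
    qed
  next
    assume "k \<le> (LEAST k. \<xi> (Suc k) \<noteq> \<eta> (Suc k))"
    then show "\<xi> k = \<eta> k"
      \<comment> \<open>The confluent is indexed by the last common level, while the minimum is
        taken over the level after it; hence \<open>k - 1\<close>, with level 0 settled by the
        common root.\<close>
      using not_less_Least[of "k - 1" "\<lambda>k. \<xi> (Suc k) \<noteq> \<eta> (Suc k)"] r ray_props(1) by (cases k) auto
  qed
qed

lemma sum_t_ray: "\<xi> \<in> Rays \<Longrightarrow> (\<Sum>k\<le>l. t (\<xi> k)) = Th (\<xi> l)"
  by (induction l) (simp_all add: t_def ray_props)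

text \<open>Off the diagonal the truncated kernel is stationary from the level of the confluent on.
  On the diagonal the squared difference is 0, whatever the growth of the kernel.\<close>

lemma ThK_tendsto:
  assumes r: "\<xi> \<in> Rays" "\<eta> \<in> Rays"
  shows "(\<lambda>J. (\<phi> \<xi> - \<phi> \<eta>)\<^sup>2 * ThK J \<xi> \<eta>) \<longlonglongrightarrow> (\<phi> \<xi> - \<phi> \<eta>)\<^sup>2 * naim \<xi> \<eta>"
proof (cases "\<xi> = \<eta>")
  case False
  define l where "l = (LEAST k. \<xi> (Suc k) \<noteq> \<eta> (Suc k))"
  have agree: "\<xi> k = \<eta> k \<longleftrightarrow> k \<le> l" for k
    unfolding l_def by (rule rays_agree_iff[OF r False])
  have "ThK J \<xi> \<eta> = naim \<xi> \<eta>" if J: "J \<ge> l" for J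
  proof -
    have "ThK J \<xi> \<eta> = (\<Sum>k\<le>J. if k \<le> l then t (\<xi> k) else 0)"
      unfolding ThK_rays[OF r] agree ..
    also have "\<dots> = (\<Sum>k\<le>l. t (\<xi> k))"
      by (rule sum.mono_neutral_cong_right) (use J in auto)
    finally show ?thesis using sum_t_ray[OF r(1)] naim_Th[OF False] by (simp add: confl_def l_def)
  qed
  then have "\<forall>\<^sub>F J in sequentially. (\<phi> \<xi> - \<phi> \<eta>)\<^sup>2 * ThK J \<xi> \<eta> = (\<phi> \<xi> - \<phi> \<eta>)\<^sup>2 * naim \<xi> \<eta>"
    unfolding eventually_sequentially by auto
  then show ?thesis by (rule tendsto_eventually)
qed simp

end

context dirichlet_function
begin

abbreviation ZZ :: "((nat \<Rightarrow> 'a) \<times> (nat \<Rightarrow> 'a)) measure" where "ZZ \<equiv> Z \<Otimes>\<^sub>M Z"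

text \<open>Square integrability is used here: the square is expanded into three product functions,
  each integrable on its own.\<close>

lemma square_cell:
  "has_bochner_integral ZZ (\<lambda>(\<xi>, \<eta>). (\<phi> \<xi> - \<phi> \<eta>)\<^sup>2 * (indicator (Bd x) \<xi> * indicator (Bd x) \<eta>)) (2 * (N x * M x - (I x)\<^sup>2))"
proof -
  have sf: "sigma_finite_measure Z"
    using finite_measure_nu finite_measure_def by blast
  let ?i = "indicator (Bd x) :: _ \<Rightarrow> real"
  note i2 = int_ind[OF sq_int, of x] and i1 = int_ind[OF phi_int, of x] and i0 = integrable_Bd[of x]
  have "has_bochner_integral ZZ (\<lambda>z. (case z of (\<xi>, \<eta>) \<Rightarrow> (?i \<xi> * (\<phi> \<xi>)\<^sup>2) * ?i \<eta>)
      - 2 * (case z of (\<xi>, \<eta>) \<Rightarrow> (?i \<xi> * \<phi> \<xi>) * (?i \<eta> * \<phi> \<eta>)) + (case z of (\<xi>, \<eta>) \<Rightarrow> ?i \<xi> * (?i \<eta> * (\<phi> \<eta>)\<^sup>2)))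
     (M x * N x - 2 * (I x * I x) + N x * M x)"
    using integral_prod[OF sf sf i2 i0] integral_prod[OF sf sf i1 i1] integral_prod[OF sf sf i0 i2]
    unfolding integral_Bd M_def I_Ib Ib_def
    by (intro has_bochner_integral_add has_bochner_integral_diff has_bochner_integral_mult_right)
  moreover have "(\<lambda>z. (case z of (\<xi>, \<eta>) \<Rightarrow> (?i \<xi> * (\<phi> \<xi>)\<^sup>2) * ?i \<eta>)
      - 2 * (case z of (\<xi>, \<eta>) \<Rightarrow> (?i \<xi> * \<phi> \<xi>) * (?i \<eta> * \<phi> \<eta>)) + (case z of (\<xi>, \<eta>) \<Rightarrow> ?i \<xi> * (?i \<eta> * (\<phi> \<eta>)\<^sup>2)))
     = (\<lambda>(\<xi>, \<eta>). (\<phi> \<xi> - \<phi> \<eta>)\<^sup>2 * (?i \<xi> * ?i \<eta>))"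
    by (auto simp: fun_eq_iff power2_eq_square algebra_simps)
  moreover have "M x * N x - 2 * (I x * I x) + N x * M x = 2 * (N x * M x - (I x)\<^sup>2)"
    by (simp add: power2_eq_square)
  ultimately show ?thesis by simp
qed

lemma cell_weight: "t x * (N x * M x - (I x)\<^sup>2) = c' x * R x"
proof (cases "N x = 0")
  case True
  then show ?thesis using M_zero[OF True] I_zero[OF True] by (simp add: N_t[symmetric])
next
  case False
  then have "N x * M x - (I x)\<^sup>2 = N x * R x" by (simp add: R_def q_def algebra_simps)
  then have "t x * (N x * M x - (I x)\<^sup>2) = (N x * t x) * R x" by simp
  then show ?thesis unfolding N_t .
qed

lemma sum_cells: "(\<Sum>k\<le>J. \<Sum>x\<in>Lv k. c' x * R x) = Wn J + (\<Sum>x\<in>Lv J. c x * R x)"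
proof (induction J)
  case 0 then show ?case by (simp add: Lv_0 c'_def Wn_def)
next
  case (Suc J)
  have "(\<Sum>x\<in>Lv (Suc J). c' x * R x) = (\<Sum>x\<in>Lv (Suc J). c x * R x) - (\<Sum>x\<in>Lv (Suc J). c (par x) * R x)"
    unfolding sum_subtractf[symmetric] by (intro sum.cong refl) (auto simp: c'_def Lv_Suc_rt algebra_simps)
  also have "(\<Sum>x\<in>Lv (Suc J). c (par x) * R x) = (\<Sum>y\<in>Lv J. c y * (R y - V y))"
    unfolding sum_Lv_Suc R_ch[symmetric] sum_distrib_left by (intro sum.cong refl) (simp add: ch_iff)
  finally show ?case using Suc by (simp add: Wn_def algebra_simps sum_subtractf)
qed

lemma ThK_integral:
  "has_bochner_integral ZZ (\<lambda>(\<xi>, \<eta>). (\<phi> \<xi> - \<phi> \<eta>)\<^sup>2 * ThK J \<xi> \<eta>) (2 * (Wn J + (\<Sum>x\<in>Lv J. c x * R x)))"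
proof -
  have "has_bochner_integral ZZ (\<lambda>z. \<Sum>k\<le>J. \<Sum>x\<in>Lv k. t x * (case z of (\<xi>, \<eta>) \<Rightarrow> (\<phi> \<xi> - \<phi> \<eta>)\<^sup>2 * (indicator (Bd x) \<xi> * indicator (Bd x) \<eta>)))
     (\<Sum>k\<le>J. \<Sum>x\<in>Lv k. t x * (2 * (N x * M x - (I x)\<^sup>2)))"
    by (intro has_bochner_integral_sum has_bochner_integral_mult_right square_cell)
  moreover have "(\<Sum>k\<le>J. \<Sum>x\<in>Lv k. t x * (2 * (N x * M x - (I x)\<^sup>2))) = 2 * (\<Sum>k\<le>J. \<Sum>x\<in>Lv k. c' x * R x)"
    unfolding cell_weight[symmetric] sum_distrib_left by (simp only: mult.left_commute)
  moreover have "(\<lambda>z. \<Sum>k\<le>J. \<Sum>x\<in>Lv k. t x * (case z of (\<xi>, \<eta>) \<Rightarrow> (\<phi> \<xi> - \<phi> \<eta>)\<^sup>2 * (indicator (Bd x) \<xi> * indicator (Bd x) \<eta>)))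
     = (\<lambda>(\<xi>, \<eta>). (\<phi> \<xi> - \<phi> \<eta>)\<^sup>2 * ThK J \<xi> \<eta>)"
    by (auto simp: fun_eq_iff ThK_def sum_distrib_left mult.left_commute)
  ultimately show ?thesis by (simp add: sum_cells)
qed

lemma naim_integral:
  "has_bochner_integral ZZ (\<lambda>(\<xi>, \<eta>). (\<phi> \<xi> - \<phi> \<eta>)\<^sup>2 * naim \<xi> \<eta>) (2 * E)"
proof -
  define f where "f J = (\<lambda>(\<xi>, \<eta>). (\<phi> \<xi> - \<phi> \<eta>)\<^sup>2 * ThK J \<xi> \<eta>)" for J
  have fi: "integrable ZZ (f J)" "integral\<^sup>L ZZ (f J) = 2 * (Wn J + (\<Sum>x\<in>Lv J. c x * R x))" for J
    using ThK_integral[of J] by (auto simp: f_def has_bochner_integral_iff)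
  have sp: "space ZZ = Rays \<times> Rays" by (simp add: space_pair_measure)
  have lim: "(\<lambda>J. f J z) \<longlonglongrightarrow> (case z of (\<xi>, \<eta>) \<Rightarrow> (\<phi> \<xi> - \<phi> \<eta>)\<^sup>2 * naim \<xi> \<eta>)" if "z \<in> space ZZ" for z
    using that ThK_tendsto[of "fst z" "snd z" \<phi>] by (auto simp: f_def sp)
  show ?thesis
  proof (rule has_bochner_integral_monotone_convergence[where f = f])
    show "integrable ZZ (f J)" for J by (rule fi)
    show "AE z in ZZ. mono (\<lambda>J. f J z)"
    proof (rule AE_I2)
      fix z
      show "mono (\<lambda>J. f J z)"
      proof (rule incseq_SucI)
        fix J
        have "ThK J \<xi> \<eta> \<le> ThK (Suc J) \<xi> \<eta>" for \<xi> \<eta>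
          unfolding ThK_def by (simp add: sum_nonneg t_nonneg)
        then show "f J z \<le> f (Suc J) z" by (auto simp: f_def split: prod.split intro!: mult_left_mono)
      qed
    qed
    show "AE z in ZZ. (\<lambda>J. f J z) \<longlonglongrightarrow> (case z of (\<xi>, \<eta>) \<Rightarrow> (\<phi> \<xi> - \<phi> \<eta>)\<^sup>2 * naim \<xi> \<eta>)"
      by (rule AE_I2) (rule lim)
    have "(\<lambda>J. 2 * (Wn J + (\<Sum>x\<in>Lv J. c x * R x))) \<longlonglongrightarrow> 2 * (E + 0)"
      by (intro tendsto_intros Wn_tendsto weighted_R_tendsto)
    then show "(\<lambda>J. integral\<^sup>L ZZ (f J)) \<longlonglongrightarrow> 2 * E" by (simp add: fi)
    \<comment> \<open>Measurability is inherited from the truncations as a pointwise limit, which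
      avoids arguing about \<open>confl\<close> directly.\<close>
    show "(\<lambda>(\<xi>, \<eta>). (\<phi> \<xi> - \<phi> \<eta>)\<^sup>2 * naim \<xi> \<eta>) \<in> borel_measurable ZZ"
      by (rule borel_measurable_LIMSEQ_real[OF lim]) (use fi borel_measurable_integrable in blast)+
  qed
qed

end

section \<open>Polarisation\<close>

context tree_walk
begin

lemma dirichlet_function_intro: "\<phi> \<in> dirichlet_space rt par p \<Longrightarrow> dirichlet_function rt par p \<phi>"
  by unfold_locales

lemma poisson_add: "integrable Z \<phi> \<Longrightarrow> integrable Z \<psi> \<Longrightarrow>
    poisson rt par p (\<lambda>\<xi>. \<phi> \<xi> + \<psi> \<xi>) x = poisson rt par p \<phi> x + poisson rt par p \<psi> x"
  unfolding poisson_def by (rule Bochner_Integration.integral_add) (rule integrable_nu, assumption)+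

lemma poisson_diff: "integrable Z \<phi> \<Longrightarrow> integrable Z \<psi> \<Longrightarrow>
    poisson rt par p (\<lambda>\<xi>. \<phi> \<xi> - \<psi> \<xi>) x = poisson rt par p \<phi> x - poisson rt par p \<psi> x"
  unfolding poisson_def by (rule Bochner_Integration.integral_diff) (rule integrable_nu, assumption)+

lemma dirichlet_space_closed:
  assumes phi: "\<phi> \<in> dirichlet_space rt par p" and psi: "\<psi> \<in> dirichlet_space rt par p"
  shows "(\<lambda>\<xi>. \<phi> \<xi> + \<psi> \<xi>) \<in> dirichlet_space rt par p" "(\<lambda>\<xi>. \<phi> \<xi> - \<psi> \<xi>) \<in> dirichlet_space rt par p"
proof -
  let ?d = "\<lambda>f x. poisson rt par p f x - poisson rt par p f (par x)"
  have i: "integrable Z \<phi>" "integrable Z \<psi>" using phi psi by (auto simp: dirichlet_space_def)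
  have sm: "(\<lambda>x. 2 * ((?d \<phi> x)\<^sup>2 * a x) + 2 * ((?d \<psi> x)\<^sup>2 * a x)) summable_on (UNIV - {rt})"
    by (intro summable_on_add summable_on_cmult_right) (use phi psi in \<open>auto simp: dirichlet_space_def\<close>)
  have sq: "(u + v)\<^sup>2 * w \<le> 2 * (u\<^sup>2 * w) + 2 * (v\<^sup>2 * w)" "(u - v)\<^sup>2 * w \<le> 2 * (u\<^sup>2 * w) + 2 * (v\<^sup>2 * w)"
    if "w > 0" for u v w :: real
  proof -
    have "(u + v)\<^sup>2 \<le> 2 * u\<^sup>2 + 2 * v\<^sup>2" "(u - v)\<^sup>2 \<le> 2 * u\<^sup>2 + 2 * v\<^sup>2"
      using zero_le_power2[of "u - v"] zero_le_power2[of "u + v"] by (auto simp: power2_eq_square algebra_simps)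
    then show "(u + v)\<^sup>2 * w \<le> 2 * (u\<^sup>2 * w) + 2 * (v\<^sup>2 * w)" "(u - v)\<^sup>2 * w \<le> 2 * (u\<^sup>2 * w) + 2 * (v\<^sup>2 * w)"
      using that mult_right_mono[of "(u + v)\<^sup>2" "2 * u\<^sup>2 + 2 * v\<^sup>2" w]
        mult_right_mono[of "(u - v)\<^sup>2" "2 * u\<^sup>2 + 2 * v\<^sup>2" w] by (simp_all add: distrib_right)
  qed
  have nn: "0 \<le> u\<^sup>2 * a x" if "x \<in> UNIV - {rt}" for u x
    using that a_pos[of x] by simp
  have "(\<lambda>x. (?d \<phi> x + ?d \<psi> x)\<^sup>2 * a x) summable_on (UNIV - {rt})"
    by (rule summable_on_comparison_test[OF sm]) (use sq(1) nn a_pos in blast)+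
  moreover have "(\<lambda>x. (?d \<phi> x - ?d \<psi> x)\<^sup>2 * a x) summable_on (UNIV - {rt})"
    by (rule summable_on_comparison_test[OF sm]) (use sq(2) nn a_pos in blast)+
  moreover have "?d (\<lambda>\<xi>. \<phi> \<xi> + \<psi> \<xi>) x = ?d \<phi> x + ?d \<psi> x" "?d (\<lambda>\<xi>. \<phi> \<xi> - \<psi> \<xi>) x = ?d \<phi> x - ?d \<psi> x" for x
    by (simp_all add: poisson_add[OF i] poisson_diff[OF i])
  ultimately show "(\<lambda>\<xi>. \<phi> \<xi> + \<psi> \<xi>) \<in> dirichlet_space rt par p" "(\<lambda>\<xi>. \<phi> \<xi> - \<psi> \<xi>) \<in> dirichlet_space rt par p"
    using i by (simp_all add: dirichlet_space_def)
qed

text \<open>Polarisation is applied to the sum and the difference of the two functions.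
  Integrability on the product space is part of the claim, since the iterated integral is obtained
  from it by Fubini's theorem.\<close>

lemma energy_HD_naim:
  assumes phi: "\<phi> \<in> dirichlet_space rt par p" and psi: "\<psi> \<in> dirichlet_space rt par p"
  shows "has_bochner_integral (Z \<Otimes>\<^sub>M Z) (\<lambda>(\<xi>, \<eta>). (\<phi> \<xi> - \<phi> \<eta>) * (\<psi> \<xi> - \<psi> \<eta>) * naim \<xi> \<eta>) (2 * energy_HD rt par p \<phi> \<psi>)"
proof -
  interpret s: dirichlet_function rt par p "\<lambda>\<xi>. \<phi> \<xi> + \<psi> \<xi>"
    by (rule dirichlet_function_intro[OF dirichlet_space_closed(1)[OF assms]])
  interpret d: dirichlet_function rt par p "\<lambda>\<xi>. \<phi> \<xi> - \<psi> \<xi>"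
    by (rule dirichlet_function_intro[OF dirichlet_space_closed(2)[OF assms]])
  let ?d = "\<lambda>f x. poisson rt par p f x - poisson rt par p f (par x)"
  have i: "integrable Z \<phi>" "integrable Z \<psi>" using phi psi by (auto simp: dirichlet_space_def)
  have "s.E - d.E = (\<Sum>\<^sub>\<infinity>x\<in>UNIV - {rt}. s.en x + - d.en x)"
    unfolding s.E_def d.E_def using s.en_summable d.en_summable
    by (subst infsum_add) (simp_all add: infsum_uminus summable_on_uminus)
  also have "\<dots> = (\<Sum>\<^sub>\<infinity>x\<in>UNIV - {rt}. 4 * (?d \<phi> x * ?d \<psi> x * a x))"
    by (rule infsum_cong)
       (simp add: s.en_def d.en_def poisson_add[OF i] poisson_diff[OF i] power2_eq_square algebra_simps)
  also have "\<dots> = 4 * energy_HD rt par p \<phi> \<psi>"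
    unfolding energy_HD_def energy_def by (rule infsum_cmult_right') 
  finally have e: "(2 * s.E - 2 * d.E) / 4 = 2 * energy_HD rt par p \<phi> \<psi>" by simp
  have "has_bochner_integral (Z \<Otimes>\<^sub>M Z) (\<lambda>z. ((case z of (\<xi>, \<eta>) \<Rightarrow> ((\<phi> \<xi> + \<psi> \<xi>) - (\<phi> \<eta> + \<psi> \<eta>))\<^sup>2 * naim \<xi> \<eta>)
     - (case z of (\<xi>, \<eta>) \<Rightarrow> ((\<phi> \<xi> - \<psi> \<xi>) - (\<phi> \<eta> - \<psi> \<eta>))\<^sup>2 * naim \<xi> \<eta>)) / 4) ((2 * s.E - 2 * d.E) / 4)"
    by (intro has_bochner_integral_divide_zero has_bochner_integral_diff s.naim_integral d.naim_integral)
  moreover have "(\<lambda>z. ((case z of (\<xi>, \<eta>) \<Rightarrow> ((\<phi> \<xi> + \<psi> \<xi>) - (\<phi> \<eta> + \<psi> \<eta>))\<^sup>2 * naim \<xi> \<eta>)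
     - (case z of (\<xi>, \<eta>) \<Rightarrow> ((\<phi> \<xi> - \<psi> \<xi>) - (\<phi> \<eta> - \<psi> \<eta>))\<^sup>2 * naim \<xi> \<eta>)) / 4)
    = (\<lambda>(\<xi>, \<eta>). (\<phi> \<xi> - \<phi> \<eta>) * (\<psi> \<xi> - \<psi> \<eta>) * naim \<xi> \<eta>)"
    by (auto simp: fun_eq_iff power2_eq_square algebra_simps)
  ultimately show ?thesis unfolding e by simp
qed

end

theorem theorem3p4:
  fixes rt :: 'a and par :: "'a \<Rightarrow> 'a" and p :: "'a \<Rightarrow> 'a \<Rightarrow> real"
    and \<phi> \<psi> :: "(nat \<Rightarrow> 'a) \<Rightarrow> real"
  assumes tree: "is_rooted_tree rt par"
    and locfin: "\<forall>x. finite {y. tadj rt par x y}"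
    and infinite_tree: "infinite (UNIV :: 'a set)"
    and walk: "nn_random_walk rt par p"
    and trans: "transient p"
    and phi: "\<phi> \<in> dirichlet_space rt par p"
    and psi: "\<psi> \<in> dirichlet_space rt par p"
  shows "energy_HD rt par p \<phi> \<psi> =
    1/2 * (\<integral>\<eta>. (\<integral>\<xi>. (\<phi> \<xi> - \<phi> \<eta>) * (\<psi> \<xi> - \<psi> \<eta>) * naim_kernel rt par p \<xi> \<eta>
              \<partial>limit_distr rt par p rt) \<partial>limit_distr rt par p rt)"
proof -
  interpret tree_walk rt par p
    using tree locfin walk trans by unfold_locales auto
  interpret pair_sigma_finite Z Z
    unfolding pair_sigma_finite_def using finite_measure_nu finite_measure_def by blast
  note hb = energy_HD_naim[OF phi psi, unfolded has_bochner_integral_iff]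
  \<comment> \<open>The outer integration runs over the second variable of the product.\<close>
  show ?thesis using integral_snd[OF conjunct1[OF hb]] conjunct2[OF hb] by simp
qed

end
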